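(* Let $\mathcal O$ be a bounded convex domain in $\mathbb R^d$, $d\in\mathbb N$, with smooth boundary. Let $f,f_0\in C^2(\mathcal O)$ be bounded from below by a constant $f_{min}>0$, suppose $f=f_0$ on $\mathcal O\setminus\mathcal O_0$ for some compact subset $\mathcal O_0$ of $\mathcal O$, and that $\|f\|_{C^2}+\|f_0\|_{C^2}\le U$ for some $U$. Let $D>0$. Then there exists a positive constant $C$ depending on $D,d,\mathcal O_0,\mathcal O,U,f_{min}$ such that $$\|f-f_0\|_{L^2(\mathcal O)}\le C\Big(\log\frac{1}{\|P_{D,f}-P_{D,f_0}\|_{L^2\to L^2}}\Big)^{-2/3}$$ (the right-hand side being read as $0$ when $P_{D,f}=P_{D,f_0}$). In particular, if $P_{D,f}=P_{D,f_0}$ coincide as linear operators on $L^2(\mathcal O)$ for some $D>0$, then $f=f_0$ on $\mathcal O$.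
   Context: $vol(\mathcal O)=1$. $C^2(\mathcal O)$ is the space of functions whose partial derivatives up to order $2$ are uniformly continuous on $\mathcal O$. For $f\in C^2(\mathcal O)$ with $f\ge f_{min}>0$, $\mathcal L_f\phi=\nabla\cdot(f\nabla\phi)$ with Neumann boundary conditions $\partial\phi/\partial\nu=0$ on $\partial\mathcal O$ has $L^2(\mathcal O)$-orthonormal eigenfunctions $e_{j,f}$, $\mathcal L_fe_{j,f}=-\lambda_{j,f}e_{j,f}$, $e_{0,f}=1$, $0=\lambda_0<\lambda_{1,f}\le\lambda_{2,f}\le\dots$. For $t>0$, $P_{t,f}(\phi)=\sum_{j\ge0}e^{-t\lambda_{j,f}}e_{j,f}\langle e_{j,f},\phi\rangle_{L^2}$, $\phi\in L^2(\mathcal O)$. $\|\cdot\|_{L^2\to L^2}$ is the operator norm on $L^2(\mathcal O)$. *)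

theory Defs
  imports "HOL-Analysis.Analysis"
begin

definition partial :: "'n::finite \<Rightarrow> (real^'n \<Rightarrow> real) \<Rightarrow> real^'n \<Rightarrow> real" where
  "partial i f x = frechet_derivative f (at x) (axis i 1)"

fun iter_partial :: "'n::finite list \<Rightarrow> (real^'n \<Rightarrow> real) \<Rightarrow> real^'n \<Rightarrow> real" where
  "iter_partial [] f = f"
| "iter_partial (i # is) f = partial i (iter_partial is f)"

definition gradient :: "(real^'n::finite \<Rightarrow> real) \<Rightarrow> real^'n \<Rightarrow> real^'n" where
  "gradient f x = (\<chi> i. partial i f x)"

definition smooth_on :: "(real^'n::finite) set \<Rightarrow> (real^'n \<Rightarrow> real) \<Rightarrow> bool" where
  "smooth_on V f \<longleftrightarrow> (\<forall>is. iter_partial is f differentiable_on V)"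

text \<open>
  \<open>C2 S\<close> consists of the functions on the open set \<open>S\<close> all of whose partial derivatives up to
  order 2 exist and are uniformly continuous on \<open>S\<close>. As the partial derivatives are continuous,
  asking for total differentiability in orders 0 and 1 is the same as asking for the existence of
  the next partial derivatives. Values outside \<open>S\<close> are irrelevant.
\<close>
definition C2 :: "(real^'n::finite) set \<Rightarrow> (real^'n \<Rightarrow> real) set" where
  "C2 S = {f. (\<forall>is. length is \<le> 1 \<longrightarrow> iter_partial is f differentiable_on S) \<and>
              (\<forall>is. length is \<le> 2 \<longrightarrow> uniformly_continuous_on S (iter_partial is f))}"

text \<open>
  The maximum over all partial derivatives of order at most 2 of their supremum norms. On a bounded
  set, the suprema are finite for functions in \<open>C2 S\<close>.
\<close>
definition C2_norm :: "(real^'n::finite) set \<Rightarrow> (real^'n \<Rightarrow> real) \<Rightarrow> real" where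
  "C2_norm S f =
     Max ((\<lambda>is. SUP x\<in>S. \<bar>iter_partial is f x\<bar>) ` {is. length is \<le> 2})"

text \<open>
  \<open>S\<close> is near \<open>p\<close> the sublevel set of a smooth function with nowhere vanishing gradient. For open
  \<open>S\<close> it follows that the boundary of \<open>S\<close> in \<open>V\<close> is exactly the zero set of \<open>\<rho>\<close>, and that
  \<open>gradient \<rho>\<close> is there an outward normal vector.
\<close>
definition local_defining_function ::
  "(real^'n::finite) set \<Rightarrow> real^'n \<Rightarrow> (real^'n) set \<Rightarrow> (real^'n \<Rightarrow> real) \<Rightarrow> bool" where
  "local_defining_function S p V \<rho> \<longleftrightarrow>
     open V \<and> p \<in> V \<and> smooth_on V \<rho> \<and> (\<forall>x\<in>V. gradient \<rho> x \<noteq> 0) \<and> S \<inter> V = {x\<in>V. \<rho> x < 0}"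

definition smooth_boundary :: "(real^'n::finite) set \<Rightarrow> bool" where
  "smooth_boundary S \<longleftrightarrow> (\<forall>p\<in>frontier S. \<exists>V \<rho>. local_defining_function S p V \<rho>)"

definition outer_unit_normal :: "(real^'n::finite) set \<Rightarrow> real^'n \<Rightarrow> real^'n \<Rightarrow> bool" where
  "outer_unit_normal S p \<nu> \<longleftrightarrow>
     (\<exists>V \<rho>. local_defining_function S p V \<rho> \<and> \<nu> = gradient \<rho> p /\<^sub>R norm (gradient \<rho> p))"

text \<open>
  The gradient of a function in \<open>C2 S\<close> is uniformly continuous on \<open>S\<close>, and hence has boundary
  values, which are obtained as limits from inside \<open>S\<close>.
\<close>
definition neumann_condition :: "(real^'n::finite) set \<Rightarrow> (real^'n \<Rightarrow> real) \<Rightarrow> bool" where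
  "neumann_condition S \<phi> \<longleftrightarrow>
     (\<forall>p\<in>frontier S. \<forall>\<nu>. outer_unit_normal S p \<nu> \<longrightarrow>
        ((\<lambda>x. gradient \<phi> x \<bullet> \<nu>) \<longlongrightarrow> 0) (at p within S))"

text \<open>
  Elements of \<open>L2 S\<close> are functions rather than equivalence classes, so equality in
  the Hilbert space is equality almost everywhere on \<open>S\<close>.
\<close>
definition L2 :: "(real^'n::finite) set \<Rightarrow> (real^'n \<Rightarrow> real) set" where
  "L2 S = {\<phi>. \<phi> \<in> borel_measurable (lebesgue_on S) \<and>
              integrable (lebesgue_on S) (\<lambda>x. (\<phi> x)\<^sup>2)}"

definition L2_inner :: "(real^'n::finite) set \<Rightarrow> (real^'n \<Rightarrow> real) \<Rightarrow> (real^'n \<Rightarrow> real) \<Rightarrow> real" where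
  "L2_inner S \<phi> \<psi> = (\<integral>x. \<phi> x * \<psi> x \<partial>(lebesgue_on S))"

definition L2_norm :: "(real^'n::finite) set \<Rightarrow> (real^'n \<Rightarrow> real) \<Rightarrow> real" where
  "L2_norm S \<phi> = sqrt (L2_inner S \<phi> \<phi>)"

definition L2_operator_norm ::
  "(real^'n::finite) set \<Rightarrow> ((real^'n \<Rightarrow> real) \<Rightarrow> (real^'n \<Rightarrow> real)) \<Rightarrow> real" where
  "L2_operator_norm S T = (SUP \<phi>\<in>{\<phi> \<in> L2 S. L2_norm S \<phi> \<le> 1}. L2_norm S (T \<phi>))"

definition L2_operator_eq ::
  "(real^'n::finite) set \<Rightarrow> ((real^'n \<Rightarrow> real) \<Rightarrow> (real^'n \<Rightarrow> real)) \<Rightarrow>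
     ((real^'n \<Rightarrow> real) \<Rightarrow> (real^'n \<Rightarrow> real)) \<Rightarrow> bool" where
  "L2_operator_eq S A B \<longleftrightarrow> (\<forall>\<phi>\<in>L2 S. AE x in lebesgue_on S. A \<phi> x = B \<phi> x)"

definition div_form_op :: "(real^'n::finite \<Rightarrow> real) \<Rightarrow> (real^'n \<Rightarrow> real) \<Rightarrow> real^'n \<Rightarrow> real" where
  "div_form_op f \<phi> x = (\<Sum>i\<in>UNIV. partial i (\<lambda>y. f y * partial i \<phi> y) x)"

text \<open>
  The eigenfunctions \<open>e j\<close> and eigenvalues \<open>lam j\<close> (with multiplicities) of the Neumann problem for
  \<open>\<nabla>\<cdot>(f\<nabla>\<phi>)\<close>. By elliptic regularity, for \<open>f\<close> in \<open>C2 S\<close> bounded away from zero and smooth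
  boundary, every eigenfunction has a version in \<open>C2 S\<close>, for which the eigenvalue equation and the
  boundary condition hold in the classical sense. That the list of eigenfunctions is complete, i.e.
  an orthonormal basis, is expressed by saying that only zero is orthogonal to all of them.
\<close>
definition neumann_eigensystem ::
  "(real^'n::finite) set \<Rightarrow> (real^'n \<Rightarrow> real) \<Rightarrow> (nat \<Rightarrow> real^'n \<Rightarrow> real) \<Rightarrow> (nat \<Rightarrow> real) \<Rightarrow> bool" where
  "neumann_eigensystem S f e lam \<longleftrightarrow>
     (\<forall>j. e j \<in> C2 S \<and> neumann_condition S (e j) \<and>
          (\<forall>x\<in>S. div_form_op f (e j) x = - lam j * e j x)) \<and>
     (\<forall>j k. L2_inner S (e j) (e k) = (if j = k then 1 else 0)) \<and>
     (\<forall>\<phi>\<in>L2 S. (\<forall>j. L2_inner S (e j) \<phi> = 0) \<longrightarrow> (AE x in lebesgue_on S. \<phi> x = 0)) \<and>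
     (\<forall>x\<in>S. e 0 x = 1) \<and> lam 0 = 0 \<and> 0 < lam 1 \<and> (\<forall>j\<ge>1. lam j \<le> lam (Suc j))"

text \<open>
  A representative of the sum of the series
  \<open>\<Sum>j. exp (- t * lam j) * \<langle>e j, \<phi>\<rangle> * e j\<close>, which converges in the norm of \<open>L2 S\<close>; the sum
  is unique up to equality almost everywhere on \<open>S\<close>.
\<close>
definition semigroup_op ::
  "(real^'n::finite) set \<Rightarrow> (nat \<Rightarrow> real^'n \<Rightarrow> real) \<Rightarrow> (nat \<Rightarrow> real) \<Rightarrow> real \<Rightarrow>
     (real^'n \<Rightarrow> real) \<Rightarrow> (real^'n \<Rightarrow> real)" where
  "semigroup_op S e lam t \<phi> =
     (SOME g. g \<in> L2 S \<and>
        (\<lambda>n. L2_norm S (\<lambda>x. (\<Sum>j<n. exp (- t * lam j) * e j x * L2_inner S (e j) \<phi>) - g x))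
          \<longlonglongrightarrow> 0)"

end

theory Submission
  imports Defs
begin

text \<open>
  Write \<open>L_f \<phi> = \<nabla>\<cdot>(f\<nabla>\<phi>)\<close>, let \<open>P\<close> and \<open>P\<^sub>0\<close> be the two semigroups at time \<open>D\<close>, \<open>\<delta>\<close> the norm of
  their difference, and \<open>h = f - f\<^sub>0\<close>, which vanishes outside the compact set \<open>S\<^sub>0\<close>. The proof
  passes from the semigroups to resolvents, from resolvents to a bound on \<open>h\<close> in a negative Sobolev
  norm, and from there to the \<open>L\<^sup>2\<close> norm.

  \<^bold>\<open>Resolvents.\<close> On an eigenfunction, \<open>P\<close> has the eigenvalue \<open>\<alpha> = exp (- D * \<lambda>)\<close>, and the resolvent
  \<open>(2 / D + \<lambda>)\<^sup>-\<^sup>1\<close> is \<open>D / (2 + ln (1 / \<alpha>))\<close>. By a theorem of Kaluza on reciprocals of power series with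
  log-convex coefficients, \<open>1 / (2 + ln (1 / \<alpha>)) = 1 / 2 - (\<Sum>n. \<kappa> n * (1 - \<alpha>) ^ n)\<close>, where
  \<open>\<kappa> n \<ge> 0\<close> and \<open>(\<Sum>n. \<kappa> n) \<le> 1 / 2\<close>. As \<open>1 - P\<close> and \<open>1 - P\<^sub>0\<close> are contractions, their \<open>n\<close>-th powers
  differ by at most \<open>min 2 (n * \<delta>)\<close>. Summing these bounds with the weights \<open>\<kappa> n\<close> shows that the
  resolvents differ by at most a multiple of \<open>\<epsilon> = 1 / (2 + ln (1 / \<delta>))\<close>
  (\<open>resolvent_stability\<close>). That \<open>\<delta> < 1\<close> follows from the spectral gap (\<open>operator_norm_bounds\<close>).

  \<^bold>\<open>The energy form of \<open>h\<close>.\<close> Let \<open>u\<close> and \<open>v\<close> be \<open>C\<^sup>2\<close> with compact support in \<open>S\<close>. Integration by parts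
  against the eigenfunctions produces no boundary terms and shows that the resolvents map
  \<open>2 / D * v - L_f v\<close> to \<open>v\<close> and \<open>2 / D * u - L_f\<^sub>0 u\<close> to \<open>u\<close>. A further integration by parts turns
  the bound on resolvents into
  \<open>\<bar>\<integral> h \<nabla>u\<cdot>\<nabla>v\<bar> \<le> 4 * D * \<epsilon> * \<parallel>2 / D * u - L_f\<^sub>0 u\<parallel> * \<parallel>2 / D * v - L_f v\<parallel>\<close>
  (\<open>energy_difference_bound\<close>). The right-hand side is controlled by the \<open>H\<^sup>2\<close> norms of \<open>u\<close> and \<open>v\<close>. If \<open>u\<close>
  is a coordinate function near \<open>S\<^sub>0\<close>, this bounds \<open>\<integral> h \<partial>\<^sub>i v\<close>, so that \<open>\<nabla>h\<close> is small of order \<open>\<epsilon>\<close> in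
  \<open>H\<^sup>-\<^sup>2\<close>.

  \<^bold>\<open>Interpolation.\<close> Because \<open>h\<close> is bounded in \<open>C\<^sup>2\<close>, the exponent \<open>2 / 3\<close> is that of the
  interpolation of \<open>L\<^sup>2\<close> between \<open>H\<^sup>-\<^sup>1\<close> and \<open>H\<^sup>2\<close>. To carry it out, let \<open>K\<^sub>r\<close> be an even bump of
  width \<open>r\<close>, shifted by \<open>r\<^sup>2 m\<close> for a fixed long vector \<open>m\<close>. Up to normalization, \<open>h\<close> differs from its convolution
  with \<open>K\<^sub>r\<close> only by \<open>O(r\<^sup>2)\<close>. The correlation of \<open>h\<close> with this convolution vanishes at \<open>r = 1\<close>, as there the
  shift has moved the support away. In between, \<open>\<partial>\<^sub>r K\<^sub>r\<close> is a divergence, so that the derivative of the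
  correlation is a sum of integrals \<open>\<integral> h \<partial>\<^sub>i v\<^sub>i\<close> with functions \<open>v\<^sub>i\<close> whose \<open>H\<^sup>2\<close> norm is
  at most of order \<open>r\<^sup>-\<^sup>2 \<parallel>h\<parallel>\<close>. It follows that \<open>\<parallel>h\<parallel> \<le> C * (r\<^sup>2 + \<epsilon> / r)\<close> (\<open>norm_bound_from_correlation\<close>),
  and \<open>r = \<epsilon> powr (1 / 3)\<close> gives the estimate (\<open>stability_estimate\<close>).
\<close>

section \<open>The power series of a logarithmic resolvent\<close>

text \<open>
  The recursion says that \<open>2 + (\<Sum>n\<ge>1. y ^ n / n)\<close> times \<open>1 / 2 - (\<Sum>n. kaluza n * y ^ n)\<close> is \<open>1\<close>, compared
  coefficientwise. The first factor is \<open>2 - ln (1 - y)\<close>.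
\<close>
fun kaluza :: "nat \<Rightarrow> real" where
  "kaluza n = (if n = 0 then 0 else
             (inverse (real n) - 2 * (\<Sum>k<n. kaluza k * inverse (real (n - k)))) / 4)"

declare kaluza.simps [simp del]

lemma kaluza_0: "kaluza 0 = 0" by (simp add: kaluza.simps)

lemma kaluza_rec:
  assumes "n > 0"
  shows "4 * kaluza n = inverse (real n) - 2 * (\<Sum>k<n. kaluza k * inverse (real (n - k)))"
  using assms by (subst kaluza.simps) simp

text \<open>
  Kaluza's argument: the coefficients \<open>2, 1, 1/2, 1/3, \<dots>\<close> are log-convex. This allows one to subtract the
  recursion for \<open>n - 1\<close> from that for \<open>n\<close>, scaled so that all earlier terms of the difference have the
  right sign by induction. The constant \<open>2\<close> is the smallest for which log-convexity holds, and the reason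
  for working with the resolvent at \<open>2 / D\<close>.
\<close>
lemma kaluza_nonneg: "0 \<le> kaluza n"
proof (induction n rule: less_induct)
  case (less n)
  consider "n = 0" | "n = 1" | m where "n = Suc m" "m \<ge> 1"
    by (cases n) (auto simp: Suc_le_eq)
  thus ?case
  proof cases
    case 1 thus ?thesis by (simp add: kaluza_0)
  next
    case 2
    have "4 * kaluza 1 = 1" using kaluza_rec[of 1] by (simp add: kaluza_0)
    thus ?thesis using 2 by simp
  next
    case (3 m)
    let ?T = "\<lambda>k. kaluza k * inverse (real (n - k))"
    let ?S = "\<lambda>k. kaluza k * inverse (real (m - k))"
    have n0: "4 * kaluza n = inverse (real n) - 2 * (\<Sum>k<m. ?T k) - 2 * kaluza m"
      using kaluza_rec[of n] 3 by (simp add: algebra_simps)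
    have m0: "4 * kaluza m = inverse (real m) - 2 * (\<Sum>k<m. ?S k)"
      using kaluza_rec[of m] 3 by simp
    have le: "(real n) * ?T k \<le> (real m) * ?S k" if "k < m" for k
    proof (cases "k = 0")
      case True thus ?thesis by (simp add: kaluza_0)
    next
      case False
      have "real n * inverse (real (n - k)) \<le> real m * inverse (real (m - k))"
        using that 3 by (simp add: field_simps of_nat_diff)
      from mult_left_mono[OF this less.IH[of k]] that 3 show ?thesis by (simp add: mult_ac)
    qed
    have "real n * (\<Sum>k<m. ?T k) \<le> real m * (\<Sum>k<m. ?S k)"
      unfolding sum_distrib_left by (rule sum_mono) (use le in auto)
    moreover have "4 * (real n * kaluza n) = 1 - 2 * (real n * (\<Sum>k<m. ?T k)) - 2 * (real n * kaluza m)"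
    proof -
      have "real n * (4 * kaluza n) = real n * (inverse (real n) - 2 * (\<Sum>k<m. ?T k) - 2 * kaluza m)"
        by (simp only: n0)
      thus ?thesis using 3 by (simp add: algebra_simps del: of_nat_Suc)
    qed
    moreover have "4 * (real m * kaluza m) = 1 - 2 * (real m * (\<Sum>k<m. ?S k))"
    proof -
      have "real m * (4 * kaluza m) = real m * (inverse (real m) - 2 * (\<Sum>k<m. ?S k))"
        by (simp only: m0)
      thus ?thesis using 3 by (simp add: algebra_simps)
    qed
    ultimately have "4 * (real n * kaluza n) \<ge> 4 * (real m * kaluza m) - 2 * (real n * kaluza m)" by linarith
    also have "4 * (real m * kaluza m) - 2 * (real n * kaluza m) = 2 * (real m - 1) * kaluza m"
      using 3 by (simp add: algebra_simps)
    finally have "4 * (real n * kaluza n) \<ge> 0"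
      using less.IH[of m] 3 by (smt (verit) lessI mult_nonneg_nonneg of_nat_1 of_nat_mono)
    thus ?thesis using 3 by (simp add: zero_le_mult_iff)
  qed
qed

lemma kaluza_le_1: "kaluza n \<le> 1"
proof (cases "n = 0")
  case False
  have "0 \<le> (\<Sum>k<n. kaluza k * inverse (real (n - k)))"
    by (intro sum_nonneg mult_nonneg_nonneg kaluza_nonneg) auto
  moreover have "inverse (real n) \<le> 1" using False by (simp add: field_simps)
  ultimately show ?thesis using kaluza_rec[of n] False by linarith
qed (simp add: kaluza_0)

lemma ln_one_minus_sums:
  assumes "0 \<le> y" "y < (1::real)"
  shows "(\<lambda>n. y ^ n * inverse (real n)) sums (- ln (1 - y))"
proof -
  have "ln (1 - y) = (\<Sum>n. (-1)^n * (1 / real (n + 1)) * ((1 - y) - 1)^(Suc n))"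
    using ln_series[of "1 - y"] assms by simp
  also have "\<dots> = (\<Sum>n. - (y ^ Suc n * inverse (real (Suc n))))"
  proof -
    have "(-1)^n * (- y)^(Suc n) = - (y ^ Suc n)" for n
      by (induction n) (auto simp: algebra_simps)
    hence "(-1)^n * (1 / real (n + 1)) * ((1 - y) - 1)^(Suc n) = - (y ^ Suc n * inverse (real (Suc n)))" for n
      by (metis (no_types, lifting) ab_group_add_class.ab_diff_conv_add_uminus add.commute
          add_diff_cancel_left' diff_add_cancel divide_inverse mult.assoc mult.commute
          mult_1 mult_minus_left Suc_eq_plus1)
    thus ?thesis by simp
  qed
  finally have l: "ln (1 - y) = (\<Sum>n. - (y ^ Suc n * inverse (real (Suc n))))" .
  have s: "summable (\<lambda>n. y ^ Suc n * inverse (real (Suc n)))"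
  proof (rule summable_comparison_test')
    show "summable (\<lambda>n. y ^ n)" using assms by simp
    show "norm (y ^ Suc n * inverse (real (Suc n))) \<le> y ^ n" for n
    proof -
      have "y ^ Suc n * inverse (real (Suc n)) \<le> y ^ n * 1"
        using assms by (intro mult_mono) (auto simp: field_simps mult_le_one intro: mult_left_le_one_le)
      thus ?thesis using assms by simp
    qed
  qed
  have "(\<lambda>n. y ^ Suc n * inverse (real (Suc n))) sums (- ln (1 - y))"
    using l suminf_minus[OF s] summable_sums[OF s] by simp
  thus ?thesis by (subst (asm) sums_Suc_iff) simp
qed

lemma kaluza_sums:
  assumes "0 \<le> y" "y < (1::real)"
  shows "(\<lambda>n. kaluza n * y ^ n) sums (1/2 - 1 / (2 - ln (1 - y)))"
proof -
  let ?k = "\<lambda>n. (if n = 0 then 1/2 else 0) - kaluza n * y ^ n"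
  let ?a = "\<lambda>n. (if n = 0 then 2 else 0) + y ^ n * inverse (real n)"
  have sk: "summable (\<lambda>n. kaluza n * y ^ n)"
  proof (rule summable_comparison_test')
    show "summable (\<lambda>n. y ^ n)" using assms by simp
    show "norm (kaluza n * y ^ n) \<le> y ^ n" for n
      using assms kaluza_nonneg[of n] kaluza_le_1[of n] by (simp add: abs_mult mult_left_le_one_le)
  qed
  have s1: "(\<lambda>n. (if n = 0 then c else 0)) sums (c::real)" for c
    using sums_single[of 0 "\<lambda>_. c"] by simp
  have sa: "?a sums (2 + - ln (1 - y))"
    by (intro sums_add s1 ln_one_minus_sums assms)
  have sk': "?k sums (1/2 - (\<Sum>n. kaluza n * y ^ n))"
    by (intro sums_diff s1 summable_sums sk)
  have na: "summable (\<lambda>n. norm (?a n))"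
    using sa assms by (auto simp: sums_iff)
  have nk: "summable (\<lambda>n. norm (?k n))"
  proof -
    have "summable (\<lambda>n. (if n = 0 then 1/2 else 0) + kaluza n * y ^ n)"
      using s1[of "1/2"] sk by (intro summable_add) (auto simp: sums_iff)
    moreover have "norm (?k n) = (if n = 0 then 1/2 else 0) + kaluza n * y ^ n" for n
      using assms kaluza_nonneg[of n] by (auto simp: kaluza_0)
    ultimately show ?thesis by simp
  qed
  have conv: "(\<Sum>i\<le>n. ?k i * ?a (n - i)) = (if n = 0 then 1 else 0)" for n
  proof (cases "n = 0")
    case False
    have "(\<Sum>i\<le>n. ?k i * ?a (n - i)) = (\<Sum>i<n. ?k i * ?a (n - i)) + ?k n * 2"
      by (simp add: lessThan_Suc_atMost[symmetric])
    also have "(\<Sum>i<n. ?k i * ?a (n - i)) =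
               (\<Sum>i<n. (if i = 0 then 1/2 * (y ^ n * inverse (real n)) else 0) - y ^ n * (kaluza i * inverse (real (n - i))))"
    proof (intro sum.cong refl)
      fix i assume i: "i \<in> {..<n}"
      show "?k i * ?a (n - i) = (if i = 0 then 1/2 * (y ^ n * inverse (real n)) else 0) - y ^ n * (kaluza i * inverse (real (n - i)))"
      proof (cases "i = 0")
        case True
        thus ?thesis using i by (simp add: kaluza_0)
      next
        case i0: False
        have "y ^ n = y ^ i * y ^ (n - i)" using i by (simp flip: power_add)
        hence "y ^ n * (kaluza i * inverse (real (n - i))) = kaluza i * y ^ i * (y ^ (n - i) * inverse (real (n - i)))"
          by (simp only: mult_ac)
        thus ?thesis using i i0 by force
      qed
    qed
    also have "\<dots> = 1/2 * (y ^ n * inverse (real n)) - y ^ n * (\<Sum>i<n. kaluza i * inverse (real (n - i)))"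
      using False unfolding sum_subtractf sum_distrib_left[symmetric] by (subst sum.delta) auto
    also have "\<dots> + ?k n * 2 = y ^ n * ((inverse (real n) - 2 * (\<Sum>i<n. kaluza i * inverse (real (n - i)))) / 2 - 2 * kaluza n)"
      using False by (simp add: algebra_simps)
    also have "\<dots> = 0" using kaluza_rec[of n] False by simp
    finally show ?thesis using False by simp
  qed (simp add: kaluza_0)
  have "(\<lambda>n. if n = 0 then 1 else 0) sums ((\<Sum>n. ?k n) * (\<Sum>n. ?a n))"
    using Cauchy_product_sums[OF nk na] unfolding conv .
  hence "(\<Sum>n. ?k n) * (\<Sum>n. ?a n) = 1" using s1[of 1] sums_unique2 by blast
  hence "(1/2 - (\<Sum>n. kaluza n * y ^ n)) * (2 - ln (1 - y)) = 1"
    using sa sk' by (simp add: sums_iff)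
  hence "1/2 - (\<Sum>n. kaluza n * y ^ n) = 1 / (2 - ln (1 - y))"
    by (metis mult_zero_right nonzero_eq_divide_eq zero_neq_one)
  hence "(\<Sum>n. kaluza n * y ^ n) = 1/2 - 1 / (2 - ln (1 - y))" by linarith
  thus ?thesis using summable_sums[OF sk] by simp
qed

text \<open>
  For \<open>y < 1\<close> the whole series is below \<open>1 / 2\<close>, since \<open>2 - ln (1 - y) > 0\<close>; let \<open>y\<close> tend to \<open>1\<close> in the
  partial sums.
\<close>
lemma kaluza_partial_le: "(\<Sum>n<N. kaluza n) \<le> 1/2"
proof -
  have *: "(\<Sum>n<N. kaluza n * y ^ n) \<le> 1/2" if "0 \<le> y" "y < 1" for y :: real
  proof -
    have "(\<Sum>n<N. kaluza n * y ^ n) \<le> (\<Sum>n. kaluza n * y ^ n)"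
      using kaluza_sums[OF that] that kaluza_nonneg by (intro sum_le_suminf) (auto simp: sums_iff)
    also have "\<dots> = 1/2 - 1 / (2 - ln (1 - y))" using kaluza_sums[OF that] by (simp add: sums_iff)
    also have "\<dots> \<le> 1/2"
      using that by (simp add: ln_le_zero_iff) (smt (verit) ln_le_zero_iff)
    finally show ?thesis .
  qed
  have "((\<lambda>y. \<Sum>n<N. kaluza n * y ^ n) \<longlongrightarrow> (\<Sum>n<N. kaluza n * 1 ^ n)) (at_left (1::real))"
    by (intro tendsto_intros)
  moreover have "eventually (\<lambda>y. (\<Sum>n<N. kaluza n * y ^ n) \<le> 1/2) (at_left (1::real))"
    by (rule eventually_mono[OF eventually_at_left_real[of 0 1]]) (use * in auto)
  ultimately have "(\<Sum>n<N. kaluza n * 1 ^ n) \<le> 1/2"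
    by (rule tendsto_upperbound) simp
  thus ?thesis by simp
qed

lemma kaluza_summable: "summable kaluza"
  by (rule summableI_nonneg_bounded[OF kaluza_nonneg kaluza_partial_le])

text \<open>
  Up to a factor \<open>4\<close>, \<open>min 2 (n * \<delta>)\<close> is below \<open>1 - (1 - \<delta>) ^ n\<close> by Bernoulli's inequality, and the
  series with the latter terms is evaluated by \<open>kaluza_sums\<close> at \<open>y = 1 - \<delta>\<close>.
\<close>
lemma kaluza_min_bound:
  assumes "0 < \<delta>" "\<delta> < (1::real)"
  shows "(\<Sum>n<N. kaluza n * min 2 (real n * \<delta>)) \<le> 4 / (2 + ln (1 / \<delta>))"
proof -
  have 1: "min 2 (real n * \<delta>) \<le> 4 * (1 - (1 - \<delta>) ^ n)" for n
  proof -
    have "(1 - \<delta>) ^ n * (1 + real n * \<delta>) \<le> (1 - \<delta>) ^ n * (1 + \<delta>) ^ n"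
      using assms Bernoulli_inequality[of \<delta> n] by (intro mult_left_mono) auto
    also have "\<dots> = (1 - \<delta> * \<delta>) ^ n" by (simp add: algebra_simps flip: power_mult_distrib)
    also have "\<dots> \<le> 1" using assms by (intro power_le_one) (auto simp: mult_le_one)
    finally have le: "(1 - \<delta>) ^ n * (1 + real n * \<delta>) \<le> 1" .
    let ?q = "(1 - \<delta>) ^ n" and ?t = "real n * \<delta>"
    have q: "0 \<le> ?q" "0 \<le> ?t" using assms by auto
    show ?thesis
    proof (cases "?t \<le> 2")
      case True
      have "?q * (1 + ?t) \<le> 1" by (rule le)
      have "?t * ?t \<le> 2 * ?t" using q True by (intro mult_right_mono) auto
      hence "1 \<le> (1 + ?t) * (1 - ?t / 4)" using q by (simp add: algebra_simps)
      hence "?q * (1 + ?t) \<le> (1 - ?t / 4) * (1 + ?t)" using le by (simp add: mult.commute)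
      hence "?q \<le> 1 - ?t / 4" using q by (subst (asm) mult_le_cancel_right) auto
      thus ?thesis using True by simp
    next
      case False
      have "?q * 3 \<le> ?q * (1 + ?t)" using False q by (intro mult_left_mono) auto
      hence "?q * 3 \<le> 1" using le by linarith
      thus ?thesis by simp
    qed
  qed
  have y: "0 \<le> 1 - \<delta>" "1 - \<delta> < 1" using assms by auto
  note S = kaluza_sums[OF y]
  have "(\<Sum>n<N. kaluza n * min 2 (real n * \<delta>)) \<le> (\<Sum>n<N. kaluza n * (4 * (1 - (1 - \<delta>) ^ n)))"
    by (intro sum_mono mult_left_mono 1 kaluza_nonneg)
  also have "\<dots> \<le> (\<Sum>n. kaluza n * (4 * (1 - (1 - \<delta>) ^ n)))"
  proof (rule sum_le_suminf)
    have "summable (\<lambda>n. 4 * (kaluza n - kaluza n * (1 - \<delta>) ^ n))"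
      using S kaluza_summable by (intro summable_mult summable_diff) (auto simp: sums_iff)
    thus "summable (\<lambda>n. kaluza n * (4 * (1 - (1 - \<delta>) ^ n)))" by (simp add: algebra_simps)
    show "0 \<le> kaluza n * (4 * (1 - (1 - \<delta>) ^ n))" for n
      using assms by (intro mult_nonneg_nonneg kaluza_nonneg) (auto intro: power_le_one)
  qed auto
  also have "\<dots> = (\<Sum>n. 4 * (kaluza n - kaluza n * (1 - \<delta>) ^ n))" by (simp add: algebra_simps)
  also have "\<dots> = 4 * (suminf kaluza - (1/2 - 1 / (2 - ln (1 - (1 - \<delta>)))))"
    using S kaluza_summable
    by (subst suminf_mult) (auto simp: sums_iff suminf_diff[symmetric] intro: summable_diff)
  also have "\<dots> \<le> 4 * (1 / (2 - ln \<delta>))"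
    using suminf_le_const[OF kaluza_summable kaluza_partial_le] by simp
  finally show ?thesis using assms by (simp add: ln_div)
qed

section \<open>Square-integrable functions\<close>

lemma L2_D:
  assumes "\<phi> \<in> L2 S"
  shows "\<phi> \<in> borel_measurable (lebesgue_on S)" "integrable (lebesgue_on S) (\<lambda>x. (\<phi> x)\<^sup>2)"
  using assms by (auto simp: L2_def)

lemma L2_integrable_mult:
  assumes "\<phi> \<in> L2 S" "\<psi> \<in> L2 S"
  shows "integrable (lebesgue_on S) (\<lambda>x. \<phi> x * \<psi> x)"
proof (rule Bochner_Integration.integrable_bound)
  note [measurable] = L2_D(1)[OF assms(1)] L2_D(1)[OF assms(2)]
  show "integrable (lebesgue_on S) (\<lambda>x. (\<phi> x)\<^sup>2 + (\<psi> x)\<^sup>2)"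
    by (intro Bochner_Integration.integrable_add L2_D(2) assms)
  show "(\<lambda>x. \<phi> x * \<psi> x) \<in> borel_measurable (lebesgue_on S)" by measurable
  have "\<bar>a * b\<bar> \<le> a\<^sup>2 + b\<^sup>2" for a b :: real
  proof -
    have "0 \<le> \<bar>a\<bar> * \<bar>b\<bar>" by simp
    moreover have "2 * (\<bar>a\<bar> * \<bar>b\<bar>) \<le> a\<^sup>2 + b\<^sup>2"
      using sum_squares_bound[of "\<bar>a\<bar>" "\<bar>b\<bar>"] by simp
    ultimately show ?thesis unfolding abs_mult by linarith
  qed
  thus "AE x in lebesgue_on S. norm (\<phi> x * \<psi> x) \<le> norm ((\<phi> x)\<^sup>2 + (\<psi> x)\<^sup>2)" by auto
qed

lemma L2_add: "\<phi> \<in> L2 S \<Longrightarrow> \<psi> \<in> L2 S \<Longrightarrow> (\<lambda>x. \<phi> x + \<psi> x) \<in> L2 S"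
  using L2_integrable_mult[of \<phi> S \<psi>] L2_integrable_mult[of \<phi> S \<phi>] L2_integrable_mult[of \<psi> S \<psi>]
  by (auto simp: L2_def power2_eq_square distrib_left distrib_right mult.commute)

lemma L2_scale: "\<phi> \<in> L2 S \<Longrightarrow> (\<lambda>x. c * \<phi> x) \<in> L2 S"
  by (auto simp: L2_def power_mult_distrib)

lemma L2_diff: "\<phi> \<in> L2 S \<Longrightarrow> \<psi> \<in> L2 S \<Longrightarrow> (\<lambda>x. \<phi> x - \<psi> x) \<in> L2 S"
  using L2_add[of \<phi> S "\<lambda>x. (-1) * \<psi> x"] L2_scale[of \<psi> S "-1"] by simp

lemma L2_zero: "(\<lambda>x. 0) \<in> L2 S" by (simp add: L2_def)

lemma L2_sum: "(\<And>i. i \<in> I \<Longrightarrow> \<phi> i \<in> L2 S) \<Longrightarrow> (\<lambda>x. \<Sum>i\<in>I. \<phi> i x) \<in> L2 S"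
  by (induction I rule: infinite_finite_induct) (auto intro: L2_add L2_zero)

lemma L2_inner_commute: "L2_inner S \<phi> \<psi> = L2_inner S \<psi> \<phi>"
  by (simp add: L2_inner_def mult.commute)

lemma L2_inner_add_right:
  "\<phi> \<in> L2 S \<Longrightarrow> \<psi> \<in> L2 S \<Longrightarrow> \<eta> \<in> L2 S \<Longrightarrow>
     L2_inner S \<phi> (\<lambda>x. \<psi> x + \<eta> x) = L2_inner S \<phi> \<psi> + L2_inner S \<phi> \<eta>"
  by (simp add: L2_inner_def distrib_left L2_integrable_mult)

lemma L2_inner_diff_right:
  "\<phi> \<in> L2 S \<Longrightarrow> \<psi> \<in> L2 S \<Longrightarrow> \<eta> \<in> L2 S \<Longrightarrow>
     L2_inner S \<phi> (\<lambda>x. \<psi> x - \<eta> x) = L2_inner S \<phi> \<psi> - L2_inner S \<phi> \<eta>"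
  by (simp add: L2_inner_def right_diff_distrib L2_integrable_mult)

lemma L2_inner_scale_right: "L2_inner S \<phi> (\<lambda>x. c * \<psi> x) = c * L2_inner S \<phi> \<psi>"
  unfolding L2_inner_def by (simp add: mult.left_commute)

lemma L2_inner_sum_right:
  "\<phi> \<in> L2 S \<Longrightarrow> (\<And>i. i \<in> I \<Longrightarrow> \<psi> i \<in> L2 S) \<Longrightarrow>
     L2_inner S \<phi> (\<lambda>x. \<Sum>i\<in>I. \<psi> i x) = (\<Sum>i\<in>I. L2_inner S \<phi> (\<psi> i))"
proof (induction I rule: infinite_finite_induct)
  case (insert i I)
  have "L2_inner S \<phi> (\<lambda>x. \<psi> i x + (\<Sum>i\<in>I. \<psi> i x)) = L2_inner S \<phi> (\<psi> i) + L2_inner S \<phi> (\<lambda>x. \<Sum>i\<in>I. \<psi> i x)"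
    using insert by (intro L2_inner_add_right L2_sum) auto
  thus ?case using insert by simp
qed (auto simp: L2_inner_def)

lemma L2_inner_cong_AE:
  assumes "\<phi> \<in> L2 S" "\<phi>' \<in> L2 S" "\<psi> \<in> L2 S" "AE x in lebesgue_on S. \<phi> x = \<phi>' x"
  shows "L2_inner S \<psi> \<phi> = L2_inner S \<psi> \<phi>'"
  unfolding L2_inner_def
  using assms L2_integrable_mult[of \<psi> S \<phi>] L2_integrable_mult[of \<psi> S \<phi>']
  by (intro integral_cong_AE) auto

lemma L2_inner_self_nonneg: "0 \<le> L2_inner S \<phi> \<phi>"
  by (simp add: L2_inner_def)

lemma L2_norm_nonneg: "0 \<le> L2_norm S \<phi>"
  by (simp add: L2_norm_def L2_inner_self_nonneg)

lemma L2_norm_sq: "(L2_norm S \<phi>)\<^sup>2 = L2_inner S \<phi> \<phi>"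
  by (simp add: L2_norm_def L2_inner_self_nonneg)

lemma L2_norm_eq_0_iff:
  assumes "\<phi> \<in> L2 S"
  shows "L2_norm S \<phi> = 0 \<longleftrightarrow> (AE x in lebesgue_on S. \<phi> x = 0)"
  using integral_nonneg_eq_0_iff_AE[OF L2_D(2)[OF assms]] L2_inner_self_nonneg[of S \<phi>]
  by (simp add: L2_norm_def L2_inner_def power2_eq_square)

lemma L2_inner_expand:
  assumes "\<phi> \<in> L2 S" "\<psi> \<in> L2 S"
  shows "L2_inner S (\<lambda>x. \<phi> x + c * \<psi> x) (\<lambda>x. \<phi> x + c * \<psi> x) =
         L2_inner S \<phi> \<phi> + 2 * c * L2_inner S \<phi> \<psi> + c\<^sup>2 * L2_inner S \<psi> \<psi>"
proof -
  note A = L2_scale[OF assms(2), of c] and B = L2_add[OF assms(1) L2_scale[OF assms(2), of c]]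
  show ?thesis
    unfolding L2_inner_add_right[OF B assms(1) A] L2_inner_scale_right
      L2_inner_commute[of S "\<lambda>x. \<phi> x + c * \<psi> x"]
      L2_inner_add_right[OF assms(1) assms(1) A] L2_inner_add_right[OF assms(2) assms(1) A]
    by (simp add: L2_inner_commute[of S \<psi> \<phi>] power2_eq_square algebra_simps)
qed

lemma L2_Cauchy_Schwarz:
  assumes "\<phi> \<in> L2 S" "\<psi> \<in> L2 S"
  shows "\<bar>L2_inner S \<phi> \<psi>\<bar> \<le> L2_norm S \<phi> * L2_norm S \<psi>"
proof -
  let ?a = "L2_inner S \<psi> \<psi>" and ?b = "L2_inner S \<phi> \<psi>" and ?c = "L2_inner S \<phi> \<phi>"
  have q: "0 \<le> ?c + 2 * t * ?b + t\<^sup>2 * ?a" for t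
    using L2_inner_self_nonneg[of S "\<lambda>x. \<phi> x + t * \<psi> x"] by (simp only: L2_inner_expand[OF assms])
  have "?b\<^sup>2 \<le> ?c * ?a"
  proof (cases "?a = 0")
    case True
    have "?b = 0"
    proof (rule ccontr)
      assume "?b \<noteq> 0"
      hence "?c + 2 * (- (?c + 1) / (2 * ?b)) * ?b = -1" by (simp add: field_simps)
      thus False using q[of "- (?c + 1) / (2 * ?b)"] True by simp
    qed
    thus ?thesis using True by simp
  next
    case False
    hence a: "?a > 0" using L2_inner_self_nonneg[of S \<psi>] by simp
    have "0 \<le> (?c + 2 * (- ?b / ?a) * ?b + (- ?b / ?a)\<^sup>2 * ?a) * ?a"
      using q[of "- ?b / ?a"] a by (intro mult_nonneg_nonneg) auto
    also have "\<dots> = ?c * ?a - ?b\<^sup>2" using a by (simp add: power2_eq_square field_simps)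
    finally show ?thesis by simp
  qed
  hence "sqrt (?b\<^sup>2) \<le> sqrt (?c * ?a)" by (rule real_sqrt_le_mono)
  thus ?thesis by (simp add: L2_norm_def real_sqrt_mult)
qed

lemma L2_norm_scale: "L2_norm S (\<lambda>x. c * \<phi> x) = \<bar>c\<bar> * L2_norm S \<phi>"
proof -
  have "L2_inner S (\<lambda>x. c * \<phi> x) (\<lambda>x. c * \<phi> x) = c\<^sup>2 * L2_inner S \<phi> \<phi>"
    by (simp add: L2_inner_scale_right L2_inner_commute[of S "\<lambda>x. c * \<phi> x"] power2_eq_square)
  thus ?thesis by (simp add: L2_norm_def real_sqrt_mult)
qed

lemma L2_norm_minus_commute: "L2_norm S (\<lambda>x. \<phi> x - \<psi> x) = L2_norm S (\<lambda>x. \<psi> x - \<phi> x)"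
proof -
  have "(\<lambda>x. \<psi> x - \<phi> x) = (\<lambda>x. (-1) * (\<phi> x - \<psi> x))" by auto
  thus ?thesis using L2_norm_scale[of S "-1" "\<lambda>x. \<phi> x - \<psi> x"] by simp
qed

lemma L2_norm_cong_AE:
  assumes "\<phi> \<in> L2 S" "\<psi> \<in> L2 S" "AE x in lebesgue_on S. \<phi> x = \<psi> x"
  shows "L2_norm S \<phi> = L2_norm S \<psi>"
  using L2_inner_cong_AE[OF assms(1,2,1,3)] L2_inner_cong_AE[OF assms(1,2,2,3)]
  by (simp add: L2_norm_def L2_inner_commute[of S \<phi> \<psi>])

lemma L2_const: "S \<in> lmeasurable \<Longrightarrow> (\<lambda>x. c) \<in> L2 S"
  by (auto simp: L2_def intro!: finite_measure.integrable_const finite_measure_lebesgue_on)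

lemma L2_abs: "\<phi> \<in> L2 S \<Longrightarrow> (\<lambda>x. \<bar>\<phi> x\<bar>) \<in> L2 S"
  by (auto simp: L2_def)

text \<open>
  On a set of finite measure, a Cauchy sequence in \<open>L\<^sup>2\<close> is Cauchy in \<open>L\<^sup>1\<close> and hence has a subsequence
  that converges almost everywhere. By Fatou's lemma, the pointwise limit is also the limit in \<open>L\<^sup>2\<close>.
\<close>
lemma L2_complete:
  fixes u :: "nat \<Rightarrow> real^'n::finite \<Rightarrow> real"
  assumes S: "S \<in> lmeasurable" and u: "\<And>n. u n \<in> L2 S"
    and C: "\<And>\<epsilon>. \<epsilon> > 0 \<Longrightarrow> \<exists>N. \<forall>m\<ge>N. \<forall>n\<ge>N. L2_norm S (\<lambda>x. u m x - u n x) < \<epsilon>"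
  obtains g where "g \<in> L2 S" "(\<lambda>n. L2_norm S (\<lambda>x. u n x - g x)) \<longlonglongrightarrow> 0"
proof -
  let ?M = "lebesgue_on S"
  have um [measurable]: "u n \<in> borel_measurable ?M" for n using L2_D(1)[OF u] .
  have one: "(\<lambda>x. 1) \<in> L2 S" by (rule L2_const[OF S])
  have int1: "integrable ?M (u n)" for n
    using L2_integrable_mult[OF u[of n] one] by simp
  have L1: "\<exists>N. \<forall>i\<ge>N. \<forall>j\<ge>N. (LINT x|?M. norm (u i x - u j x)) < e" if e: "e > 0" for e
  proof -
    define K where "K = L2_norm S (\<lambda>x. 1) + 1"
    have K: "K > 0" using L2_norm_nonneg[of S "\<lambda>x. 1"] by (simp add: K_def)
    obtain N where N: "\<forall>m\<ge>N. \<forall>n\<ge>N. L2_norm S (\<lambda>x. u m x - u n x) < e / K"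
      using C[of "e / K"] e K by auto
    have "(LINT x|?M. norm (u i x - u j x)) < e" if "i \<ge> N" "j \<ge> N" for i j
    proof -
      note d = L2_diff[OF u[of i] u[of j]]
      have "(LINT x|?M. norm (u i x - u j x)) = L2_inner S (\<lambda>x. \<bar>u i x - u j x\<bar>) (\<lambda>x. 1)"
        by (simp add: L2_inner_def)
      also have "\<dots> \<le> L2_norm S (\<lambda>x. \<bar>u i x - u j x\<bar>) * L2_norm S (\<lambda>x. 1)"
        using L2_Cauchy_Schwarz[OF L2_abs[OF d] one] by linarith
      also have "L2_norm S (\<lambda>x. \<bar>u i x - u j x\<bar>) = L2_norm S (\<lambda>x. u i x - u j x)"
        by (simp add: L2_norm_def L2_inner_def)
      also have "\<dots> * L2_norm S (\<lambda>x. 1) \<le> L2_norm S (\<lambda>x. u i x - u j x) * K"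
        by (intro mult_left_mono L2_norm_nonneg) (simp add: K_def)
      also have "\<dots> < e" using N that K by (simp add: field_simps)
      finally show ?thesis .
    qed
    thus ?thesis by blast
  qed
  obtain r where r: "strict_mono r" "AE x in ?M. Cauchy (\<lambda>i. u (r i) x)"
    using cauchy_L1_AE_cauchy_subseq[OF int1 L1] by blast
  define g where "g = (\<lambda>x. lim (\<lambda>i. u (r i) x))"
  have gm [measurable]: "g \<in> borel_measurable ?M"
    unfolding g_def by (rule borel_measurable_lim_metric) simp
  have conv: "AE x in ?M. (\<lambda>i. u (r i) x) \<longlonglongrightarrow> g x"
    using r(2) by eventually_elim (simp add: g_def Cauchy_convergent_iff convergent_LIMSEQ_iff)
  have key: "(\<lambda>x. u n x - g x) \<in> L2 S \<and> L2_norm S (\<lambda>x. u n x - g x) \<le> \<epsilon>"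
    if e: "\<epsilon> > 0" and N: "\<forall>m\<ge>N. \<forall>n\<ge>N. L2_norm S (\<lambda>x. u m x - u n x) < \<epsilon>" and n: "n \<ge> N"
    for \<epsilon> N n
  proof -
    have "(\<integral>\<^sup>+x. ennreal ((u n x - g x)\<^sup>2) \<partial>?M) = (\<integral>\<^sup>+x. liminf (\<lambda>i. ennreal ((u n x - u (r i) x)\<^sup>2)) \<partial>?M)"
    proof (intro nn_integral_cong_AE, use conv in eventually_elim)
      case (elim x)
      have "(\<lambda>i. ennreal ((u n x - u (r i) x)\<^sup>2)) \<longlonglongrightarrow> ennreal ((u n x - g x)\<^sup>2)"
        by (intro tendsto_ennrealI tendsto_intros elim)
      thus ?case using lim_imp_Liminf by (metis trivial_limit_sequentially)
    qed
    also have "\<dots> \<le> liminf (\<lambda>i. \<integral>\<^sup>+x. ennreal ((u n x - u (r i) x)\<^sup>2) \<partial>?M)"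
      by (intro nn_integral_liminf) measurable
    also have "\<dots> \<le> ennreal (\<epsilon>\<^sup>2)"
    proof (rule Liminf_le)
      show "\<forall>\<^sub>F i in sequentially. (\<integral>\<^sup>+x. ennreal ((u n x - u (r i) x)\<^sup>2) \<partial>?M) \<le> ennreal (\<epsilon>\<^sup>2)"
      proof (rule eventually_sequentiallyI[of N])
        fix i assume "N \<le> i"
        hence ri: "N \<le> r i" using seq_suble[OF r(1), of i] by simp
        have "(\<integral>\<^sup>+x. ennreal ((u n x - u (r i) x)\<^sup>2) \<partial>?M) = ennreal ((L2_norm S (\<lambda>x. u n x - u (r i) x))\<^sup>2)"
          unfolding L2_norm_sq L2_inner_def power2_eq_square[symmetric]
          by (rule nn_integral_eq_integral) (auto intro: L2_D(2)[OF L2_diff[OF u u]])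
        also have "\<dots> \<le> ennreal (\<epsilon>\<^sup>2)"
          using N n ri L2_norm_nonneg by (intro ennreal_leI power_mono) (auto intro: less_imp_le)
        finally show "(\<integral>\<^sup>+x. ennreal ((u n x - u (r i) x)\<^sup>2) \<partial>?M) \<le> ennreal (\<epsilon>\<^sup>2)" .
      qed
    qed simp
    finally have le: "(\<integral>\<^sup>+x. ennreal ((u n x - g x)\<^sup>2) \<partial>?M) \<le> ennreal (\<epsilon>\<^sup>2)" .
    hence i: "integrable ?M (\<lambda>x. (u n x - g x)\<^sup>2)"
      by (intro integrableI_bounded) (auto simp: less_top[symmetric] top_unique)
    hence mem: "(\<lambda>x. u n x - g x) \<in> L2 S" by (simp add: L2_def)
    have "ennreal ((L2_norm S (\<lambda>x. u n x - g x))\<^sup>2) \<le> ennreal (\<epsilon>\<^sup>2)"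
      using le nn_integral_eq_integral[OF i] unfolding L2_norm_sq L2_inner_def
      by (simp add: power2_eq_square)
    hence "(L2_norm S (\<lambda>x. u n x - g x))\<^sup>2 \<le> \<epsilon>\<^sup>2" by (simp add: ennreal_le_iff)
    hence "L2_norm S (\<lambda>x. u n x - g x) \<le> \<epsilon>" using e by (simp add: power2_le_iff_abs_le L2_norm_nonneg)
    thus ?thesis using mem by simp
  qed
  have "g \<in> L2 S"
  proof -
    obtain N where "\<forall>m\<ge>N. \<forall>n\<ge>N. L2_norm S (\<lambda>x. u m x - u n x) < 1" using C[of 1] by auto
    from key[OF zero_less_one this order.refl] have "(\<lambda>x. u N x - g x) \<in> L2 S" by simp
    from L2_diff[OF u[of N] this] show ?thesis by simp
  qed
  moreover have "(\<lambda>n. L2_norm S (\<lambda>x. u n x - g x)) \<longlonglongrightarrow> 0"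
  proof (rule LIMSEQ_I)
    fix e :: real assume e: "0 < e"
    then obtain N where "\<forall>m\<ge>N. \<forall>n\<ge>N. L2_norm S (\<lambda>x. u m x - u n x) < e / 2" using C[of "e / 2"] by auto
    hence "L2_norm S (\<lambda>x. u n x - g x) < e" if "n \<ge> N" for n
      using key[of "e / 2" N n] that e by simp
    thus "\<exists>N. \<forall>n\<ge>N. norm (L2_norm S (\<lambda>x. u n x - g x) - 0) < e"
      by (intro exI[of _ N]) (simp add: L2_norm_nonneg)
  qed
  ultimately show ?thesis by (rule that)
qed

section \<open>Orthonormal bases, multipliers and their resolvents\<close>

locale L2_basis =
  fixes S :: "(real^'n::finite) set" and e :: "nat \<Rightarrow> real^'n \<Rightarrow> real"
  assumes S: "S \<in> lmeasurable"
    and basis_mem: "e j \<in> L2 S"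
    and orthonormal: "L2_inner S (e j) (e k) = (if j = k then 1 else 0)"
    and complete: "\<phi> \<in> L2 S \<Longrightarrow> (\<And>j. L2_inner S (e j) \<phi> = 0) \<Longrightarrow> AE x in lebesgue_on S. \<phi> x = 0"
begin

abbreviation coeff :: "nat \<Rightarrow> (real^'n \<Rightarrow> real) \<Rightarrow> real" where
  "coeff j \<phi> \<equiv> L2_inner S (e j) \<phi>"

lemma combination_mem: "(\<lambda>x. \<Sum>j\<in>I. c j * e j x) \<in> L2 S"
  by (intro L2_sum L2_scale basis_mem)

lemma inner_combination:
  assumes "\<phi> \<in> L2 S"
  shows "L2_inner S (\<lambda>x. \<Sum>j\<in>I. c j * e j x) \<phi> = (\<Sum>j\<in>I. c j * coeff j \<phi>)"
  unfolding L2_inner_commute[of S _ \<phi>]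
  by (subst L2_inner_sum_right) (auto intro: assms L2_scale basis_mem simp: L2_inner_scale_right)

lemma coeff_combination:
  assumes "finite I"
  shows "coeff k (\<lambda>x. \<Sum>j\<in>I. c j * e j x) = (if k \<in> I then c k else 0)"
proof -
  have "coeff k (\<lambda>x. \<Sum>j\<in>I. c j * e j x) = (\<Sum>j\<in>I. c j * coeff j (e k))"
    by (simp add: L2_inner_commute[of S "e k"] inner_combination basis_mem)
  also have "\<dots> = (\<Sum>j\<in>I. if k = j then c j else 0)"
    by (intro sum.cong) (auto simp: orthonormal)
  finally show ?thesis using assms by simp
qed

lemma norm_combination:
  assumes "finite I"
  shows "(L2_norm S (\<lambda>x. \<Sum>j\<in>I. c j * e j x))\<^sup>2 = (\<Sum>j\<in>I. (c j)\<^sup>2)"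
  unfolding L2_norm_sq inner_combination[OF combination_mem] coeff_combination[OF assms]
  by (intro sum.cong) (auto simp: power2_eq_square)

lemma Bessel:
  assumes "\<phi> \<in> L2 S"
  shows "(\<Sum>j<n. (coeff j \<phi>)\<^sup>2) \<le> (L2_norm S \<phi>)\<^sup>2"
proof -
  let ?s = "\<lambda>x. \<Sum>j<n. coeff j \<phi> * e j x"
  have "0 \<le> L2_inner S (\<lambda>x. \<phi> x + (-1) * ?s x) (\<lambda>x. \<phi> x + (-1) * ?s x)"
    by (rule L2_inner_self_nonneg)
  also have "\<dots> = L2_inner S \<phi> \<phi> + 2 * (-1) * L2_inner S \<phi> ?s + (-1)\<^sup>2 * L2_inner S ?s ?s"
    by (rule L2_inner_expand[OF assms combination_mem])
  also have "L2_inner S \<phi> ?s = (\<Sum>j<n. (coeff j \<phi>)\<^sup>2)"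
    unfolding L2_inner_commute[of S \<phi>] inner_combination[OF assms] by (simp add: power2_eq_square)
  also have "L2_inner S ?s ?s = (\<Sum>j<n. (coeff j \<phi>)\<^sup>2)"
    using norm_combination[of "{..<n}" "\<lambda>j. coeff j \<phi>"] by (simp add: L2_norm_sq)
  finally show ?thesis by (simp add: L2_norm_sq)
qed

lemma coeff_sq_summable: "\<phi> \<in> L2 S \<Longrightarrow> summable (\<lambda>j. (coeff j \<phi>)\<^sup>2)"
  by (rule summableI_nonneg_bounded[where x="(L2_norm S \<phi>)\<^sup>2"]) (auto intro: Bessel)

lemma Riesz_Fischer:
  assumes c: "summable (\<lambda>j. (c j)\<^sup>2)"
  obtains g where "g \<in> L2 S" "(\<lambda>n. L2_norm S (\<lambda>x. (\<Sum>j<n. c j * e j x) - g x)) \<longlonglongrightarrow> 0"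
proof (rule L2_complete[OF S, of "\<lambda>n x. \<Sum>j<n. c j * e j x"])
  fix \<epsilon> :: real assume e: "\<epsilon> > 0"
  obtain N where N: "\<And>m n. m \<ge> N \<Longrightarrow> norm (\<Sum>j\<in>{m..<n}. (c j)\<^sup>2) < \<epsilon>\<^sup>2"
    using c[unfolded summable_Cauchy] e by (meson zero_less_power)
  have main: "L2_norm S (\<lambda>x. (\<Sum>j<n. c j * e j x) - (\<Sum>j<m. c j * e j x)) < \<epsilon>" if "N \<le> m" "m \<le> n" for m n
  proof -
    have "(\<Sum>j<n. c j * e j x) - (\<Sum>j<m. c j * e j x) = (\<Sum>j\<in>{m..<n}. c j * e j x)" for x
      using that(2) sum_diff_nat_ivl[of 0 m n "\<lambda>j. c j * e j x"] by (simp add: atLeast0LessThan)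
    hence "(L2_norm S (\<lambda>x. (\<Sum>j<n. c j * e j x) - (\<Sum>j<m. c j * e j x)))\<^sup>2 = (\<Sum>j\<in>{m..<n}. (c j)\<^sup>2)"
      by (simp add: norm_combination)
    also have "\<dots> < \<epsilon>\<^sup>2" using N[OF that(1), of n] by simp
    finally show ?thesis using e by (simp add: power_less_imp_less_base)
  qed
  show "\<exists>N. \<forall>m\<ge>N. \<forall>n\<ge>N. L2_norm S (\<lambda>x. (\<Sum>j<m. c j * e j x) - (\<Sum>j<n. c j * e j x)) < \<epsilon>"
  proof (intro exI allI impI)
    fix m n assume "N \<le> m" "N \<le> n"
    thus "L2_norm S (\<lambda>x. (\<Sum>j<m. c j * e j x) - (\<Sum>j<n. c j * e j x)) < \<epsilon>"
      using main[of m n] main[of n m]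
        L2_norm_minus_commute[of S "\<lambda>x. \<Sum>j<m. c j * e j x" "\<lambda>x. \<Sum>j<n. c j * e j x"]
      by (cases "m \<le> n") auto
  qed
qed (use that combination_mem in auto)

lemma inner_limit:
  assumes "g \<in> L2 S" "\<psi> \<in> L2 S"
    and "(\<lambda>n. L2_norm S (\<lambda>x. (\<Sum>j<n. c j * e j x) - g x)) \<longlonglongrightarrow> 0"
  shows "(\<lambda>j. c j * coeff j \<psi>) sums L2_inner S g \<psi>"
proof -
  have "(\<lambda>n. (\<Sum>j<n. c j * coeff j \<psi>) - L2_inner S g \<psi>) \<longlonglongrightarrow> 0"
  proof (rule Lim_null_comparison)
    show "\<forall>\<^sub>F n in sequentially. norm ((\<Sum>j<n. c j * coeff j \<psi>) - L2_inner S g \<psi>)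
        \<le> L2_norm S \<psi> * L2_norm S (\<lambda>x. (\<Sum>j<n. c j * e j x) - g x)"
    proof (intro always_eventually allI)
      fix n
      have "(\<Sum>j<n. c j * coeff j \<psi>) - L2_inner S g \<psi> = L2_inner S \<psi> (\<lambda>x. (\<Sum>j<n. c j * e j x) - g x)"
        using L2_inner_diff_right[OF assms(2) combination_mem assms(1)] inner_combination[OF assms(2)]
        by (simp add: L2_inner_commute[of S \<psi>])
      thus "norm ((\<Sum>j<n. c j * coeff j \<psi>) - L2_inner S g \<psi>)
        \<le> L2_norm S \<psi> * L2_norm S (\<lambda>x. (\<Sum>j<n. c j * e j x) - g x)"
        using L2_Cauchy_Schwarz[OF assms(2) L2_diff[OF combination_mem assms(1)]] by simp
    qed
    show "(\<lambda>n. L2_norm S \<psi> * L2_norm S (\<lambda>x. (\<Sum>j<n. c j * e j x) - g x)) \<longlonglongrightarrow> 0"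
      using tendsto_mult[OF tendsto_const assms(3)] by simp
  qed
  thus ?thesis by (simp add: sums_def LIM_zero_iff)
qed

lemma coeff_limit:
  assumes "g \<in> L2 S" "(\<lambda>n. L2_norm S (\<lambda>x. (\<Sum>j<n. c j * e j x) - g x)) \<longlonglongrightarrow> 0"
  shows "coeff k g = c k"
proof -
  have "(\<lambda>j. c j * coeff j (e k)) sums L2_inner S g (e k)"
    by (rule inner_limit[OF assms(1) basis_mem assms(2)])
  moreover have "(\<lambda>j. c j * coeff j (e k)) sums (c k)"
    using sums_single[of k c] by (simp add: orthonormal if_distrib[of "\<lambda>x. _ * x"] cong: if_cong)
  ultimately show ?thesis using sums_unique2 L2_inner_commute by metis
qed

lemma AE_eqI:
  assumes "\<phi> \<in> L2 S" "\<psi> \<in> L2 S" "\<And>j. coeff j \<phi> = coeff j \<psi>"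
  shows "AE x in lebesgue_on S. \<phi> x = \<psi> x"
  using complete[OF L2_diff[OF assms(1,2)]] assms L2_inner_diff_right[OF basis_mem assms(1,2)] by simp

lemma Parseval:
  assumes "\<phi> \<in> L2 S" "\<psi> \<in> L2 S"
  shows "(\<lambda>j. coeff j \<phi> * coeff j \<psi>) sums L2_inner S \<phi> \<psi>"
proof -
  obtain g where g: "g \<in> L2 S" "(\<lambda>n. L2_norm S (\<lambda>x. (\<Sum>j<n. coeff j \<phi> * e j x) - g x)) \<longlonglongrightarrow> 0"
    using Riesz_Fischer[OF coeff_sq_summable[OF assms(1)]] by blast
  \<comment> \<open>The Fourier series of \<open>\<phi>\<close> converges to a function with the coefficients of \<open>\<phi>\<close>, which is \<open>\<phi>\<close> by completeness.\<close>
  have "AE x in lebesgue_on S. g x = \<phi> x"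
    by (rule AE_eqI[OF g(1) assms(1)]) (simp add: coeff_limit[OF g])
  hence "L2_inner S g \<psi> = L2_inner S \<phi> \<psi>"
    using L2_inner_cong_AE[OF g(1) assms(1) assms(2)] by (simp add: L2_inner_commute[of S _ \<psi>])
  thus ?thesis using inner_limit[OF g(1) assms(2) g(2)] by simp
qed

lemma Parseval_norm: "\<phi> \<in> L2 S \<Longrightarrow> (\<lambda>j. (coeff j \<phi>)\<^sup>2) sums (L2_norm S \<phi>)\<^sup>2"
  using Parseval[of \<phi> \<phi>] unfolding L2_norm_sq by (simp add: power2_eq_square)

lemma coeff_mult_summable:
  assumes "\<phi> \<in> L2 S" "\<psi> \<in> L2 S"
  shows "summable (\<lambda>j. \<bar>coeff j \<phi> * coeff j \<psi>\<bar>)"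
proof (rule summable_comparison_test')
  show "summable (\<lambda>j. (coeff j \<phi>)\<^sup>2 + (coeff j \<psi>)\<^sup>2)"
    by (intro summable_add coeff_sq_summable assms)
  show "norm \<bar>coeff j \<phi> * coeff j \<psi>\<bar> \<le> (coeff j \<phi>)\<^sup>2 + (coeff j \<psi>)\<^sup>2" for j
  proof -
    have "2 * (\<bar>coeff j \<phi>\<bar> * \<bar>coeff j \<psi>\<bar>) \<le> (coeff j \<phi>)\<^sup>2 + (coeff j \<psi>)\<^sup>2"
      using sum_squares_bound[of "\<bar>coeff j \<phi>\<bar>" "\<bar>coeff j \<psi>\<bar>"] by simp
    moreover have "0 \<le> \<bar>coeff j \<phi>\<bar> * \<bar>coeff j \<psi>\<bar>" by simp
    ultimately show ?thesis unfolding real_norm_def abs_abs abs_mult by linarith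
  qed
qed

end

text \<open>
  The values of \<open>P\<close> are functions, so that \<open>P\<close> is linear only up to null sets. Everything that is needed about
  it is contained in its action on the coefficients.
\<close>
locale L2_multiplier = L2_basis S e
  for S :: "(real^'n::finite) set" and e +
  fixes P :: "(real^'n \<Rightarrow> real) \<Rightarrow> (real^'n \<Rightarrow> real)" and \<alpha> :: "nat \<Rightarrow> real"
  assumes P_mem: "\<phi> \<in> L2 S \<Longrightarrow> P \<phi> \<in> L2 S"
    and coeff_P: "\<phi> \<in> L2 S \<Longrightarrow> coeff j (P \<phi>) = \<alpha> j * coeff j \<phi>"
    and \<alpha>: "0 < \<alpha> j" "\<alpha> j \<le> 1"
begin

definition defect :: "(real^'n \<Rightarrow> real) \<Rightarrow> (real^'n \<Rightarrow> real)" where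
  "defect \<phi> = (\<lambda>x. \<phi> x - P \<phi> x)"

lemma defect_mem: "\<phi> \<in> L2 S \<Longrightarrow> defect \<phi> \<in> L2 S"
  unfolding defect_def by (intro L2_diff P_mem)

lemma coeff_defect: "\<phi> \<in> L2 S \<Longrightarrow> coeff j (defect \<phi>) = (1 - \<alpha> j) * coeff j \<phi>"
  unfolding defect_def by (simp add: L2_inner_diff_right basis_mem P_mem coeff_P algebra_simps)

lemma defect_pow_mem: "\<phi> \<in> L2 S \<Longrightarrow> (defect ^^ n) \<phi> \<in> L2 S"
  by (induction n) (auto intro: defect_mem)

lemma coeff_defect_pow: "\<phi> \<in> L2 S \<Longrightarrow> coeff j ((defect ^^ n) \<phi>) = (1 - \<alpha> j) ^ n * coeff j \<phi>"
  by (induction n) (auto simp: coeff_defect defect_pow_mem)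

lemma inner_defect_pow:
  assumes "\<phi> \<in> L2 S" "\<psi> \<in> L2 S"
  shows "(\<lambda>j. (1 - \<alpha> j) ^ n * (coeff j \<phi> * coeff j \<psi>)) sums L2_inner S \<phi> ((defect ^^ n) \<psi>)"
  using Parseval[OF assms(1) defect_pow_mem[OF assms(2), of n]]
  by (simp add: coeff_defect_pow assms mult_ac)

lemma defect_pow_symmetric:
  assumes "\<phi> \<in> L2 S" "\<psi> \<in> L2 S"
  shows "L2_inner S \<phi> ((defect ^^ n) \<psi>) = L2_inner S ((defect ^^ n) \<phi>) \<psi>"
  using inner_defect_pow[OF assms, of n] inner_defect_pow[OF assms(2,1), of n]
  by (simp add: sums_iff mult.commute L2_inner_commute)

lemma norm_defect_pow_le:
  assumes "\<phi> \<in> L2 S"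
  shows "L2_norm S ((defect ^^ n) \<phi>) \<le> L2_norm S \<phi>"
proof -
  note A = Parseval_norm[OF defect_pow_mem[OF assms, of n]] and B = Parseval_norm[OF assms]
  have "(L2_norm S ((defect ^^ n) \<phi>))\<^sup>2 \<le> (L2_norm S \<phi>)\<^sup>2"
  proof (rule sums_le[OF _ A B])
    fix j
    have "\<bar>1 - \<alpha> j\<bar> ^ n \<le> 1" using \<alpha>[of j] by (intro power_le_one) auto
    hence "\<bar>coeff j ((defect ^^ n) \<phi>)\<bar> \<le> \<bar>coeff j \<phi>\<bar>"
      by (simp add: coeff_defect_pow assms abs_mult power_abs mult_left_le_one_le)
    thus "(coeff j ((defect ^^ n) \<phi>))\<^sup>2 \<le> (coeff j \<phi>)\<^sup>2" by (simp add: abs_le_square_iff)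
  qed
  thus ?thesis by (simp add: power2_le_iff_abs_le L2_norm_nonneg)
qed

lemma norm_defect_le: "\<phi> \<in> L2 S \<Longrightarrow> L2_norm S (defect \<phi>) \<le> L2_norm S \<phi>"
  using norm_defect_pow_le[of \<phi> 1] by simp

lemma P_scale_AE:
  assumes "\<phi> \<in> L2 S"
  shows "AE x in lebesgue_on S. P (\<lambda>x. c * \<phi> x) x = c * P \<phi> x"
  using assms by (intro AE_eqI P_mem L2_scale) (auto simp: coeff_P L2_scale L2_inner_scale_right P_mem)

text \<open>
  Kaluza's expansion at the point \<open>1 - \<alpha> j\<close>, in each coefficient, weighted by the summable products of the
  coefficients of \<open>\<phi>\<close> and \<open>a\<close>. The error after \<open>N\<close> terms is at most the tail of the series \<open>kaluza\<close>,
  uniformly in \<open>j\<close>, so no interchange of two infinite sums is necessary.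
\<close>
lemma resolvent_expansion:
  assumes mem: "\<phi> \<in> L2 S" "a \<in> L2 S" "v \<in> L2 S" and D: "D > 0"
    and lam: "\<And>j. 0 \<le> lam j" "\<And>j. \<alpha> j = exp (- D * lam j)"
    and av: "\<And>j. coeff j a = (2 / D + lam j) * coeff j v"
  shows "(\<lambda>N. 1/2 * L2_inner S \<phi> a - (\<Sum>n<N. kaluza n * L2_inner S \<phi> ((defect ^^ n) a)))
           \<longlonglongrightarrow> L2_inner S \<phi> v / D"
proof -
  define B where "B = (\<Sum>j. \<bar>coeff j \<phi> * coeff j a\<bar>)"
  define r where "r N = suminf kaluza - (\<Sum>n<N. kaluza n)" for N
  let ?err = "\<lambda>N. 1/2 * L2_inner S \<phi> a - (\<Sum>n<N. kaluza n * L2_inner S \<phi> ((defect ^^ n) a)) - L2_inner S \<phi> v / D"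
  let ?w = "\<lambda>N j. 1/2 - (\<Sum>n<N. kaluza n * (1 - \<alpha> j) ^ n) - 1 / (2 + D * lam j)"
  have s1: "(\<lambda>j. ?w N j * (coeff j \<phi> * coeff j a)) sums ?err N" for N
  proof -
    have "(\<lambda>j. 1/2 * (coeff j \<phi> * coeff j a)
               - (\<Sum>n<N. kaluza n * ((1 - \<alpha> j) ^ n * (coeff j \<phi> * coeff j a)))
               - (coeff j \<phi> * coeff j v) / D) sums ?err N"
      by (intro sums_diff sums_mult sums_sum sums_divide Parseval inner_defect_pow mem)
    moreover have "1/2 * (coeff j \<phi> * coeff j a)
               - (\<Sum>n<N. kaluza n * ((1 - \<alpha> j) ^ n * (coeff j \<phi> * coeff j a)))
               - (coeff j \<phi> * coeff j v) / D = ?w N j * (coeff j \<phi> * coeff j a)" for j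
    proof -
      have *: "coeff j a * (1 / (2 + D * lam j)) = coeff j v / D"
      proof -
        have p: "2 + D * lam j > 0" using D lam(1)[of j] by (simp add: add_pos_nonneg)
        have "2 / D + lam j = (2 + D * lam j) / D" using D by (simp add: field_simps)
        thus ?thesis using p by (simp add: av)
      qed
      have "(coeff j \<phi> * coeff j v) / D = (coeff j \<phi> * coeff j a) * (1 / (2 + D * lam j))"
        unfolding mult.assoc * by simp
      thus ?thesis by (simp add: algebra_simps sum_distrib_left)
    qed
    ultimately show ?thesis by simp
  qed
  have w: "0 \<le> ?w N j \<and> ?w N j \<le> r N" for N j
  proof -
    let ?y = "1 - \<alpha> j"
    have y: "0 \<le> ?y" "?y < 1" using \<alpha>[of j] by auto
    have "ln (1 - ?y) = - D * lam j" by (simp add: lam(2))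
    hence sy: "(\<lambda>n. kaluza n * ?y ^ n) sums (1/2 - 1 / (2 + D * lam j))" using kaluza_sums[OF y] by simp
    hence t: "(\<lambda>n. kaluza (n + N) * ?y ^ (n + N)) sums ?w N j"
      using sums_iff_shift[of "\<lambda>n. kaluza n * ?y ^ n" N "?w N j"] by simp
    have rs: "(\<lambda>n. kaluza (n + N)) sums r N"
      using sums_iff_shift[of kaluza N "r N"] kaluza_summable by (simp add: r_def summable_sums)
    have le: "kaluza (n + N) * ?y ^ (n + N) \<le> kaluza (n + N)" for n
      using y kaluza_nonneg[of "n + N"] by (intro mult_right_le_one_le power_le_one) auto
    have "?w N j \<le> r N" by (rule sums_le[OF le t rs])
    moreover have "0 \<le> ?w N j"
      by (rule sums_le[OF _ sums_zero t]) (use y kaluza_nonneg in auto)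
    ultimately show ?thesis by simp
  qed
  have r0: "r \<longlonglongrightarrow> 0"
    using summable_LIMSEQ[OF kaluza_summable] unfolding r_def by (auto intro!: tendsto_eq_intros)
  have "?err \<longlonglongrightarrow> 0"
  proof (rule Lim_null_comparison)
    show "(\<lambda>N. r N * B) \<longlonglongrightarrow> 0" using tendsto_mult[OF r0 tendsto_const[of B]] by simp
    show "\<forall>\<^sub>F N in sequentially. norm (?err N) \<le> r N * B"
    proof (intro always_eventually allI)
      fix N
      have ab: "(\<lambda>j. r N * \<bar>coeff j \<phi> * coeff j a\<bar>) sums (r N * B)"
        unfolding B_def by (intro sums_mult summable_sums coeff_mult_summable mem)
      have le: "\<bar>?w N j * (coeff j \<phi> * coeff j a)\<bar> \<le> r N * \<bar>coeff j \<phi> * coeff j a\<bar>" for j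
      proof -
        have "\<bar>?w N j\<bar> \<le> r N" using w[of j N] by linarith
        thus ?thesis unfolding abs_mult[of "?w N j"] by (rule mult_right_mono) simp
      qed
      have "?err N \<le> r N * B"
        by (rule sums_le[OF _ s1 ab]) (use le in \<open>auto simp: abs_le_iff\<close>)
      moreover have "- (r N * B) \<le> ?err N"
        by (rule sums_le[OF _ sums_minus[OF ab] s1]) (metis le abs_le_D2 minus_le_iff)
      ultimately show "norm (?err N) \<le> r N * B"
        by (simp add: abs_le_iff)
    qed
  qed
  thus ?thesis by (simp add: LIM_zero_iff)
qed

end

text \<open>
  Two multipliers for two orthonormal bases, so that they need not commute.
\<close>
locale L2_multiplier_pair =
  A: L2_multiplier S e P \<alpha> + B: L2_multiplier S e' P' \<beta>
  for S :: "(real^'n::finite) set" and e P \<alpha> e' P' \<beta>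
begin

abbreviation (input) T :: "(real^'n \<Rightarrow> real) \<Rightarrow> (real^'n \<Rightarrow> real)" where
  "T \<equiv> \<lambda>\<phi> x. P \<phi> x - P' \<phi> x"

lemma T_mem: "\<phi> \<in> L2 S \<Longrightarrow> T \<phi> \<in> L2 S"
  by (intro L2_diff A.P_mem B.P_mem)

lemma inner_T:
  assumes "\<phi> \<in> L2 S" "\<psi> \<in> L2 S"
  shows "L2_inner S \<psi> (T \<phi>) = L2_inner S \<psi> (P \<phi>) - L2_inner S \<psi> (P' \<phi>)"
  by (intro L2_inner_diff_right A.P_mem B.P_mem assms)

end

locale close_multipliers = L2_multiplier_pair S e P \<alpha> e' P' \<beta>
  for S :: "(real^'n::finite) set" and e P \<alpha> e' P' \<beta> +
  fixes \<delta> :: real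
  assumes close: "\<phi> \<in> L2 S \<Longrightarrow> L2_norm S (T \<phi>) \<le> \<delta> * L2_norm S \<phi>"
    and \<delta>: "0 < \<delta>" "\<delta> < 1"
begin

text \<open>
  With \<open>X = 1 - P\<close> and \<open>Y = 1 - P'\<close>, this is the telescoping identity
  \<open>X\<^sup>n\<^sup>+\<^sup>1 - Y\<^sup>n\<^sup>+\<^sup>1 = (X - Y) X\<^sup>n + Y (X\<^sup>n - Y\<^sup>n)\<close>, in which both powers are contractions. As \<open>X\<close> and \<open>Y\<close> are linear only
  up to null sets, \<open>Y\<close> is moved to the other side of the inner product.
\<close>
lemma power_difference:
  assumes "a \<in> L2 S" "b \<in> L2 S"
  shows "\<bar>L2_inner S b ((A.defect ^^ n) a) - L2_inner S b ((B.defect ^^ n) a)\<bar> \<le> real n * \<delta> * (L2_norm S a * L2_norm S b)"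
  using assms(2)
proof (induction n arbitrary: b)
  case (Suc n)
  note b = \<open>b \<in> L2 S\<close>
  let ?z = "(A.defect ^^ n) a"
  have z: "?z \<in> L2 S" by (rule A.defect_pow_mem[OF assms(1)])
  have "L2_inner S b ((B.defect ^^ Suc n) a) = L2_inner S (B.defect b) ((B.defect ^^ n) a)"
    using B.defect_pow_symmetric[OF b B.defect_pow_mem[OF assms(1), of n], of 1] by simp
  moreover have "L2_inner S b (B.defect ?z) = L2_inner S (B.defect b) ?z"
    using B.defect_pow_symmetric[OF b z, of 1] by simp
  moreover have "L2_inner S b (A.defect ?z) - L2_inner S b (B.defect ?z) = L2_inner S b (\<lambda>x. P' ?z x - P ?z x)"
  proof -
    have "(\<lambda>x. P' ?z x - P ?z x) = (\<lambda>x. A.defect ?z x - B.defect ?z x)" by (auto simp: A.defect_def B.defect_def)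
    thus ?thesis by (simp add: L2_inner_diff_right[OF b A.defect_mem[OF z] B.defect_mem[OF z]])
  qed
  ultimately have eq: "L2_inner S b ((A.defect ^^ Suc n) a) - L2_inner S b ((B.defect ^^ Suc n) a)
      = L2_inner S b (\<lambda>x. P' ?z x - P ?z x)
        + (L2_inner S (B.defect b) ((A.defect ^^ n) a) - L2_inner S (B.defect b) ((B.defect ^^ n) a))"
    by simp
  have "\<bar>L2_inner S b (\<lambda>x. P' ?z x - P ?z x)\<bar> \<le> L2_norm S b * L2_norm S (\<lambda>x. P' ?z x - P ?z x)"
    by (intro L2_Cauchy_Schwarz b L2_diff A.P_mem B.P_mem z)
  also have "\<dots> \<le> L2_norm S b * (\<delta> * L2_norm S a)"
  proof (rule mult_left_mono)
    have "L2_norm S (\<lambda>x. P' ?z x - P ?z x) \<le> \<delta> * L2_norm S ?z"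
      using close[OF z] L2_norm_minus_commute[of S "P ?z" "P' ?z"] by simp
    also have "\<dots> \<le> \<delta> * L2_norm S a" using A.norm_defect_pow_le[OF assms(1), of n] \<delta> by simp
    finally show "L2_norm S (\<lambda>x. P' ?z x - P ?z x) \<le> \<delta> * L2_norm S a" .
  qed (rule L2_norm_nonneg)
  finally have 1: "\<bar>L2_inner S b (\<lambda>x. P' ?z x - P ?z x)\<bar> \<le> \<delta> * (L2_norm S a * L2_norm S b)"
    by (simp add: mult_ac)
  have "\<bar>L2_inner S (B.defect b) ((A.defect ^^ n) a) - L2_inner S (B.defect b) ((B.defect ^^ n) a)\<bar>
     \<le> real n * \<delta> * (L2_norm S a * L2_norm S (B.defect b))"
    by (rule Suc.IH[OF B.defect_mem[OF b]])
  also have "\<dots> \<le> real n * \<delta> * (L2_norm S a * L2_norm S b)"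
    using B.norm_defect_le[OF b] \<delta> by (intro mult_left_mono) (auto simp: L2_norm_nonneg)
  finally show ?case using 1 unfolding eq by (simp add: algebra_simps)
qed simp

lemma power_difference_min:
  assumes "a \<in> L2 S" "b \<in> L2 S"
  shows "\<bar>L2_inner S b ((A.defect ^^ n) a) - L2_inner S b ((B.defect ^^ n) a)\<bar>
           \<le> min 2 (real n * \<delta>) * (L2_norm S a * L2_norm S b)"
proof -
  have "\<bar>L2_inner S b ((A.defect ^^ n) a)\<bar> \<le> L2_norm S b * L2_norm S a"
    using L2_Cauchy_Schwarz[OF assms(2) A.defect_pow_mem[OF assms(1)]] A.norm_defect_pow_le[OF assms(1), of n]
    by (meson L2_norm_nonneg mult_left_mono order_trans)
  moreover have "\<bar>L2_inner S b ((B.defect ^^ n) a)\<bar> \<le> L2_norm S b * L2_norm S a"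
    using L2_Cauchy_Schwarz[OF assms(2) B.defect_pow_mem[OF assms(1)]] B.norm_defect_pow_le[OF assms(1), of n]
    by (meson L2_norm_nonneg mult_left_mono order_trans)
  ultimately show ?thesis
    using power_difference[OF assms, of n] unfolding min_def by (auto simp: mult_ac)
qed

text \<open>
  If the first multiplier is \<open>exp (- D * A)\<close>, then \<open>a = (2 / D + A) v\<close>; likewise for the second one
  and \<open>b\<close>, \<open>u\<close>. The left-hand side is thus the matrix element at \<open>a\<close> and \<open>b\<close> of the difference of the
  two resolvents. Both are expanded in the powers of \<open>1 - P\<close> and \<open>1 - P'\<close>, which are compared term by term.
\<close>
lemma resolvent_stability:
  assumes mem: "a \<in> L2 S" "v \<in> L2 S" "b \<in> L2 S" "u \<in> L2 S" and D: "D > 0"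
    and lam: "\<And>j. 0 \<le> lam j" "\<And>j. \<alpha> j = exp (- D * lam j)"
    and av: "\<And>j. A.coeff j a = (2 / D + lam j) * A.coeff j v"
    and lam': "\<And>j. 0 \<le> lam' j" "\<And>j. \<beta> j = exp (- D * lam' j)"
    and bu: "\<And>j. B.coeff j b = (2 / D + lam' j) * B.coeff j u"
  shows "\<bar>L2_inner S b v - L2_inner S a u\<bar> \<le> 4 * D / (2 + ln (1 / \<delta>)) * (L2_norm S a * L2_norm S b)"
proof -
  let ?K = "4 / (2 + ln (1 / \<delta>)) * (L2_norm S a * L2_norm S b)"
  have "(\<lambda>N. (1/2 * L2_inner S b a - (\<Sum>n<N. kaluza n * L2_inner S b ((A.defect ^^ n) a)))
     - (1/2 * L2_inner S a b - (\<Sum>n<N. kaluza n * L2_inner S a ((B.defect ^^ n) b)))) \<longlonglongrightarrow> L2_inner S b v / D - L2_inner S a u / D"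
    by (intro tendsto_diff A.resolvent_expansion[OF mem(3,1,2) D lam av] B.resolvent_expansion[OF mem(1,3,4) D lam' bu])
  moreover have "norm ((1/2 * L2_inner S b a - (\<Sum>n<N. kaluza n * L2_inner S b ((A.defect ^^ n) a)))
     - (1/2 * L2_inner S a b - (\<Sum>n<N. kaluza n * L2_inner S a ((B.defect ^^ n) b)))) \<le> ?K" for N
  proof -
    have sym: "L2_inner S a ((B.defect ^^ n) b) = L2_inner S b ((B.defect ^^ n) a)" for n
      using B.defect_pow_symmetric[OF mem(1,3)] by (simp add: L2_inner_commute)
    have "(1/2 * L2_inner S b a - (\<Sum>n<N. kaluza n * L2_inner S b ((A.defect ^^ n) a)))
     - (1/2 * L2_inner S a b - (\<Sum>n<N. kaluza n * L2_inner S a ((B.defect ^^ n) b)))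
     = - (\<Sum>n<N. kaluza n * (L2_inner S b ((A.defect ^^ n) a) - L2_inner S b ((B.defect ^^ n) a)))"
      by (simp add: sym L2_inner_commute[of S a b] sum_subtractf right_diff_distrib)
    also have "norm \<dots> \<le> (\<Sum>n<N. kaluza n * (min 2 (real n * \<delta>) * (L2_norm S a * L2_norm S b)))"
      unfolding norm_minus_cancel
    proof (rule sum_norm_le)
      fix n
      show "norm (kaluza n * (L2_inner S b ((A.defect ^^ n) a) - L2_inner S b ((B.defect ^^ n) a)))
          \<le> kaluza n * (min 2 (real n * \<delta>) * (L2_norm S a * L2_norm S b))"
        using mult_left_mono[OF power_difference_min[OF mem(1,3), of n] kaluza_nonneg[of n]]
        by (simp add: abs_mult kaluza_nonneg)
    qed
    also have "\<dots> = (\<Sum>n<N. kaluza n * min 2 (real n * \<delta>)) * (L2_norm S a * L2_norm S b)"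
      unfolding sum_distrib_right by (simp only: mult.assoc)
    also have "\<dots> \<le> ?K"
      by (intro mult_right_mono kaluza_min_bound \<delta>) (simp add: L2_norm_nonneg)
    finally show ?thesis .
  qed
  ultimately have "norm (L2_inner S b v / D - L2_inner S a u / D) \<le> ?K"
    by (intro tendsto_upperbound[OF tendsto_norm always_eventually]) auto
  hence "\<bar>L2_inner S b v - L2_inner S a u\<bar> / D \<le> ?K"
    using D by (simp add: diff_divide_distrib[symmetric])
  hence "\<bar>L2_inner S b v - L2_inner S a u\<bar> \<le> ?K * D" using D by (simp add: pos_divide_le_eq)
  thus ?thesis by (simp add: mult_ac)
qed

end

locale gapped_multipliers = L2_multiplier_pair S e P \<alpha> e' P' \<beta>
  for S :: "(real^'n::finite) set" and e P \<alpha> e' P' \<beta> +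
  fixes q :: real
  assumes same_mean: "L2_inner S (e' 0) \<phi> = L2_inner S (e 0) \<phi>" and top: "\<alpha> 0 = 1" "\<beta> 0 = 1"
    and q: "0 \<le> q" "q < 1" and gap: "j \<noteq> 0 \<Longrightarrow> \<alpha> j \<le> q" "j \<noteq> 0 \<Longrightarrow> \<beta> j \<le> q"
begin

text \<open>
  The quadratic form of \<open>T\<close> lies between \<open>- q * \<parallel>\<phi>\<parallel>\<^sup>2\<close> and \<open>q * \<parallel>\<phi>\<parallel>\<^sup>2\<close>, because the contributions of the common
  eigenvalue \<open>1\<close> cancel and the remaining part of either multiplier is between \<open>0\<close> and \<open>q\<close>. Polarization turns this
  into a bound on the norm. The triangle inequality would only give \<open>2 * q\<close>, which may exceed \<open>1\<close>.
\<close>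
lemma difference_contraction:
  assumes "\<phi> \<in> L2 S"
  shows "L2_norm S (T \<phi>) \<le> q * L2_norm S \<phi>"
proof -
  have aux: "\<bar>L2_inner S \<phi> (T \<phi>)\<bar> \<le> q * (L2_norm S \<phi>)\<^sup>2" if \<phi>: "\<phi> \<in> L2 S" for \<phi>
  proof -
    have sA: "(\<lambda>j. \<alpha> j * (A.coeff j \<phi>)\<^sup>2) sums L2_inner S \<phi> (P \<phi>)"
      using A.Parseval[OF \<phi> A.P_mem[OF \<phi>]] by (simp add: A.coeff_P[OF \<phi>] power2_eq_square mult_ac)
    have sB: "(\<lambda>j. \<beta> j * (B.coeff j \<phi>)\<^sup>2) sums L2_inner S \<phi> (P' \<phi>)"
      using B.Parseval[OF \<phi> B.P_mem[OF \<phi>]] by (simp add: B.coeff_P[OF \<phi>] power2_eq_square mult_ac)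
    let ?z = "(A.coeff 0 \<phi>)\<^sup>2"
    let ?d = "\<lambda>j. if j = (0::nat) then ?z else 0"
    have s0: "?d sums ?z" using sums_single[of 0 "\<lambda>_. ?z"] by simp
    have A2: "L2_inner S \<phi> (P \<phi>) - ?z \<le> q * (L2_norm S \<phi>)\<^sup>2"
    proof (rule sums_le[OF _ sums_diff[OF sA s0] sums_mult[OF A.Parseval_norm[OF \<phi>]]])
      fix j
      show "\<alpha> j * (A.coeff j \<phi>)\<^sup>2 - ?d j \<le> q * (A.coeff j \<phi>)\<^sup>2"
        using q gap by (auto simp: top intro: mult_right_mono)
    qed
    have B2: "L2_inner S \<phi> (P' \<phi>) - ?z \<le> q * (L2_norm S \<phi>)\<^sup>2"
    proof (rule sums_le[OF _ sums_diff[OF sB s0] sums_mult[OF B.Parseval_norm[OF \<phi>]]])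
      fix j
      show "\<beta> j * (B.coeff j \<phi>)\<^sup>2 - ?d j \<le> q * (B.coeff j \<phi>)\<^sup>2"
        using q gap by (auto simp: top same_mean intro: mult_right_mono)
    qed
    have "?z \<le> L2_inner S \<phi> (P \<phi>)"
      by (rule sums_le[OF _ s0 sA]) (use A.\<alpha>(1) in \<open>auto simp: top less_imp_le\<close>)
    moreover have "?z \<le> L2_inner S \<phi> (P' \<phi>)"
      by (rule sums_le[OF _ s0 sB]) (use B.\<alpha>(1) in \<open>auto simp: top same_mean less_imp_le\<close>)
    ultimately show ?thesis using A2 B2 unfolding inner_T[OF \<phi> \<phi>] by linarith
  qed
  have sym: "L2_inner S \<psi> (T \<phi>) = L2_inner S \<phi> (T \<psi>)" if "\<phi> \<in> L2 S" "\<psi> \<in> L2 S" for \<phi> \<psi>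
  proof -
    have "L2_inner S \<psi> (P \<phi>) = L2_inner S \<phi> (P \<psi>)"
      using A.Parseval[OF that(2) A.P_mem[OF that(1)]] A.Parseval[OF that(1) A.P_mem[OF that(2)]]
      by (simp add: sums_iff A.coeff_P that mult_ac)
    moreover have "L2_inner S \<psi> (P' \<phi>) = L2_inner S \<phi> (P' \<psi>)"
      using B.Parseval[OF that(2) B.P_mem[OF that(1)]] B.Parseval[OF that(1) B.P_mem[OF that(2)]]
      by (simp add: sums_iff B.coeff_P that mult_ac)
    ultimately show ?thesis by (simp add: inner_T that)
  qed
  have quad: "L2_inner S (\<lambda>x. \<phi> x + c * \<psi> x) (T (\<lambda>x. \<phi> x + c * \<psi> x)) =
      L2_inner S \<phi> (T \<phi>) + 2 * c * L2_inner S \<psi> (T \<phi>) + c\<^sup>2 * L2_inner S \<psi> (T \<psi>)"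
    if m: "\<phi> \<in> L2 S" "\<psi> \<in> L2 S" for \<phi> \<psi> c
  proof -
    let ?w = "\<lambda>x. \<phi> x + c * \<psi> x"
    have w: "?w \<in> L2 S" by (intro L2_add L2_scale m)
    have r: "L2_inner S ?w \<xi> = L2_inner S \<phi> \<xi> + c * L2_inner S \<psi> \<xi>" if "\<xi> \<in> L2 S" for \<xi>
      using L2_inner_add_right[OF that m(1) L2_scale[OF m(2), of c]]
      by (simp add: L2_inner_commute[of S _ \<xi>] L2_inner_scale_right)
    have "L2_inner S ?w (T ?w) = L2_inner S \<phi> (T ?w) + c * L2_inner S \<psi> (T ?w)"
      by (rule r[OF T_mem[OF w]])
    also have "L2_inner S \<phi> (T ?w) = L2_inner S \<phi> (T \<phi>) + c * L2_inner S \<psi> (T \<phi>)"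
      using sym[OF w m(1)] r[OF T_mem[OF m(1)]] by simp
    also have "L2_inner S \<psi> (T ?w) = L2_inner S \<psi> (T \<phi>) + c * L2_inner S \<psi> (T \<psi>)"
      using sym[OF w m(2)] r[OF T_mem[OF m(2)]] sym[OF m] by simp
    finally show ?thesis by (simp add: power2_eq_square algebra_simps)
  qed
  note \<phi> = assms
  show ?thesis
  proof (cases "L2_norm S \<phi> = 0 \<or> L2_norm S (T \<phi>) = 0")
    case True
    moreover have "L2_norm S (T \<phi>) = 0" if z: "L2_norm S \<phi> = 0"
    proof -
      have "A.coeff j \<phi> = 0" "B.coeff j \<phi> = 0" for j
        using L2_Cauchy_Schwarz[OF A.basis_mem \<phi>, of j] L2_Cauchy_Schwarz[OF B.basis_mem \<phi>, of j] z by auto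
      hence cA: "A.coeff j (P \<phi>) = 0"
        and cB: "B.coeff j (P' \<phi>) = 0" for j
        by (simp_all add: A.coeff_P[OF \<phi>] B.coeff_P[OF \<phi>])
      have "AE x in lebesgue_on S. P \<phi> x = 0"
        by (rule A.complete[OF A.P_mem[OF \<phi>] cA])
      moreover have "AE x in lebesgue_on S. P' \<phi> x = 0"
        by (rule B.complete[OF B.P_mem[OF \<phi>] cB])
      ultimately have "AE x in lebesgue_on S. T \<phi> x = 0" by eventually_elim simp
      thus ?thesis using L2_norm_eq_0_iff[OF T_mem[OF \<phi>]] by blast
    qed
    ultimately show ?thesis using q L2_norm_nonneg[of S \<phi>] by (auto intro: mult_nonneg_nonneg)
  next
    case False
    let ?a = "L2_norm S \<phi>" and ?b = "L2_norm S (T \<phi>)"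
    have pos: "?a > 0" "?b > 0" using False L2_norm_nonneg[of S] by (auto simp: less_le)
    \<comment> \<open>This choice gives both terms of \<open>\<phi> \<plusminus> c T \<phi>\<close> the same norm, which makes polarization sharp.\<close>
    define c where "c = ?a / ?b"
    have c: "c > 0" using pos by (simp add: c_def)
    let ?p = "\<lambda>x. \<phi> x + c * T \<phi> x" and ?m = "\<lambda>x. \<phi> x + (-c) * T \<phi> x"
    note m = \<phi> T_mem[OF \<phi>]
    have mem: "?p \<in> L2 S" "?m \<in> L2 S" by (intro L2_add L2_scale m)+
    have "4 * c * L2_inner S (T \<phi>) (T \<phi>) = L2_inner S ?p (T ?p) - L2_inner S ?m (T ?m)"
      unfolding quad[OF m] by simp
    also have "\<dots> \<le> q * (L2_norm S ?p)\<^sup>2 + q * (L2_norm S ?m)\<^sup>2"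
      using aux[OF mem(1)] aux[OF mem(2)] by linarith
    also have "\<dots> = 2 * q * (?a\<^sup>2 + c\<^sup>2 * ?b\<^sup>2)"
      unfolding L2_norm_sq L2_inner_expand[OF m] by (simp add: algebra_simps)
    also have "c\<^sup>2 * ?b\<^sup>2 = ?a\<^sup>2" using pos by (simp add: c_def field_simps)
    also have "L2_inner S (T \<phi>) (T \<phi>) = ?b\<^sup>2" by (simp only: L2_norm_sq)
    also have "4 * c * ?b\<^sup>2 = 4 * ?a * ?b" using pos by (simp add: c_def power2_eq_square)
    finally have "?a * ?b \<le> ?a * (q * ?a)" by (simp add: power2_eq_square algebra_simps)
    thus ?thesis using pos by simp
  qed
qed

lemma operator_norm_bounds:
  defines "\<delta> \<equiv> L2_operator_norm S (\<lambda>\<phi> x. P \<phi> x - P' \<phi> x)"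
  shows "0 \<le> \<delta>" "\<delta> < 1" "\<phi> \<in> L2 S \<Longrightarrow> L2_norm S (T \<phi>) \<le> \<delta> * L2_norm S \<phi>"
    "\<not> L2_operator_eq S P P' \<Longrightarrow> 0 < \<delta>"
proof -
  note T = difference_contraction
  let ?U = "{\<phi> \<in> L2 S. L2_norm S \<phi> \<le> 1}"
  have z: "(\<lambda>x. 0) \<in> ?U" by (simp add: L2_zero L2_norm_def L2_inner_def)
  have le: "L2_norm S (T \<phi>) \<le> q" if "\<phi> \<in> ?U" for \<phi>
    using T[of \<phi>] that q mult_left_mono[of "L2_norm S \<phi>" 1 q] by auto
  hence bdd: "bdd_above ((\<lambda>\<phi>. L2_norm S (T \<phi>)) ` ?U)" by (auto intro!: bdd_aboveI2)
  have up: "L2_norm S (T \<phi>) \<le> \<delta>" if "\<phi> \<in> ?U" for \<phi>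
    unfolding \<delta>_def L2_operator_norm_def using that bdd by (rule cSUP_upper)
  show d0: "0 \<le> \<delta>" using up[OF z] L2_norm_nonneg[of S "T (\<lambda>x. 0)"] by linarith
  have "\<delta> \<le> q" unfolding \<delta>_def L2_operator_norm_def using z le by (intro cSUP_least) auto
  thus "\<delta> < 1" using q by simp
  show main: "L2_norm S (T \<phi>) \<le> \<delta> * L2_norm S \<phi>" if \<phi>: "\<phi> \<in> L2 S" for \<phi>
  proof (cases "L2_norm S \<phi> = 0")
    case True
    thus ?thesis using T[OF \<phi>] by simp
  next
    case False
    hence pos: "L2_norm S \<phi> > 0" using L2_norm_nonneg[of S \<phi>] by simp
    define c where "c = 1 / L2_norm S \<phi>"
    have c: "c > 0" using pos by (simp add: c_def)
    let ?\<psi> = "\<lambda>x. c * \<phi> x"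
    have psi: "?\<psi> \<in> L2 S" by (rule L2_scale[OF \<phi>])
    have "L2_norm S ?\<psi> = 1" unfolding L2_norm_scale using pos by (simp add: c_def)
    hence "?\<psi> \<in> ?U" using psi by simp
    hence "L2_norm S (T ?\<psi>) \<le> \<delta>" by (rule up)
    moreover have "AE x in lebesgue_on S. T ?\<psi> x = c * T \<phi> x"
      using A.P_scale_AE[OF \<phi>, of c] B.P_scale_AE[OF \<phi>, of c]
      by eventually_elim (simp add: right_diff_distrib)
    hence "L2_norm S (T ?\<psi>) = L2_norm S (\<lambda>x. c * T \<phi> x)"
      by (intro L2_norm_cong_AE T_mem[OF psi] L2_scale[OF T_mem[OF \<phi>]])
    moreover have "L2_norm S (\<lambda>x. c * T \<phi> x) = c * L2_norm S (T \<phi>)" using c by (simp add: L2_norm_scale)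
    ultimately have "c * L2_norm S (T \<phi>) \<le> \<delta>" by linarith
    thus ?thesis using pos by (simp add: c_def field_simps)
  qed
  show "0 < \<delta>" if ne: "\<not> L2_operator_eq S P P'"
  proof (rule ccontr)
    assume "\<not> 0 < \<delta>"
    hence "\<delta> = 0" using d0 by simp
    have "AE x in lebesgue_on S. P \<phi> x = P' \<phi> x" if \<phi>: "\<phi> \<in> L2 S" for \<phi>
    proof -
      have "L2_norm S (T \<phi>) = 0" using main[OF \<phi>] L2_norm_nonneg[of S "T \<phi>"] \<open>\<delta> = 0\<close> by simp
      hence "AE x in lebesgue_on S. T \<phi> x = 0" using L2_norm_eq_0_iff[OF T_mem[OF \<phi>]] by blast
      thus ?thesis by eventually_elim simp
    qed
    thus False using ne by (simp add: L2_operator_eq_def)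
  qed
qed

end

section \<open>The Neumann semigroup\<close>

lemma C2_continuous:
  assumes "f \<in> C2 S" "length is \<le> 2"
  shows "continuous_on S (iter_partial is f)"
  using assms by (auto simp: C2_def intro: uniformly_continuous_imp_continuous)

lemma C2_bounded:
  assumes "f \<in> C2 S" "length is \<le> 2" "bounded S"
  shows "bounded (iter_partial is f ` S)"
  using assms by (auto simp: C2_def intro: bounded_uniformly_continuous_image)

lemma bounded_continuous_L2:
  fixes g :: "real^'n::finite \<Rightarrow> real"
  assumes "S \<in> lmeasurable" "continuous_on S g" "bounded (g ` S)"
  shows "g \<in> L2 S"
proof -
  have m [measurable]: "g \<in> borel_measurable (lebesgue_on S)"
    using assms by (intro continuous_imp_measurable_on_sets_lebesgue) auto
  obtain B where B: "\<And>x. x \<in> S \<Longrightarrow> \<bar>g x\<bar> \<le> B"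
    using assms(3) by (auto simp: bounded_iff)
  have "integrable (lebesgue_on S) (\<lambda>x. (g x)\<^sup>2)"
  proof (rule finite_measure.integrable_const_bound[OF finite_measure_lebesgue_on[OF assms(1)]])
    show "AE x in lebesgue_on S. norm ((g x)\<^sup>2) \<le> B\<^sup>2"
      by (rule AE_I2) (use B abs_le_square_iff in \<open>fastforce intro: power_mono[of "\<bar>g _\<bar>", simplified]\<close>)
  qed measurable
  thus ?thesis using m by (simp add: L2_def)
qed

lemma C2_L2:
  assumes "f \<in> C2 S" "open S" "bounded S"
  shows "f \<in> L2 S"
  using C2_continuous[OF assms(1), of "[]"] C2_bounded[OF assms(1) _ assms(3), of "[]"] assms
  by (intro bounded_continuous_L2) (auto intro: lmeasurable_open)

lemma eigensystem_basis:
  assumes "neumann_eigensystem S f e lam" "open S" "bounded S"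
  shows "L2_basis S e"
proof
  show "S \<in> lmeasurable" using assms by (intro lmeasurable_open)
qed (use assms C2_L2 in \<open>auto simp: neumann_eigensystem_def\<close>)

lemma eigensystem_lam_ge:
  assumes "neumann_eigensystem S f e lam"
  shows "j \<ge> 1 \<Longrightarrow> lam 1 \<le> lam j" "0 \<le> lam j"
proof -
  have 1: "lam 1 \<le> lam j" if "j \<ge> 1" for j
    using that
  proof (induction j rule: dec_induct)
    case (step n)
    thus ?case using assms by (force simp: neumann_eigensystem_def)
  qed simp
  thus "j \<ge> 1 \<Longrightarrow> lam 1 \<le> lam j" .
  show "0 \<le> lam j"
    using 1[of j] assms by (cases "j = 0") (auto simp: neumann_eigensystem_def)
qed

text \<open>
  By the Riesz-Fischer theorem the series defining the semigroup converges, so that the choice in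
  \<open>semigroup_op\<close> is one of an existing function.
\<close>
lemma semigroup_multiplier:
  assumes sys: "neumann_eigensystem S f e lam" and S: "open S" "bounded S" and D: "D > 0"
  shows "L2_multiplier S e (semigroup_op S e lam D) (\<lambda>j. exp (- D * lam j))"
proof -
  interpret L2_basis S e by (rule eigensystem_basis[OF sys S])
  have P: "semigroup_op S e lam D \<phi> \<in> L2 S \<and>
     coeff j (semigroup_op S e lam D \<phi>) = exp (- D * lam j) * coeff j \<phi>" if "\<phi> \<in> L2 S" for \<phi> j
  proof -
    let ?c = "\<lambda>j. exp (- D * lam j) * coeff j \<phi>"
    have "summable (\<lambda>j. (?c j)\<^sup>2)"
    proof (rule summable_comparison_test'[OF coeff_sq_summable[OF that]])
      fix j
      have "exp (- D * lam j) \<le> 1" using D eigensystem_lam_ge(2)[OF sys, of j] by simp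
      hence "(exp (- D * lam j))\<^sup>2 \<le> 1" by (intro power_le_one) auto
      thus "norm ((?c j)\<^sup>2) \<le> (coeff j \<phi>)\<^sup>2"
        by (simp add: power_mult_distrib mult_left_le_one_le)
    qed
    then obtain g where "g \<in> L2 S" "(\<lambda>n. L2_norm S (\<lambda>x. (\<Sum>j<n. ?c j * e j x) - g x)) \<longlonglongrightarrow> 0"
      by (rule Riesz_Fischer)
    hence "\<exists>g. g \<in> L2 S \<and> (\<lambda>n. L2_norm S (\<lambda>x. (\<Sum>j<n. exp (- D * lam j) * e j x * coeff j \<phi>) - g x)) \<longlonglongrightarrow> 0"
      by (auto simp: mult_ac)
    from someI_ex[OF this]
    have *: "semigroup_op S e lam D \<phi> \<in> L2 S"
      "(\<lambda>n. L2_norm S (\<lambda>x. (\<Sum>j<n. ?c j * e j x) - semigroup_op S e lam D \<phi> x)) \<longlonglongrightarrow> 0"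
      by (auto simp: semigroup_op_def mult_ac)
    show ?thesis using * coeff_limit[OF *] by auto
  qed
  show ?thesis
  proof
    show "exp (- D * lam j) \<le> 1" for j using D eigensystem_lam_ge(2)[OF sys, of j] by simp
  qed (use P in auto)
qed

lemma semigroups_gapped:
  assumes sys: "neumann_eigensystem S f e lam" and sys0: "neumann_eigensystem S f\<^sub>0 e\<^sub>0 lam\<^sub>0"
    and S: "open S" "bounded S" and D: "D > 0"
  shows "gapped_multipliers S e (semigroup_op S e lam D) (\<lambda>j. exp (- D * lam j))
    e\<^sub>0 (semigroup_op S e\<^sub>0 lam\<^sub>0 D) (\<lambda>j. exp (- D * lam\<^sub>0 j)) (max (exp (- D * lam 1)) (exp (- D * lam\<^sub>0 1)))"
proof -
  interpret A: L2_multiplier S e "semigroup_op S e lam D" "\<lambda>j. exp (- D * lam j)"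
    by (rule semigroup_multiplier[OF sys S D])
  interpret B: L2_multiplier S e\<^sub>0 "semigroup_op S e\<^sub>0 lam\<^sub>0 D" "\<lambda>j. exp (- D * lam\<^sub>0 j)"
    by (rule semigroup_multiplier[OF sys0 S D])
  show ?thesis
  proof
    show "L2_inner S (e\<^sub>0 0) \<phi> = L2_inner S (e 0) \<phi>" for \<phi>
      unfolding L2_inner_def using sys sys0
      by (intro Bochner_Integration.integral_cong) (auto simp: neumann_eigensystem_def)
    show "exp (- D * lam j) \<le> max (exp (- D * lam 1)) (exp (- D * lam\<^sub>0 1))" if "j \<noteq> 0" for j
      using eigensystem_lam_ge(1)[OF sys, of j] that D by (simp add: le_max_iff_disj)
    show "exp (- D * lam\<^sub>0 j) \<le> max (exp (- D * lam 1)) (exp (- D * lam\<^sub>0 1))" if "j \<noteq> 0" for j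
      using eigensystem_lam_ge(1)[OF sys0, of j] that D by (simp add: le_max_iff_disj)
  qed (use D sys sys0 in \<open>auto simp: neumann_eigensystem_def le_max_iff_disj\<close>)
qed

section \<open>Partial derivatives and integration by parts\<close>

text \<open>
  Only derivatives along single coordinate axes enter the integrations by parts, and for them the rules of
  one-dimensional calculus suffice.
\<close>
definition has_partial :: "(real^'n::finite \<Rightarrow> real) \<Rightarrow> 'n \<Rightarrow> real \<Rightarrow> real^'n \<Rightarrow> bool" where
  "has_partial F i d x \<longleftrightarrow> ((\<lambda>t. F (x + t *\<^sub>R axis i 1)) has_real_derivative d) (at 0)"

lemma has_partial_const: "has_partial (\<lambda>x. c) i 0 x"
  by (simp add: has_partial_def)

lemma has_partial_add:
  "has_partial F i a x \<Longrightarrow> has_partial G i b x \<Longrightarrow> has_partial (\<lambda>x. F x + G x) i (a + b) x"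
  unfolding has_partial_def by (rule DERIV_add)

lemma has_partial_mult:
  "has_partial F i a x \<Longrightarrow> has_partial G i b x \<Longrightarrow> has_partial (\<lambda>x. F x * G x) i (a * G x + F x * b) x"
  unfolding has_partial_def using DERIV_mult[of "\<lambda>t. F (x + t *\<^sub>R axis i 1)" a 0 UNIV "\<lambda>t. G (x + t *\<^sub>R axis i 1)" b]
  by (simp add: mult.commute)

lemma has_partial_chain:
  assumes "has_partial F i a x" "(g has_real_derivative b) (at (F x))"
  shows "has_partial (\<lambda>x. g (F x)) i (b * a) x"
  unfolding has_partial_def
  using DERIV_chain2[of g b "\<lambda>t. F (x + t *\<^sub>R axis i 1)" 0 a UNIV] assms by (simp add: has_partial_def)

lemma has_partial_coord: "has_partial (\<lambda>x. x $ j) i (if i = j then 1 else 0) x"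
  unfolding has_partial_def by (auto simp: axis_def intro!: derivative_eq_intros)

lemma has_partial_norm_sq: "has_partial (\<lambda>x. (norm (x - c))\<^sup>2) i (2 * (x - c) $ i) x"
proof -
  have "(norm (x + t *\<^sub>R axis i 1 - c))\<^sup>2 = (norm (x - c))\<^sup>2 + t * (2 * (x - c) $ i) + t * t" for t
    unfolding power2_norm_eq_inner
    by (simp add: inner_add_left inner_add_right inner_diff_left inner_diff_right inner_axis' inner_axis
        inner_commute algebra_simps)
  thus ?thesis unfolding has_partial_def by (auto intro!: derivative_eq_intros)
qed

lemma has_partial_cong:
  assumes "open V" "x \<in> V" "\<And>y. y \<in> V \<Longrightarrow> F y = G y" "has_partial F i d x"
  shows "has_partial G i d x"
proof -
  have "((\<lambda>t. x + t *\<^sub>R axis i 1) \<longlongrightarrow> x + 0 *\<^sub>R axis i 1) (nhds (0::real))"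
    by (intro tendsto_intros filterlim_ident)
  hence "eventually (\<lambda>t. x + t *\<^sub>R axis i 1 \<in> V) (nhds (0::real))"
    using assms(1,2) by (intro topological_tendstoD) auto
  hence "eventually (\<lambda>t. F (x + t *\<^sub>R axis i 1) = G (x + t *\<^sub>R axis i 1)) (nhds (0::real))"
    by eventually_elim (rule assms(3))
  from DERIV_cong_ev[OF refl this refl, of d] assms(4) show ?thesis
    unfolding has_partial_def by blast
qed

lemma has_partial_unique: "has_partial F i a x \<Longrightarrow> has_partial F i b x \<Longrightarrow> a = b"
  unfolding has_partial_def by (rule DERIV_unique)

lemma has_partial_along:
  assumes "has_partial F i d (x + t *\<^sub>R axis i 1)"
  shows "((\<lambda>t. F (x + t *\<^sub>R axis i 1)) has_real_derivative d) (at t)"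
proof -
  have eq: "x + t *\<^sub>R axis i 1 + s *\<^sub>R axis i 1 = x + (s + t) *\<^sub>R axis i 1" for s
    by (simp add: scaleR_left_distrib)
  have "((\<lambda>s. F (x + (s + t) *\<^sub>R axis i 1)) has_real_derivative d) (at 0)"
    using assms unfolding has_partial_def eq .
  thus ?thesis using DERIV_shift[of "\<lambda>t. F (x + t *\<^sub>R axis i 1)" d 0 t] by simp
qed

lemma has_derivative_has_partial:
  assumes "(F has_derivative F') (at x)"
  shows "has_partial F i (F' (axis i 1)) x"
proof -
  have "((\<lambda>t. x + t *\<^sub>R axis i 1) has_derivative (\<lambda>t. t *\<^sub>R axis i 1)) (at (0::real))"
    by (auto intro!: derivative_eq_intros)
  from has_derivative_compose[OF this, of F F'] assms
  have "((\<lambda>t. F (x + t *\<^sub>R axis i 1)) has_derivative (\<lambda>t. F' (t *\<^sub>R axis i 1))) (at 0)" by simp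
  moreover have "F' (t *\<^sub>R axis i 1) = F' (axis i 1) * t" for t
    using linear_scale[OF has_derivative_linear[OF assms]] by (simp add: mult.commute)
  ultimately show ?thesis by (simp add: has_partial_def has_field_derivative_def)
qed

lemma differentiable_has_partial:
  assumes "F differentiable_on S" "open S" "x \<in> S"
  shows "has_partial F i (partial i F x) x"
proof -
  have "F differentiable (at x)"
    using assms by (metis at_within_open differentiable_on_def)
  hence "(F has_derivative frechet_derivative F (at x)) (at x)" by (simp only: frechet_derivative_works)
  thus ?thesis unfolding partial_def by (rule has_derivative_has_partial)
qed

lemma integral_support:
  fixes G :: "'a::euclidean_space \<Rightarrow> real"
  assumes "\<And>x. x \<in> S \<Longrightarrow> x \<notin> T \<Longrightarrow> G x = 0" "T \<subseteq> S"
  shows "integral S G = integral T G"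
proof -
  have "integral S G = integral S (\<lambda>x. if x \<in> T then G x else 0)"
    using assms by (intro integral_cong) auto
  also have "\<dots> = integral (S \<inter> T) G" by (simp add: integral_restrict_Int Int_commute)
  finally show ?thesis using assms(2) by (simp add: Int_absorb1)
qed

lemma integral_translate:
  fixes G :: "'a::euclidean_space \<Rightarrow> real"
  assumes "bounded K" "\<And>x. x \<notin> K \<Longrightarrow> G x = 0"
  shows "integral UNIV (\<lambda>x. G (v + x)) = integral UNIV G"
proof -
  have "bounded ((\<lambda>x. x - v) ` K)" using assms(1) by (rule bounded_translation_minus)
  then obtain a where a: "(\<lambda>x. x - v) ` K \<subseteq> cbox (-a) a" using bounded_subset_cbox_symmetric by blast
  have out: "G (v + x) = 0" if "x \<notin> cbox (-a) a" for x
  proof -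
    have "x \<notin> (\<lambda>x. x - v) ` K" using a that by blast
    hence "v + x \<notin> K" by (auto simp: image_iff)
    thus ?thesis by (rule assms(2))
  qed
  have out2: "G x = 0" if "x \<notin> cbox (-a + v) (a + v)" for x
  proof -
    have "x - v \<notin> cbox (-a) a"
      using that by (force simp: mem_box inner_diff_left inner_add_left algebra_simps)
    from out[OF this] show ?thesis by simp
  qed
  have "integral UNIV (\<lambda>x. G (v + x)) = integral (cbox (-a) a) (G \<circ> (+) v)"
    using integral_support[of UNIV "cbox (-a) a" "\<lambda>x. G (v + x)"] out by (simp add: o_def)
  also have "\<dots> = integral (cbox (-a + v) (a + v)) G"
    unfolding integral_def integrable_on_def has_integral_shift_cbox_iff ..
  also have "\<dots> = integral UNIV G"
    using integral_support[of UNIV "cbox (-a + v) (a + v)" G] out2 by simp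
  finally show ?thesis .
qed

text \<open>
  The integral of \<open>F\<close> over the whole space does not change when \<open>F\<close> is translated in direction \<open>i\<close>.
  Differentiating under the integral sign at translation \<open>0\<close> yields the integral of \<open>F'\<close>.
\<close>
lemma integral_partial_UNIV:
  fixes F :: "real^'n::finite \<Rightarrow> real"
  assumes F: "\<And>x. has_partial F i (F' x) x" and c: "continuous_on UNIV F" "continuous_on UNIV F'"
    and K: "compact K" "\<And>x. x \<notin> K \<Longrightarrow> F x = 0"
  shows "integral UNIV F' = 0" "x \<notin> K \<Longrightarrow> F' x = 0"
proof -
  show z: "F' x = 0" if "x \<notin> K" for x
  proof (rule has_partial_unique[OF F])
    show "has_partial F i 0 x"
      by (rule has_partial_cong[of "- K" x "\<lambda>_. 0"])
        (use that K in \<open>auto simp: compact_imp_closed open_Compl has_partial_const\<close>)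
  qed
  let ?e = "axis i 1 :: real^'n"
  let ?K = "(\<lambda>(x, t). x + t *\<^sub>R ?e) ` (K \<times> {-1..1::real})"
  have "compact ?K"
    by (intro compact_continuous_image compact_Times K compact_Icc) (auto simp: split_def intro!: continuous_intros)
  then obtain a where a: "?K \<subseteq> cbox (-a) a"
    using compact_imp_bounded bounded_subset_cbox_symmetric by blast
  let ?U = "{-1<..<1::real}"
  let ?J = "\<lambda>t. integral (cbox (-a) a) (\<lambda>x. F (x + t *\<^sub>R ?e))"
  have "(?J has_field_derivative integral (cbox (-a) a) (\<lambda>x. F' (x + 0 *\<^sub>R ?e))) (at 0 within ?U)"
  proof (rule leibniz_rule_field_derivative[where fx="\<lambda>t x. F' (x + t *\<^sub>R ?e)"])
    show "((\<lambda>t. F (x + t *\<^sub>R ?e)) has_field_derivative F' (x + t *\<^sub>R ?e)) (at t within ?U)" for t x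
      by (rule has_field_derivative_at_within[OF has_partial_along[OF F]])
    show "(\<lambda>x. F (x + t *\<^sub>R ?e)) integrable_on cbox (-a) a" for t
      by (intro integrable_continuous continuous_on_compose2[OF c(1)] continuous_intros) auto
    show "continuous_on (?U \<times> cbox (-a) a) (\<lambda>(t, x). F' (x + t *\<^sub>R ?e))"
      unfolding split_def by (intro continuous_on_compose2[OF c(2)] continuous_intros) auto
  qed auto
  hence d1: "(?J has_field_derivative integral (cbox (-a) a) F') (at 0)"
    by (simp add: at_within_open[of 0 ?U])
  have const: "?J t = integral UNIV F" if "t \<in> ?U" for t
  proof -
    have "F (x + t *\<^sub>R ?e) = 0" if "x \<notin> cbox (-a) a" for x
    proof (rule K(2), rule notI)
      assume "x + t *\<^sub>R ?e \<in> K"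
      hence "(\<lambda>(x, t). x + t *\<^sub>R ?e) (x + t *\<^sub>R ?e, - t) \<in> ?K"
        using \<open>t \<in> ?U\<close> by (intro imageI) auto
      thus False using a that by auto
    qed
    hence "?J t = integral UNIV (\<lambda>x. F (x + t *\<^sub>R ?e))"
      by (intro integral_support[symmetric]) auto
    also have "\<dots> = integral UNIV F"
      using integral_translate[OF compact_imp_bounded[OF K(1)] K(2), where v="t *\<^sub>R ?e"] by (simp add: add.commute)
    finally show ?thesis .
  qed
  have "(?J has_field_derivative 0) (at 0)"
  proof (rule DERIV_cong_ev[THEN iffD2, OF refl _ refl DERIV_const])
    show "\<forall>\<^sub>F t in nhds 0. ?J t = integral UNIV F"
      using const by (intro eventually_nhds[THEN iffD2] exI[of _ ?U]) auto
  qed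
  from DERIV_unique[OF d1 this] have "integral (cbox (-a) a) F' = 0" .
  moreover have "K \<subseteq> cbox (-a) a"
  proof
    fix x assume "x \<in> K"
    hence "(\<lambda>(x, t). x + t *\<^sub>R ?e) (x, 0) \<in> ?K" by (intro imageI) auto
    thus "x \<in> cbox (-a) a" using a by auto
  qed
  hence "integral UNIV F' = integral (cbox (-a) a) F'" using z by (intro integral_support) auto
  ultimately show "integral UNIV F' = 0" by simp
qed

lemma continuous_zero_extension:
  fixes F :: "real^'n::finite \<Rightarrow> real"
  assumes "open S" "compact K" "K \<subseteq> S" "continuous_on S F" "\<And>x. x \<in> S - K \<Longrightarrow> F x = 0"
  shows "continuous_on UNIV (\<lambda>x. if x \<in> S then F x else 0)"
proof -
  have "continuous_on (S \<union> - K) (\<lambda>x. if x \<in> S then F x else 0)"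
  proof (rule continuous_on_open_Un)
    show "continuous_on S (\<lambda>x. if x \<in> S then F x else 0)"
      using assms(4) by (rule continuous_on_eq) simp
    show "continuous_on (- K) (\<lambda>x. if x \<in> S then F x else 0)"
      by (rule continuous_on_eq[of _ "\<lambda>_. 0"]) (use assms(5) in auto)
  qed (use assms in \<open>auto simp: compact_imp_closed open_Compl\<close>)
  moreover have "S \<union> - K = UNIV" using assms(3) by auto
  ultimately show ?thesis by simp
qed

lemma has_partial_zero_extension:
  fixes F :: "real^'n::finite \<Rightarrow> real"
  assumes "open S" "compact K" "K \<subseteq> S" "\<And>x. x \<in> S - K \<Longrightarrow> F x = 0"
    "\<And>x. x \<in> S \<Longrightarrow> has_partial F i (F' x) x"
  shows "has_partial (\<lambda>x. if x \<in> S then F x else 0) i (if x \<in> S then F' x else 0) x"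
proof (cases "x \<in> S")
  case True
  thus ?thesis using has_partial_cong[OF assms(1) True _ assms(5)[OF True]] by simp
next
  case False
  have "has_partial (\<lambda>x. if x \<in> S then F x else 0) i 0 x"
    by (rule has_partial_cong[of "- K" x "\<lambda>_. 0"])
      (use False assms in \<open>auto simp: compact_imp_closed open_Compl has_partial_const\<close>)
  thus ?thesis using False by simp
qed

text \<open>
  The divergence theorem for functions with compact support in \<open>S\<close>, by extension by zero.
\<close>
lemma integral_partial_eq_0:
  fixes F :: "real^'n::finite \<Rightarrow> real"
  assumes S: "open S" "compact K" "K \<subseteq> S" "\<And>x. x \<in> S - K \<Longrightarrow> F x = 0"
    and F: "\<And>x. x \<in> S \<Longrightarrow> has_partial F i (F' x) x" "continuous_on S F" "continuous_on S F'"
  shows "integral S F' = 0"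
proof -
  have z: "F' x = 0" if "x \<in> S - K" for x
  proof (rule has_partial_unique[OF F(1)])
    show "has_partial F i 0 x"
      by (rule has_partial_cong[of "S - K" x "\<lambda>_. 0"])
        (use that S in \<open>auto simp: compact_imp_closed open_Diff has_partial_const\<close>)
  qed (use that in auto)
  have "integral UNIV (\<lambda>x. if x \<in> S then F' x else 0) = 0"
  proof (rule integral_partial_UNIV(1))
    show "has_partial (\<lambda>x. if x \<in> S then F x else 0) i (if x \<in> S then F' x else 0) x" for x
      by (rule has_partial_zero_extension[OF S F(1)])
  qed (use S z in \<open>auto intro: continuous_zero_extension[OF S(1-3)] F\<close>)
  thus ?thesis by (simp add: integral_restrict_UNIV)
qed

section \<open>Cutoff functions\<close>

text \<open>
  Mixed second derivatives are absent because \<open>\<nabla>\<cdot>(f\<nabla>v)\<close> contains only the pure ones.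
\<close>
definition pure_C2 ::
  "(real^'n::finite \<Rightarrow> real) \<Rightarrow> ('n \<Rightarrow> real^'n \<Rightarrow> real) \<Rightarrow> ('n \<Rightarrow> real^'n \<Rightarrow> real) \<Rightarrow> bool" where
  "pure_C2 F F1 F2 \<longleftrightarrow> continuous_on UNIV F \<and>
     (\<forall>i. continuous_on UNIV (F1 i) \<and> continuous_on UNIV (F2 i) \<and>
        (\<forall>x. has_partial F i (F1 i x) x \<and> has_partial (F1 i) i (F2 i x) x))"

lemma pure_C2D:
  assumes "pure_C2 F F1 F2"
  shows "continuous_on UNIV F" "continuous_on UNIV (F1 i)" "continuous_on UNIV (F2 i)"
    "has_partial F i (F1 i x) x" "has_partial (F1 i) i (F2 i x) x"
  using assms by (auto simp: pure_C2_def)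

lemma pure_C2_const: "pure_C2 (\<lambda>x. c) (\<lambda>i x. 0) (\<lambda>i x. 0)"
  by (simp add: pure_C2_def has_partial_const)

lemma pure_C2_add:
  assumes "pure_C2 F F1 F2" "pure_C2 G G1 G2"
  shows "pure_C2 (\<lambda>x. F x + G x) (\<lambda>i x. F1 i x + G1 i x) (\<lambda>i x. F2 i x + G2 i x)"
  using assms by (auto simp: pure_C2_def intro: has_partial_add continuous_on_add)

lemma pure_C2_mult:
  assumes "pure_C2 F F1 F2" "pure_C2 G G1 G2"
  shows "pure_C2 (\<lambda>x. F x * G x) (\<lambda>i x. F1 i x * G x + F x * G1 i x)
    (\<lambda>i x. F2 i x * G x + 2 * F1 i x * G1 i x + F x * G2 i x)"
  unfolding pure_C2_def
proof (intro conjI allI)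
  note F = pure_C2D[OF assms(1)] and G = pure_C2D[OF assms(2)]
  show "has_partial (\<lambda>x. F x * G x) i (F1 i x * G x + F x * G1 i x) x" for i x
    by (intro has_partial_mult F G)
  have "has_partial (\<lambda>x. F1 i x * G x + F x * G1 i x) i
     ((F2 i x * G x + F1 i x * G1 i x) + (F1 i x * G1 i x + F x * G2 i x)) x" for i x
    by (intro has_partial_add has_partial_mult F G)
  thus "has_partial (\<lambda>x. F1 i x * G x + F x * G1 i x) i (F2 i x * G x + 2 * F1 i x * G1 i x + F x * G2 i x) x" for i x
    by (simp add: algebra_simps)
qed (intro continuous_intros pure_C2D[OF assms(1)] pure_C2D[OF assms(2)])+

lemma pure_C2_chain:
  assumes "pure_C2 F F1 F2" "\<And>z. (g has_real_derivative g1 z) (at z)" "\<And>z. (g1 has_real_derivative g2 z) (at z)"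
    "continuous_on UNIV g2"
  shows "pure_C2 (\<lambda>x. g (F x)) (\<lambda>i x. g1 (F x) * F1 i x) (\<lambda>i x. g2 (F x) * F1 i x * F1 i x + g1 (F x) * F2 i x)"
  unfolding pure_C2_def
proof (intro conjI allI)
  note F = pure_C2D[OF assms(1)]
  have c: "continuous_on UNIV g" "continuous_on UNIV g1"
    using assms(2,3) by (meson DERIV_isCont continuous_at_imp_continuous_on)+
  have c': "continuous_on UNIV (\<lambda>x. g (F x))" "continuous_on UNIV (\<lambda>x. g1 (F x))" "continuous_on UNIV (\<lambda>x. g2 (F x))"
    by (auto intro: continuous_on_compose2[OF _ F(1)] c assms(4))
  show "has_partial (\<lambda>x. g (F x)) i (g1 (F x) * F1 i x) x" for i x
    by (rule has_partial_chain[OF F(4) assms(2)])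
  show "has_partial (\<lambda>x. g1 (F x) * F1 i x) i (g2 (F x) * F1 i x * F1 i x + g1 (F x) * F2 i x) x" for i x
    by (intro has_partial_mult has_partial_chain[OF F(4) assms(3)] F)
  show "continuous_on UNIV (\<lambda>x. g (F x))" by (rule c')
  show "continuous_on UNIV (\<lambda>x. g1 (F x) * F1 i x)" for i by (intro continuous_intros c' F)
  show "continuous_on UNIV (\<lambda>x. g2 (F x) * F1 i x * F1 i x + g1 (F x) * F2 i x)" for i
    by (intro continuous_intros c' F)
qed

lemma pure_C2_coord: "pure_C2 (\<lambda>x. x $ j) (\<lambda>i x. if i = j then 1 else 0) (\<lambda>i x. 0)"
  unfolding pure_C2_def
  by (intro conjI allI has_partial_coord has_partial_const continuous_on_const continuous_on_component continuous_on_id)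

lemma pure_C2_norm_sq: "pure_C2 (\<lambda>x. (norm (x - c))\<^sup>2) (\<lambda>i x. 2 * (x - c) $ i) (\<lambda>i x. 2)"
  unfolding pure_C2_def
proof (intro conjI allI)
  show "has_partial (\<lambda>x. (norm (x - c))\<^sup>2) i (2 * (x - c) $ i) x" for i x by (rule has_partial_norm_sq)
  have "has_partial (\<lambda>x. 2 * (x $ i + - c $ i)) i (0 * (x $ i + - c $ i) + 2 * (1 + 0)) x" for i x
    using has_partial_coord[of i i x]
    by (intro has_partial_mult has_partial_add has_partial_const) simp
  thus "has_partial (\<lambda>x. 2 * (x - c) $ i) i 2 x" for i x by simp
qed (intro continuous_intros)+

lemma pure_C2_sum:
  assumes "\<And>j. j \<in> J \<Longrightarrow> pure_C2 (F j) (F1 j) (F2 j)"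
  shows "pure_C2 (\<lambda>x. \<Sum>j\<in>J. F j x) (\<lambda>i x. \<Sum>j\<in>J. F1 j i x) (\<lambda>i x. \<Sum>j\<in>J. F2 j i x)"
  using assms
proof (induction J rule: infinite_finite_induct)
  case (insert j J)
  thus ?case using pure_C2_add[of "F j" "F1 j" "F2 j" "\<lambda>x. \<Sum>j\<in>J. F j x"] by simp
qed (auto intro: pure_C2_const)

text \<open>
  Hence the cube of the positive part is twice continuously differentiable, which is all the smoothness that cutoffs
  and kernels need here.
\<close>
lemma DERIV_positive_part_power:
  assumes "n \<ge> 1"
  shows "((\<lambda>z. max 0 z ^ Suc n) has_real_derivative (real (Suc n) * max 0 z ^ n)) (at (z::real))"
proof -
  consider "z < 0" | "z = 0" | "z > 0" by linarith
  thus ?thesis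
  proof cases
    case 1
    have "\<forall>\<^sub>F y in nhds z. y < 0" using 1 eventually_nhds_in_open[of "{..<0}" z] by simp
    hence "\<forall>\<^sub>F y in nhds z. max 0 y ^ Suc n = 0" by eventually_elim (simp add: max_def)
    from DERIV_cong_ev[OF refl this refl, of 0] show ?thesis using 1 assms by (simp add: max_def power_0_left)
  next
    case 3
    have "\<forall>\<^sub>F y in nhds z. y > 0" using 3 eventually_nhds_in_open[of "{0<..}" z] by simp
    hence "\<forall>\<^sub>F y in nhds z. max 0 y ^ Suc n = y ^ Suc n" by eventually_elim (simp add: max_def)
    from DERIV_cong_ev[OF refl this refl] DERIV_pow[of "Suc n" z] show ?thesis using 3 by (simp add: max_def)
  next
    case 2
    have "(\<lambda>h. max 0 h ^ n) \<midarrow>0\<rightarrow> max 0 (0::real) ^ n" by (intro tendsto_intros)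
    hence "(\<lambda>h. max 0 h ^ n) \<midarrow>0\<rightarrow> (0::real)" using assms by (simp add: power_0_left)
    hence "(\<lambda>h. (max 0 (0 + h) ^ Suc n - max 0 0 ^ Suc n) / h) \<midarrow>0\<rightarrow> (0::real)"
    proof (rule Lim_transform_eventually)
      show "\<forall>\<^sub>F h in at (0::real). max 0 h ^ n = (max 0 (0 + h) ^ Suc n - max 0 0 ^ Suc n) / h"
        using assms by (auto simp: eventually_at_filter max_def power_0_left intro!: always_eventually)
    qed
    thus ?thesis using 2 assms by (simp add: DERIV_def power_0_left)
  qed
qed

definition bump :: "real^'n::finite \<Rightarrow> real \<Rightarrow> real^'n \<Rightarrow> real" where
  "bump c r x = max 0 (r\<^sup>2 - (norm (x - c))\<^sup>2) ^ 3"

lemma bump_nonneg: "0 \<le> bump c r x" by (simp add: bump_def)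

lemma bump_pos_iff:
  assumes "r > 0"
  shows "0 < bump c r x \<longleftrightarrow> x \<in> ball c r"
proof -
  have "0 < bump c r x \<longleftrightarrow> (norm (x - c))\<^sup>2 < r\<^sup>2"
    by (cases "(norm (x - c))\<^sup>2 < r\<^sup>2") (auto simp: bump_def max_def)
  also have "\<dots> \<longleftrightarrow> norm (x - c) < r"
    using assms power2_less_imp_less[of "norm (x - c)" r] power_strict_mono[of "norm (x - c)" r 2] by auto
  finally show ?thesis by (simp add: dist_norm norm_minus_commute)
qed

lemma pure_C2_positive_part_cube:
  assumes "pure_C2 F F1 F2"
  obtains A1 A2 where "pure_C2 (\<lambda>x. max 0 (F x) ^ 3) A1 A2"
proof (rule that[OF pure_C2_chain[OF assms]])
  show "((\<lambda>z. max 0 z ^ 3) has_real_derivative 3 * max 0 z ^ 2) (at z)" for z :: real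
    using DERIV_positive_part_power[of 2 z] by simp
  have "((\<lambda>z. max 0 z ^ 2) has_real_derivative 2 * max 0 z) (at z)" for z :: real
    using DERIV_positive_part_power[of 1 z] by (simp add: power2_eq_square)
  from DERIV_cmult[OF this, of 3]
  show "((\<lambda>z. 3 * max 0 z ^ 2) has_real_derivative 3 * (2 * max 0 z)) (at z)" for z :: real .
  show "continuous_on UNIV (\<lambda>z::real. 3 * (2 * max 0 z))" by (intro continuous_intros)
qed

lemma pure_C2_bump:
  obtains B1 B2 where "pure_C2 (bump c r) B1 B2"
proof -
  obtain B1 B2 where "pure_C2 (\<lambda>x. max 0 (r\<^sup>2 + (-1) * (norm (x - c))\<^sup>2) ^ 3) B1 B2"
    by (rule pure_C2_positive_part_cube[OF
          pure_C2_add[OF pure_C2_const pure_C2_mult[OF pure_C2_const pure_C2_norm_sq]]])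
  moreover have "(\<lambda>x. max 0 (r\<^sup>2 + (-1) * (norm (x - c))\<^sup>2) ^ 3) = bump c r" by (auto simp: bump_def)
  ultimately show ?thesis using that by simp
qed

text \<open>
  A sum \<open>\<sigma>\<close> of bumps on finitely many balls that cover \<open>S\<^sub>0\<close> exceeds some \<open>\<mu> > 0\<close> on \<open>S\<^sub>0\<close>. Apply to it a
  function that vanishes at \<open>0\<close> and is equal to \<open>1\<close> from \<open>\<mu>\<close> on.
\<close>
lemma smooth_cutoff:
  fixes S S\<^sub>0 :: "(real^'n::finite) set"
  assumes "open S" "compact S\<^sub>0" "S\<^sub>0 \<subseteq> S"
  obtains \<theta> \<theta>1 \<theta>2 K N where "pure_C2 \<theta> \<theta>1 \<theta>2" "compact K" "K \<subseteq> S" "\<And>x. x \<notin> K \<Longrightarrow> \<theta> x = 0"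
    "open N" "S\<^sub>0 \<subseteq> N" "\<And>x. x \<in> N \<Longrightarrow> \<theta> x = 1"
proof -
  have "\<exists>r. 0 < r \<and> cball x r \<subseteq> S" if "x \<in> S\<^sub>0" for x
    using open_contains_cball[of S] assms that by blast
  then obtain r where r: "\<And>x. x \<in> S\<^sub>0 \<Longrightarrow> 0 < r x" "\<And>x. x \<in> S\<^sub>0 \<Longrightarrow> cball x (r x) \<subseteq> S" by metis
  have "S\<^sub>0 \<subseteq> (\<Union>x\<in>S\<^sub>0. ball x (r x))" using r(1) by force
  then obtain C where C: "C \<subseteq> S\<^sub>0" "finite C" "S\<^sub>0 \<subseteq> (\<Union>x\<in>C. ball x (r x))"
    using compactE_image[OF assms(2), of S\<^sub>0 "\<lambda>x. ball x (r x)"] by auto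
  define \<sigma> where "\<sigma> = (\<lambda>x. \<Sum>c\<in>C. bump c (r c) x)"
  have "\<exists>B1 B2. pure_C2 (bump c (r c)) B1 B2" for c using pure_C2_bump[of c "r c"] by blast
  then obtain B1 B2 where B: "\<And>c. pure_C2 (bump c (r c)) (B1 c) (B2 c)" by metis
  note s2 = pure_C2_sum[of C "\<lambda>c. bump c (r c)" B1 B2, OF B, folded \<sigma>_def]
  have pos: "\<sigma> x > 0" if xS: "x \<in> S\<^sub>0" for x
  proof -
    obtain c where c: "c \<in> C" "x \<in> ball c (r c)" using C(3) xS by blast
    hence "0 < bump c (r c) x" using bump_pos_iff[of "r c" c x] r(1) C(1) by blast
    also have "\<dots> \<le> \<sigma> x" unfolding \<sigma>_def using c C(2) by (intro member_le_sum) (auto simp: bump_nonneg)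
    finally show ?thesis .
  qed
  obtain \<mu> where \<mu>: "\<mu> > 0" "\<And>x. x \<in> S\<^sub>0 \<Longrightarrow> \<mu> < \<sigma> x"
  proof (cases "S\<^sub>0 = {}")
    case False
    have "continuous_on S\<^sub>0 \<sigma>" using pure_C2D(1)[OF s2] continuous_on_subset by blast
    from continuous_attains_inf[OF assms(2) False this] obtain z where z: "z \<in> S\<^sub>0" "\<And>y. y \<in> S\<^sub>0 \<Longrightarrow> \<sigma> z \<le> \<sigma> y"
      by blast
    show ?thesis by (rule that[of "\<sigma> z / 2"]) (use pos[OF z(1)] z(2) in \<open>force+\<close>)
  qed (use that[of 1] in auto)
  define \<theta> where "\<theta> = (\<lambda>x. 1 + (-1) * max 0 (1 + (- 1 / \<mu>) * \<sigma> x) ^ 3)"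
  obtain A1 A2 where "pure_C2 (\<lambda>x. max 0 (1 + (- 1 / \<mu>) * \<sigma> x) ^ 3) A1 A2"
    by (rule pure_C2_positive_part_cube[OF pure_C2_add[OF pure_C2_const pure_C2_mult[OF pure_C2_const s2]]])
  from pure_C2_add[OF pure_C2_const[of 1] pure_C2_mult[OF pure_C2_const[of "-1"] this]]
  obtain \<theta>1 \<theta>2 where th: "pure_C2 \<theta> \<theta>1 \<theta>2" unfolding \<theta>_def by blast
  show ?thesis
  proof (rule that[OF th, of "\<Union>c\<in>C. cball c (r c)" "{x. \<mu> < \<sigma> x}"])
    show "compact (\<Union>c\<in>C. cball c (r c))" using C(2) by (intro compact_UN) auto
    show "(\<Union>c\<in>C. cball c (r c)) \<subseteq> S" using r(2) C(1) by blast
    show "\<theta> x = 0" if "x \<notin> (\<Union>c\<in>C. cball c (r c))" for x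
    proof -
      have "bump c (r c) x = 0" if c: "c \<in> C" for c
      proof -
        have "\<not> 0 < bump c (r c) x" using bump_pos_iff[of "r c" c x] r(1) C(1) c \<open>x \<notin> _\<close> by force
        thus ?thesis using bump_nonneg[of c "r c" x] by linarith
      qed
      hence "\<sigma> x = 0" by (simp add: \<sigma>_def)
      thus ?thesis by (simp add: \<theta>_def)
    qed
    show "open {x. \<mu> < \<sigma> x}"
      using pure_C2D(1)[OF s2] by (intro open_Collect_less continuous_intros)
    show "S\<^sub>0 \<subseteq> {x. \<mu> < \<sigma> x}" using \<mu>(2) by blast
    show "\<theta> x = 1" if "x \<in> {x. \<mu> < \<sigma> x}" for x
      using that \<mu>(1) by (simp add: \<theta>_def max_def field_simps)
  qed
qed

section \<open>Mollification\<close>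

lemma integrable_compact_support:
  fixes G :: "'a::euclidean_space \<Rightarrow> real"
  assumes "continuous_on UNIV G" "compact K" "\<And>x. x \<notin> K \<Longrightarrow> G x = 0"
  shows "G integrable_on UNIV"
proof -
  obtain a where a: "K \<subseteq> cbox (-a) a"
    using compact_imp_bounded[OF assms(2)] bounded_subset_cbox_symmetric by blast
  show ?thesis
  proof (rule integrable_on_superset)
    show "G integrable_on cbox (-a) a"
      by (rule integrable_continuous, rule continuous_on_subset[OF assms(1)]) simp
  qed (use a assms(3) in auto)
qed

lemma L2_cbox:
  fixes f :: "real^'n::finite \<Rightarrow> real"
  assumes "continuous_on (cbox a b) f"
  shows "f \<in> L2 (cbox a b)"
  by (intro bounded_continuous_L2 assms lmeasurable_cbox compact_imp_bounded
      compact_continuous_image compact_cbox)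

lemma L2_inner_cbox:
  fixes f g :: "real^'n::finite \<Rightarrow> real"
  assumes "continuous_on (cbox a b) f" "continuous_on (cbox a b) g"
  shows "L2_inner (cbox a b) f g = integral (cbox a b) (\<lambda>x. f x * g x)"
  unfolding L2_inner_def
  by (rule lebesgue_integral_eq_integral) (auto intro!: L2_integrable_mult L2_cbox assms)

lemma integral_Cauchy_Schwarz:
  fixes f g :: "real^'n::finite \<Rightarrow> real"
  assumes "continuous_on (cbox a b) f" "continuous_on (cbox a b) g"
  shows "(integral (cbox a b) (\<lambda>x. f x * g x))\<^sup>2
           \<le> integral (cbox a b) (\<lambda>x. (f x)\<^sup>2) * integral (cbox a b) (\<lambda>x. (g x)\<^sup>2)"
proof -
  have "\<bar>L2_inner (cbox a b) f g\<bar>\<^sup>2 \<le> (L2_norm (cbox a b) f * L2_norm (cbox a b) g)\<^sup>2"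
    by (intro power_mono L2_Cauchy_Schwarz L2_cbox assms) auto
  thus ?thesis
    by (simp add: power_mult_distrib L2_norm_sq L2_inner_cbox assms power2_eq_square[of "f _"] power2_eq_square[of "g _"])
qed

abbreviation unit_box :: "(real^'n::finite) set" where
  "unit_box \<equiv> cbox (- One) One"

text \<open>
  In dimension \<open>n\<close> and for \<open>s > 0\<close>, this is the convolution of \<open>g\<close> with the dilated kernel \<open>s\<^sup>-\<^sup>n k (z / s)\<close>, translated
  by \<open>m\<close>. All kernels used are supported in the unit ball. The box contains this ball, and integrals
  over boxes can be interchanged and differentiated for continuous integrands.
\<close>
definition mollify ::
  "(real^'n::finite \<Rightarrow> real) \<Rightarrow> real \<Rightarrow> real^'n \<Rightarrow> (real^'n \<Rightarrow> real) \<Rightarrow> real^'n \<Rightarrow> real" where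
  "mollify k s m g x = integral unit_box (\<lambda>y. k y * g (x - s *\<^sub>R y - m))"

lemma cball_subset_unit_box: "cball (0::real^'n::finite) 1 \<subseteq> unit_box"
proof
  fix y :: "real^'n" assume y: "y \<in> cball 0 1"
  have "\<bar>y \<bullet> b\<bar> \<le> 1" if "b \<in> Basis" for b
    using Basis_le_norm[OF that, of y] y by simp
  thus "y \<in> unit_box" by (force simp: mem_box abs_le_iff)
qed

lemma mollify_continuous:
  assumes "continuous_on UNIV k" "continuous_on UNIV g"
  shows "continuous_on UNIV (mollify k s m g)"
proof -
  have "continuous_on (UNIV \<times> unit_box) (\<lambda>(x, y). k y * g (x - s *\<^sub>R y - m))"
    unfolding split_def
    by (intro continuous_intros continuous_on_compose2[OF assms(1)] continuous_on_compose2[OF assms(2)]) auto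
  from integral_continuous_on_param[OF this] show ?thesis unfolding mollify_def .
qed

lemma mollify_partial:
  assumes k: "continuous_on UNIV k" and g: "continuous_on UNIV g" "continuous_on UNIV g'"
    and p: "\<And>x. has_partial g i (g' x) x"
  shows "has_partial (mollify k s m g) i (mollify k s m g' x) x"
proof -
  let ?e = "axis i 1 :: real^'a"
  have "((\<lambda>t. integral unit_box (\<lambda>y. k y * g ((x - s *\<^sub>R y - m) + t *\<^sub>R ?e))) has_field_derivative
      integral unit_box (\<lambda>y. k y * g' ((x - s *\<^sub>R y - m) + 0 *\<^sub>R ?e))) (at 0 within UNIV)"
  proof (rule leibniz_rule_field_derivative[where fx="\<lambda>t y. k y * g' ((x - s *\<^sub>R y - m) + t *\<^sub>R ?e)"])
    show "((\<lambda>t. k y * g ((x - s *\<^sub>R y - m) + t *\<^sub>R ?e)) has_field_derivative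
        k y * g' ((x - s *\<^sub>R y - m) + t *\<^sub>R ?e)) (at t within UNIV)" for t y
      by (intro DERIV_cmult has_partial_along p)
    show "(\<lambda>y. k y * g ((x - s *\<^sub>R y - m) + t *\<^sub>R ?e)) integrable_on unit_box" for t
      by (intro integrable_continuous continuous_intros continuous_on_compose2[OF k]
          continuous_on_compose2[OF g(1)]) auto
    show "continuous_on (UNIV \<times> unit_box) (\<lambda>(t, y). k y * g' ((x - s *\<^sub>R y - m) + t *\<^sub>R ?e))"
      unfolding split_def
      by (intro continuous_intros continuous_on_compose2[OF k] continuous_on_compose2[OF g(2)]) auto
  qed auto
  moreover have "mollify k s m g (x + t *\<^sub>R ?e) = integral unit_box (\<lambda>y. k y * g ((x - s *\<^sub>R y - m) + t *\<^sub>R ?e))" for t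
    unfolding mollify_def by (simp add: algebra_simps)
  ultimately show ?thesis by (simp add: has_partial_def mollify_def)
qed

text \<open>
  Derivatives of \<open>g\<close> move to the kernel, each at the cost of a factor \<open>1 / s\<close>.
\<close>
lemma mollify_by_parts:
  assumes k: "continuous_on UNIV k" "continuous_on UNIV k'" "\<And>y. has_partial k i (k' y) y"
      "\<And>y. y \<notin> cball 0 1 \<Longrightarrow> k y = 0"
    and g: "continuous_on UNIV g" "continuous_on UNIV g'" "\<And>x. has_partial g i (g' x) x"
  shows "s * mollify k s m g' x = mollify k' s m g x"
proof -
  let ?e = "axis i 1 :: real^'a"
  let ?F' = "\<lambda>y. k' y * g (x - s *\<^sub>R y - m) + k y * (- s * g' (x - s *\<^sub>R y - m))"
  have gp: "has_partial (\<lambda>y. g (x - s *\<^sub>R y - m)) i (- s * g' (x - s *\<^sub>R y - m)) y" for y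
  proof -
    have "((\<lambda>t. g ((x - s *\<^sub>R y - m) + t *\<^sub>R ?e)) has_real_derivative g' (x - s *\<^sub>R y - m)) (at (- s * 0))"
      using g(3)[of "x - s *\<^sub>R y - m"] by (simp add: has_partial_def)
    hence d: "((\<lambda>t. g ((x - s *\<^sub>R y - m) + (- s * t) *\<^sub>R ?e)) has_real_derivative g' (x - s *\<^sub>R y - m) * (- s)) (at 0)"
      by (rule DERIV_chain2[where g="\<lambda>t. - s * t"]) (auto intro!: derivative_eq_intros)
    have eq: "(x - s *\<^sub>R y - m) + (- s * t) *\<^sub>R ?e = x - s *\<^sub>R (y + t *\<^sub>R ?e) - m" for t
      by (simp add: algebra_simps)
    show ?thesis using d unfolding has_partial_def eq by (simp add: mult.commute)
  qed
  have c: "continuous_on A (\<lambda>y. g (x - s *\<^sub>R y - m))" "continuous_on A (\<lambda>y. g' (x - s *\<^sub>R y - m))"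
     "continuous_on A k" "continuous_on A k'" for A
    using k g by (auto intro!: continuous_intros continuous_on_compose2[OF g(1)] continuous_on_compose2[OF g(2)]
       intro: continuous_on_subset)
  note I = integral_partial_UNIV[of "\<lambda>y. k y * g (x - s *\<^sub>R y - m)" i ?F' "cball 0 1"]
  have z: "integral UNIV ?F' = 0" "\<And>y. y \<notin> cball 0 1 \<Longrightarrow> ?F' y = 0"
    by (rule I; (intro has_partial_mult k gp continuous_intros c compact_cball)?; simp add: k)+
  have "integral UNIV ?F' = integral unit_box ?F'"
    by (rule integral_support, rule z(2)) (use cball_subset_unit_box in blast)+
  also have "\<dots> = integral unit_box (\<lambda>y. k' y * g (x - s *\<^sub>R y - m)) + integral unit_box (\<lambda>y. k y * (- s * g' (x - s *\<^sub>R y - m)))"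
    by (intro integral_add integrable_continuous continuous_intros c)
  also have "integral unit_box (\<lambda>y. k y * (- s * g' (x - s *\<^sub>R y - m))) = - s * mollify k s m g' x"
    unfolding mollify_def by (subst integral_mult_right[symmetric]) (simp add: mult_ac)
  finally show ?thesis using z(1) by (simp add: mollify_def)
qed

text \<open>
  The Cauchy-Schwarz inequality in \<open>y\<close>, then an interchange of the integrals and invariance under translations. It is
  Young's inequality for convolutions, with the \<open>L\<^sup>1\<close> norm of the kernel replaced by its supremum times a volume.
\<close>
lemma mollify_Young:
  fixes k g :: "real^'n::finite \<Rightarrow> real"
  assumes k: "continuous_on UNIV k" "\<And>y. y \<in> unit_box \<Longrightarrow> \<bar>k y\<bar> \<le> B"
    and g: "continuous_on UNIV g" "compact K" "\<And>x. x \<notin> K \<Longrightarrow> g x = 0"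
  shows "integral (cbox a b) (\<lambda>x. (mollify k s m g x)\<^sup>2)
     \<le> (B * measure lborel (unit_box :: (real^'n) set))\<^sup>2 * integral UNIV (\<lambda>x. (g x)\<^sup>2)"
proof -
  let ?V = "measure lborel (unit_box :: (real^'n) set)"
  let ?q = "\<lambda>x y. (g (x - s *\<^sub>R y - m))\<^sup>2"
  let ?N = "integral UNIV (\<lambda>x. (g x)\<^sup>2)"
  have B: "0 \<le> B" using k(2)[of 0] cball_subset_unit_box by force
  have gi: "(\<lambda>x. (g (v + x))\<^sup>2) integrable_on cbox p q" for v p q
    by (intro integrable_continuous continuous_intros continuous_on_compose2[OF g(1)]) auto
  have gs: "continuous_on A (\<lambda>y. g (x - s *\<^sub>R y - m))" "continuous_on A k" for A x
    using k by (auto intro!: continuous_intros continuous_on_compose2[OF g(1)] intro: continuous_on_subset)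
  have 1: "(mollify k s m g x)\<^sup>2 \<le> (B\<^sup>2 * ?V) * integral unit_box (?q x)" for x
  proof -
    have "(mollify k s m g x)\<^sup>2 \<le> integral unit_box (\<lambda>y. (k y)\<^sup>2) * integral unit_box (?q x)"
      unfolding mollify_def by (intro integral_Cauchy_Schwarz gs)
    also have "\<dots> \<le> (B\<^sup>2 * ?V) * integral unit_box (?q x)"
    proof (rule mult_right_mono)
      have "integral unit_box (\<lambda>y. (k y)\<^sup>2) \<le> integral unit_box (\<lambda>y::real^'n. B\<^sup>2)"
        using k(2) B by (intro integral_le integrable_continuous continuous_intros gs)
          (auto simp: abs_le_square_iff[symmetric])
      thus "integral unit_box (\<lambda>y. (k y)\<^sup>2) \<le> B\<^sup>2 * ?V" by (simp add: mult.commute)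
      show "0 \<le> integral unit_box (?q x)"
        by (intro integral_nonneg integrable_continuous continuous_intros gs) auto
    qed
    finally show ?thesis .
  qed
  have 2: "integral (cbox a b) (\<lambda>x. ?q x y) \<le> ?N" for y
  proof -
    let ?v = "- s *\<^sub>R y - m"
    have "integral (cbox a b) (\<lambda>x. ?q x y) = integral (cbox a b) (\<lambda>x. (g (?v + x))\<^sup>2)"
      by (simp add: algebra_simps)
    also have "\<dots> \<le> integral UNIV (\<lambda>x. (g (?v + x))\<^sup>2)"
    proof (rule integral_subset_le)
      show "(\<lambda>x. (g (?v + x))\<^sup>2) integrable_on UNIV"
      proof (rule integrable_compact_support)
        show "compact ((+) (- ?v) ` K)" using g(2) by (rule compact_translation)
        show "(g (?v + x))\<^sup>2 = 0" if "x \<notin> (+) (- ?v) ` K" for x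
        proof -
          have "?v + x \<notin> K" using that by (metis add_minus_cancel image_eqI minus_add_cancel)
          thus ?thesis using g(3) by simp
        qed
      qed (intro continuous_intros continuous_on_compose2[OF g(1)]; auto)
    qed (auto intro: gi)
    also have "\<dots> = ?N"
      using integral_translate[OF compact_imp_bounded[OF g(2)], of "\<lambda>x. (g x)\<^sup>2" ?v] g(3) by simp
    finally show ?thesis .
  qed
  have c2: "continuous_on (cbox (a, - One) (b, One)) (\<lambda>(x, y). ?q x y)"
    unfolding split_def by (intro continuous_intros continuous_on_compose2[OF g(1)]) auto
  have c3: "continuous_on A (\<lambda>x. integral unit_box (?q x))" for A
  proof (rule integral_continuous_on_param)
    show "continuous_on (A \<times> unit_box) (\<lambda>(x, y). ?q x y)"
      unfolding split_def by (intro continuous_intros continuous_on_compose2[OF g(1)]) auto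
  qed
  have "integral (cbox a b) (\<lambda>x. integral unit_box (?q x))
       = integral unit_box (\<lambda>y. integral (cbox a b) (\<lambda>x. ?q x y))"
    by (rule integral_swap_continuous[OF c2])
  also have "\<dots> \<le> integral unit_box (\<lambda>y::real^'n. ?N)"
  proof (intro integral_le 2)
    have "continuous_on (unit_box \<times> cbox a b) (\<lambda>(y, x). ?q x y)"
      unfolding split_def by (intro continuous_intros continuous_on_compose2[OF g(1)]) auto
    thus "(\<lambda>y. integral (cbox a b) (\<lambda>x. ?q x y)) integrable_on unit_box"
      by (intro integrable_continuous integral_continuous_on_param)
  qed auto
  also have "\<dots> = ?V * ?N" by simp
  finally have 3: "integral (cbox a b) (\<lambda>x. integral unit_box (?q x)) \<le> ?V * ?N" .
  have "integral (cbox a b) (\<lambda>x. (mollify k s m g x)\<^sup>2)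
      \<le> integral (cbox a b) (\<lambda>x. (B\<^sup>2 * ?V) * integral unit_box (?q x))"
    by (intro integral_le integrable_continuous continuous_intros c3 1
        continuous_on_subset[OF mollify_continuous[OF k(1) g(1)]]) auto
  also have "\<dots> = (B\<^sup>2 * ?V) * integral (cbox a b) (\<lambda>x. integral unit_box (?q x))"
    by simp
  also have "\<dots> \<le> (B\<^sup>2 * ?V) * (?V * ?N)"
    by (intro mult_left_mono[OF 3] mult_nonneg_nonneg measure_nonneg) simp
  also have "\<dots> = (B * ?V)\<^sup>2 * ?N" by (simp only: power2_eq_square mult_ac)
  finally show ?thesis .
qed

text \<open>
  Here \<open>h\<close> plays the role of the difference of two coefficients, extended by zero. Total derivatives are required because
  the second-order Taylor estimate needs derivatives along arbitrary lines.
\<close>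
locale compact_C2 =
  fixes h :: "real^'n::finite \<Rightarrow> real" and p1 :: "'n \<Rightarrow> real^'n \<Rightarrow> real"
    and p2 :: "'n \<Rightarrow> 'n \<Rightarrow> real^'n \<Rightarrow> real" and K :: "(real^'n) set" and U :: real
  assumes h1: "(h has_derivative (\<lambda>d. \<Sum>i\<in>UNIV. p1 i x * d $ i)) (at x)"
    and h2: "(p1 i has_derivative (\<lambda>d. \<Sum>j\<in>UNIV. p2 i j x * d $ j)) (at x)"
    and cont2: "continuous_on UNIV (p2 i j)"
    and bnd: "\<bar>h x\<bar> \<le> U" "\<bar>p1 i x\<bar> \<le> U" "\<bar>p2 i j x\<bar> \<le> U"
    and K: "compact K" "x \<notin> K \<Longrightarrow> h x = 0"
begin

lemma cont0: "continuous_on UNIV h"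
  using h1 by (intro continuous_at_imp_continuous_on ballI has_derivative_continuous)

lemma cont1: "continuous_on UNIV (p1 i)"
  using h2 by (intro continuous_at_imp_continuous_on ballI has_derivative_continuous)

lemma axis_sum: "(\<Sum>j\<in>UNIV. (c j :: real) * axis i 1 $ j) = c i"
  by (simp add: axis_def if_distrib[of "\<lambda>x. _ * x"] cong: if_cong)

lemma partial1: "has_partial h i (p1 i x) x"
  using has_derivative_has_partial[OF h1, of i x] by (simp add: axis_sum)

lemma partial2: "has_partial (p1 i) j (p2 i j x) x"
  using has_derivative_has_partial[OF h2[of i x], of j] by (simp add: axis_sum)

lemma U_nonneg: "0 \<le> U" using bnd(1)[of 0] by linarith

lemma sum_bound:
  assumes "\<And>i. \<bar>c i\<bar> \<le> M"
  shows "\<bar>\<Sum>i\<in>UNIV. c i * (d::real^'n) $ i\<bar> \<le> real CARD('n) * M * norm d"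
proof -
  have "\<bar>\<Sum>i\<in>UNIV. c i * d $ i\<bar> \<le> (\<Sum>i\<in>(UNIV::'n set). M * norm d)"
  proof (rule order_trans[OF sum_abs sum_mono])
    fix i
    have "0 \<le> M" using assms[of i] by linarith
    thus "\<bar>c i * d $ i\<bar> \<le> M * norm d"
      unfolding abs_mult by (intro mult_mono assms component_le_norm_cart) auto
  qed
  thus ?thesis by simp
qed

lemma curve_derivative:
  assumes "(\<gamma> has_vector_derivative v) (at t)" "(g has_derivative g') (at (\<gamma> t))"
  shows "((\<lambda>t. g (\<gamma> t)) has_real_derivative g' v) (at t)"
proof -
  have "((\<lambda>t. g (\<gamma> t)) has_derivative (\<lambda>t. g' (t *\<^sub>R v))) (at t)"
    using has_derivative_compose[OF assms(1)[unfolded has_vector_derivative_def] assms(2)] .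
  moreover have "g' (t *\<^sub>R v) = g' v * t" for t
    using linear_scale[OF has_derivative_linear[OF assms(2)]] by (simp add: mult.commute)
  ultimately show ?thesis by (simp add: has_field_derivative_def)
qed

lemma line_derivative:
  assumes "(g has_derivative g') (at (x + t *\<^sub>R z))"
  shows "((\<lambda>t. g (x + t *\<^sub>R z)) has_real_derivative g' z) (at t)"
proof (rule curve_derivative[where \<gamma>="\<lambda>t. x + t *\<^sub>R z", OF _ assms])
  show "((\<lambda>t. x + t *\<^sub>R z) has_vector_derivative z) (at t)"
    unfolding has_vector_derivative_def by (auto intro!: derivative_eq_intros)
qed

lemma Lipschitz:
  fixes g :: "real^'n \<Rightarrow> real"
  assumes g: "\<And>x. (g has_derivative (\<lambda>d. \<Sum>i\<in>UNIV. q i x * d $ i)) (at x)"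
    and q: "\<And>i x. \<bar>q i x\<bar> \<le> U"
  shows "\<bar>g y - g x\<bar> \<le> real CARD('n) * U * norm (y - x)"
proof -
  have "\<exists>t. t > 0 \<and> t < 1 \<and> g (x + 1 *\<^sub>R (y - x)) - g (x + 0 *\<^sub>R (y - x)) = (1 - 0) * (\<Sum>i\<in>UNIV. q i (x + t *\<^sub>R (y - x)) * (y - x) $ i)"
    by (rule MVT2[OF zero_less_one line_derivative[OF g]])
  then obtain t where "g y - g x = (\<Sum>i\<in>UNIV. q i (x + t *\<^sub>R (y - x)) * (y - x) $ i)" by auto
  thus ?thesis using sum_bound[of "\<lambda>i. q i (x + t *\<^sub>R (y - x))" U "y - x"] q by simp
qed

lemma second_difference:
  "\<bar>h (x + z) + h (x - z) - 2 * h x\<bar> \<le> 2 * (real CARD('n))\<^sup>2 * U * (norm z)\<^sup>2"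
proof -
  let ?\<gamma> = "\<lambda>t. h (x + t *\<^sub>R z) + h (x + t *\<^sub>R (- z))"
  let ?\<gamma>' = "\<lambda>t. (\<Sum>i\<in>UNIV. p1 i (x + t *\<^sub>R z) * z $ i) + (\<Sum>i\<in>UNIV. p1 i (x + t *\<^sub>R (- z)) * (- z) $ i)"
  have "\<exists>t. t > 0 \<and> t < 1 \<and> ?\<gamma> 1 - ?\<gamma> 0 = (1 - 0) * ?\<gamma>' t"
    by (rule MVT2[OF zero_less_one DERIV_add[OF line_derivative[OF h1] line_derivative[OF h1]]])
  then obtain t where t: "0 < t" "t < 1" and eq: "h (x + z) + h (x - z) - 2 * h x = ?\<gamma>' t" by auto
  have "?\<gamma>' t = (\<Sum>i\<in>UNIV. (p1 i (x + t *\<^sub>R z) - p1 i (x + t *\<^sub>R (- z))) * z $ i)"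
    by (simp add: sum_negf sum_subtractf left_diff_distrib)
  also have "\<bar>\<dots>\<bar> \<le> real CARD('n) * (real CARD('n) * U * (2 * norm z)) * norm z"
  proof (rule sum_bound)
    fix i
    have "\<bar>p1 i (x + t *\<^sub>R z) - p1 i (x + t *\<^sub>R (- z))\<bar>
        \<le> real CARD('n) * U * norm ((x + t *\<^sub>R z) - (x + t *\<^sub>R (- z)))"
      by (rule Lipschitz[OF h2 bnd(3)])
    also have "(x + t *\<^sub>R z) - (x + t *\<^sub>R (- z)) = (2 * t) *\<^sub>R z" by (simp add: scaleR_2 flip: scaleR_scaleR)
    also have "norm ((2 * t) *\<^sub>R z) \<le> 2 * norm z" using t by (simp add: mult_left_le_one_le)
    finally show "\<bar>p1 i (x + t *\<^sub>R z) - p1 i (x + t *\<^sub>R (- z))\<bar> \<le> real CARD('n) * U * (2 * norm z)"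
      using U_nonneg by (simp add: mult_left_mono)
  qed
  finally show ?thesis unfolding eq by (simp only: power2_eq_square mult_ac)
qed

text \<open>
  The kernel is even, so the dilation contributes a second difference of \<open>h\<close>, of order \<open>s\<^sup>2\<close>. The shift is taken to be
  of order \<open>s\<^sup>2\<close> as well, and for it the Lipschitz bound suffices.
\<close>
lemma mollify_approximates:
  assumes \<phi>: "continuous_on UNIV \<phi>" "\<And>y. \<bar>\<phi> y\<bar> \<le> B" "\<And>y. \<phi> (- y) = \<phi> y" "\<And>y. y \<notin> cball 0 1 \<Longrightarrow> \<phi> y = 0"
    and s: "0 \<le> s"
  shows "\<bar>mollify \<phi> s (s\<^sup>2 *\<^sub>R m) h x - integral unit_box \<phi> * h x\<bar>
     \<le> B * measure lborel (unit_box :: (real^'n) set) * ((real CARD('n))\<^sup>2 * U + real CARD('n) * U * norm m) * s\<^sup>2"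
proof -
  let ?V = "measure lborel (unit_box :: (real^'n) set)" and ?d = "real CARD('n)"
  define x' where "x' = x - s\<^sup>2 *\<^sub>R m"
  let ?F = "\<lambda>\<sigma> y. \<phi> y * h (x' + \<sigma> *\<^sub>R y)"
  have B: "0 \<le> B" using \<phi>(2)[of 0] by linarith
  have Fi: "?F \<sigma> integrable_on unit_box" for \<sigma>
    by (intro integrable_continuous continuous_intros continuous_on_compose2[OF \<phi>(1)] continuous_on_compose2[OF cont0]) auto
  have \<phi>i: "\<phi> integrable_on unit_box"
    by (intro integrable_continuous continuous_on_subset[OF \<phi>(1)]) auto
  have m1: "mollify \<phi> s (s\<^sup>2 *\<^sub>R m) h x = integral unit_box (?F (- s))"
    unfolding mollify_def x'_def by (intro integral_cong) (simp add: algebra_simps)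
  have m2: "integral unit_box (?F (- s)) = integral unit_box (?F s)"
    using integral_reflect[of "One" "- One" "?F s"] \<phi>(3) by simp
  have "2 * (integral unit_box (?F (- s)) - integral unit_box \<phi> * h x')
     = integral unit_box (\<lambda>y. \<phi> y * (h (x' + s *\<^sub>R y) + h (x' - s *\<^sub>R y) - 2 * h x'))"
  proof -
    have "integral unit_box (\<lambda>y. \<phi> y * (h (x' + s *\<^sub>R y) + h (x' - s *\<^sub>R y) - 2 * h x'))
      = integral unit_box (\<lambda>y. (?F s y + ?F (- s) y) - \<phi> y * (2 * h x'))"
      by (intro integral_cong) (simp add: algebra_simps)
    also have "\<dots> = (integral unit_box (?F s) + integral unit_box (?F (- s))) - integral unit_box \<phi> * (2 * h x')"
      using Fi[of s] Fi[of "-s"] \<phi>i by (simp add: integral_diff integral_add integrable_add integrable_on_mult_left)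
    finally show ?thesis using m2 by simp
  qed
  also have "\<bar>\<dots>\<bar> \<le> integral unit_box (\<lambda>y::real^'n. B * (2 * ?d\<^sup>2 * U * s\<^sup>2))"
    unfolding real_norm_def[symmetric]
  proof (rule integral_norm_bound_integral)
    show "(\<lambda>y. \<phi> y * (h (x' + s *\<^sub>R y) + h (x' - s *\<^sub>R y) - 2 * h x')) integrable_on unit_box"
      by (intro integrable_continuous continuous_intros continuous_on_compose2[OF \<phi>(1)] continuous_on_compose2[OF cont0]) auto
    show "norm (\<phi> y * (h (x' + s *\<^sub>R y) + h (x' - s *\<^sub>R y) - 2 * h x')) \<le> B * (2 * ?d\<^sup>2 * U * s\<^sup>2)" for y
    proof (cases "y \<in> cball 0 1")
      case True
      have "\<bar>h (x' + s *\<^sub>R y) + h (x' - s *\<^sub>R y) - 2 * h x'\<bar> \<le> 2 * ?d\<^sup>2 * U * (norm (s *\<^sub>R y))\<^sup>2"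
        by (rule second_difference)
      also have "(norm (s *\<^sub>R y))\<^sup>2 \<le> s\<^sup>2"
        using True s by (intro power_mono) (auto intro: mult_right_le_one_le)
      finally have "\<bar>h (x' + s *\<^sub>R y) + h (x' - s *\<^sub>R y) - 2 * h x'\<bar> \<le> 2 * ?d\<^sup>2 * U * s\<^sup>2"
        using U_nonneg by (simp add: mult_left_mono)
      thus ?thesis unfolding real_norm_def abs_mult using B by (intro mult_mono \<phi>(2)) auto
    qed (use \<phi>(4) B U_nonneg in auto)
  qed auto
  finally have A1: "\<bar>integral unit_box (?F (- s)) - integral unit_box \<phi> * h x'\<bar> \<le> B * ?V * (?d\<^sup>2 * U * s\<^sup>2)"
    by (simp add: mult_ac abs_mult)
  have "\<bar>integral unit_box \<phi>\<bar> \<le> integral unit_box (\<lambda>y::real^'n. B)"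
    unfolding real_norm_def[symmetric]
    by (rule integral_norm_bound_integral[OF \<phi>i]) (use \<phi>(2) in auto)
  hence "\<bar>integral unit_box \<phi>\<bar> \<le> B * ?V" by (simp add: mult.commute)
  moreover have "\<bar>h x' - h x\<bar> \<le> ?d * U * (s\<^sup>2 * norm m)"
    using Lipschitz[OF h1 bnd(2), of x' x] by (simp add: x'_def)
  ultimately have "\<bar>integral unit_box \<phi> * (h x' - h x)\<bar> \<le> B * ?V * (?d * U * (s\<^sup>2 * norm m))"
    unfolding abs_mult using B by (intro mult_mono) auto
  with A1 have "\<bar>integral unit_box (?F (- s)) - integral unit_box \<phi> * h x\<bar>
     \<le> B * ?V * (?d\<^sup>2 * U * s\<^sup>2) + B * ?V * (?d * U * (s\<^sup>2 * norm m))"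
    by (simp add: right_diff_distrib abs_le_iff)
  thus ?thesis unfolding m1 by (simp add: algebra_simps)
qed

end

section \<open>Correlation with mollifications\<close>

context compact_C2
begin

abbreviation correlation :: "(real^'n \<Rightarrow> real) \<Rightarrow> real^'n \<Rightarrow> real^'n \<Rightarrow> real^'n \<Rightarrow> real \<Rightarrow> real" where
  "correlation \<phi> m a b s \<equiv> integral (cbox a b) (\<lambda>x. h x * mollify \<phi> s (s\<^sup>2 *\<^sub>R m) h x)"

text \<open>
  If \<open>x - s y - s\<^sup>2 m\<close> is differentiated with respect to \<open>s\<close>, the result is \<open>- (y + 2 s m)\<close>. The derivative of the
  correlation is therefore minus the divergence of the mollifications of \<open>h\<close> with these kernels, tested with \<open>h\<close>.
\<close>
abbreviation flux_kernel :: "(real^'n \<Rightarrow> real) \<Rightarrow> real^'n \<Rightarrow> real \<Rightarrow> 'n \<Rightarrow> real^'n \<Rightarrow> real" where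
  "flux_kernel \<phi> m s i \<equiv> \<lambda>y. \<phi> y * (y $ i + 2 * s * m $ i)"

lemma correlation_derivative:
  assumes \<phi>: "continuous_on UNIV \<phi>"
  shows "(correlation \<phi> m a b has_real_derivative
     - (\<Sum>i\<in>UNIV. integral (cbox a b) (\<lambda>x. h x * mollify (flux_kernel \<phi> m s i) s (s\<^sup>2 *\<^sub>R m) (p1 i) x))) (at s)"
proof -
  let ?z = "\<lambda>s x y. x - s *\<^sub>R y - s\<^sup>2 *\<^sub>R m"
  let ?q = "\<lambda>s x y. \<phi> y * (\<Sum>i\<in>UNIV. p1 i (?z s x y) * (- (y + (2 * s) *\<^sub>R m)) $ i)"
  let ?I = "\<lambda>s x. integral unit_box (?q s x)"
  have zd: "((\<lambda>s. ?z s x y) has_vector_derivative - (y + (2 * s) *\<^sub>R m)) (at s)" for s x y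
    unfolding has_vector_derivative_def by (auto intro!: derivative_eq_intros simp: algebra_simps)
  have inner: "((\<lambda>s. mollify \<phi> s (s\<^sup>2 *\<^sub>R m) h x) has_real_derivative ?I s x) (at s within UNIV)" for s x
    unfolding mollify_def
  proof (rule leibniz_rule_field_derivative[where fx="\<lambda>s y. ?q s x y"])
    show "((\<lambda>s. \<phi> y * h (?z s x y)) has_field_derivative ?q s x y) (at s within UNIV)" for s y
      using DERIV_cmult[OF curve_derivative[OF zd h1]] by simp
    show "(\<lambda>y. \<phi> y * h (?z s x y)) integrable_on unit_box" for s
      by (intro integrable_continuous continuous_intros continuous_on_compose2[OF \<phi>]
          continuous_on_compose2[OF cont0]) auto
    show "continuous_on (UNIV \<times> unit_box) (\<lambda>(s, y). ?q s x y)"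
      unfolding split_def
      by (intro continuous_intros continuous_on_compose2[OF \<phi>] continuous_on_compose2[OF cont1]) auto
  qed auto
  have mc: "continuous_on A (mollify \<phi> s (s\<^sup>2 *\<^sub>R m) h)" for s A
    by (rule continuous_on_subset[OF mollify_continuous[OF \<phi> cont0]]) auto
  have outer: "(correlation \<phi> m a b has_real_derivative integral (cbox a b) (\<lambda>x. h x * ?I s x)) (at s within UNIV)"
  proof (rule leibniz_rule_field_derivative[where fx="\<lambda>s x. h x * ?I s x"])
    show "((\<lambda>s. h x * mollify \<phi> s (s\<^sup>2 *\<^sub>R m) h x) has_field_derivative h x * ?I s x) (at s within UNIV)" for s x
      by (intro DERIV_cmult inner)
    show "(\<lambda>x. h x * mollify \<phi> s (s\<^sup>2 *\<^sub>R m) h x) integrable_on cbox a b" for s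
      by (intro integrable_continuous continuous_intros mc continuous_on_subset[OF cont0]) auto
    have "continuous_on ((UNIV \<times> cbox a b) \<times> unit_box) (\<lambda>(p, y). ?q (fst p) (snd p) y)"
      unfolding split_def
      by (intro continuous_intros continuous_on_compose2[OF \<phi>] continuous_on_compose2[OF cont1]) auto
    from integral_continuous_on_param[OF this]
    have "continuous_on (UNIV \<times> cbox a b) (\<lambda>p. ?I (fst p) (snd p))" .
    thus "continuous_on (UNIV \<times> cbox a b) (\<lambda>(s, x). h x * ?I s x)"
      unfolding split_def by (intro continuous_intros continuous_on_compose2[OF cont0]) auto
  qed auto
  have Ieq: "?I s x = - (\<Sum>i\<in>UNIV. mollify (flux_kernel \<phi> m s i) s (s\<^sup>2 *\<^sub>R m) (p1 i) x)" for x
  proof -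
    have "?I s x = integral unit_box (\<lambda>y. - (\<Sum>i\<in>UNIV. flux_kernel \<phi> m s i y * p1 i (?z s x y)))"
      unfolding sum_negf[symmetric] sum_distrib_left by (intro integral_cong sum.cong) (simp_all add: algebra_simps)
    also have "\<dots> = - (\<Sum>i\<in>UNIV. integral unit_box (\<lambda>y. flux_kernel \<phi> m s i y * p1 i (?z s x y)))"
      by (subst integral_neg, subst integral_sum)
         (auto intro!: integrable_continuous continuous_intros continuous_on_compose2[OF \<phi>] continuous_on_compose2[OF cont1])
    finally show ?thesis by (simp add: mollify_def)
  qed
  have "integral (cbox a b) (\<lambda>x. h x * ?I s x)
      = integral (cbox a b) (\<lambda>x. - (\<Sum>i\<in>UNIV. h x * mollify (flux_kernel \<phi> m s i) s (s\<^sup>2 *\<^sub>R m) (p1 i) x))"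
    unfolding Ieq by (simp add: sum_distrib_left)
  also have "\<dots> = - (\<Sum>i\<in>UNIV. integral (cbox a b) (\<lambda>x. h x * mollify (flux_kernel \<phi> m s i) s (s\<^sup>2 *\<^sub>R m) (p1 i) x))"
    by (subst integral_neg, subst integral_sum)
       (auto intro!: integrable_continuous continuous_intros \<phi> cont1 continuous_on_subset[OF cont0]
          continuous_on_subset[OF mollify_continuous])
  finally show ?thesis using outer by simp
qed

text \<open>
  At \<open>s = 1\<close> the shift \<open>m\<close> is so long that no \<open>x\<close> and \<open>x - y - m\<close> with \<open>y\<close> in the unit ball are both in the support of \<open>h\<close>.
\<close>
lemma correlation_far:
  assumes \<phi>: "\<And>y. y \<notin> cball 0 1 \<Longrightarrow> \<phi> y = 0" and R: "K \<subseteq> ball 0 R" and m: "norm m \<ge> 2 * R + 1"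
  shows "correlation \<phi> m a b 1 = 0"
proof -
  have z: "h x * mollify \<phi> 1 (1\<^sup>2 *\<^sub>R m) h x = 0" for x
  proof (cases "x \<in> K")
    case True
    have q: "\<phi> y * h (x - 1 *\<^sub>R y - 1\<^sup>2 *\<^sub>R m) = 0" for y
    proof (cases "y \<in> cball 0 1")
      case y: True
      have "norm (x - y - m) \<ge> norm m - norm (x - y)" by (metis norm_minus_commute norm_triangle_ineq2)
      moreover have "norm (x - y) \<le> norm x + norm y" by (rule norm_triangle_ineq4)
      moreover have "norm x < R" "norm y \<le> 1" using True R y by auto
      ultimately have "norm (x - y - m) > R - 1 + 1" using m by linarith
      hence "x - y - m \<notin> K" using R by auto
      thus ?thesis using K(2) by simp
    qed (use \<phi> in simp)
    show ?thesis unfolding mollify_def q by simp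
  qed (simp add: K(2))
  show ?thesis unfolding z by simp
qed

text \<open>
  Integration of the derivative from \<open>r\<close> to \<open>1\<close>, in the form of the monotonicity of the correlation minus \<open>A / s\<close> and plus \<open>A / s\<close>.
\<close>
lemma correlation_bound:
  assumes \<phi>: "continuous_on UNIV \<phi>" and A: "0 \<le> A"
    and flux: "\<And>s. 0 < s \<Longrightarrow> s \<le> 1 \<Longrightarrow>
       \<bar>\<Sum>i\<in>UNIV. integral (cbox a b) (\<lambda>x. h x * mollify (flux_kernel \<phi> m s i) s (s\<^sup>2 *\<^sub>R m) (p1 i) x)\<bar> \<le> A / s\<^sup>2"
    and far: "correlation \<phi> m a b 1 = 0" and r: "0 < r" "r \<le> 1"
  shows "\<bar>correlation \<phi> m a b r\<bar> \<le> A / r"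
proof -
  let ?G = "correlation \<phi> m a b"
  let ?g = "\<lambda>s. - (\<Sum>i\<in>UNIV. integral (cbox a b) (\<lambda>x. h x * mollify (flux_kernel \<phi> m s i) s (s\<^sup>2 *\<^sub>R m) (p1 i) x))"
  have dA: "((\<lambda>s. A / s) has_real_derivative - (A / s\<^sup>2)) (at s)" if "s > 0" for s
    using that by (auto intro!: derivative_eq_intros simp: power2_eq_square)
  have "?G r - A / r \<le> ?G 1 - A / 1"
  proof (rule DERIV_nonneg_imp_nondecreasing[OF r(2)])
    fix s assume s: "r \<le> s" "s \<le> 1"
    hence "((\<lambda>s. ?G s - A / s) has_real_derivative ?g s - (- (A / s\<^sup>2))) (at s)"
      using r by (intro DERIV_diff correlation_derivative \<phi> dA) auto
    moreover have "0 \<le> ?g s - (- (A / s\<^sup>2))" using flux[of s] s r by (simp add: abs_le_iff)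
    ultimately show "\<exists>y. ((\<lambda>s. ?G s - A / s) has_real_derivative y) (at s) \<and> 0 \<le> y" by blast
  qed
  moreover have "?G r + A / r \<ge> ?G 1 + A / 1"
  proof (rule DERIV_nonpos_imp_nonincreasing[OF r(2)])
    fix s assume s: "r \<le> s" "s \<le> 1"
    hence "((\<lambda>s. ?G s + A / s) has_real_derivative ?g s + (- (A / s\<^sup>2))) (at s)"
      using r by (intro DERIV_add correlation_derivative \<phi> dA) auto
    moreover have "?g s + (- (A / s\<^sup>2)) \<le> 0" using flux[of s] s r by (simp add: abs_le_iff)
    ultimately show "\<exists>y. ((\<lambda>s. ?G s + A / s) has_real_derivative y) (at s) \<and> y \<le> 0" by blast
  qed
  ultimately show ?thesis using far A by (simp add: abs_le_iff)
qed

lemma mollify_pure_C2: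
  assumes "continuous_on UNIV k"
  shows "pure_C2 (mollify k s m h) (\<lambda>j. mollify k s m (p1 j)) (\<lambda>j. mollify k s m (p2 j j))"
  using assms by (auto simp: pure_C2_def
      intro!: mollify_continuous mollify_partial cont0 cont1 cont2 partial1 partial2)

lemma mollify_L2_bounds:
  assumes k: "pure_C2 k k1 k2" "\<And>y. y \<notin> cball 0 1 \<Longrightarrow> k y = 0"
    and B: "\<And>y. y \<in> unit_box \<Longrightarrow> \<bar>k y\<bar> \<le> B" "\<And>j y. y \<in> unit_box \<Longrightarrow> \<bar>k1 j y\<bar> \<le> B"
       "\<And>j y. y \<in> unit_box \<Longrightarrow> \<bar>k2 j y\<bar> \<le> B"
    and s: "0 < s" "s \<le> 1"
  defines "M \<equiv> (B * measure lborel (unit_box :: (real^'n) set) / s\<^sup>2)\<^sup>2 * integral UNIV (\<lambda>x. (h x)\<^sup>2)"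
  shows "integral (cbox a b) (\<lambda>x. (mollify k s m h x)\<^sup>2) \<le> M"
    "integral (cbox a b) (\<lambda>x. (mollify k s m (p1 j) x)\<^sup>2) \<le> M"
    "integral (cbox a b) (\<lambda>x. (mollify k s m (p2 j j) x)\<^sup>2) \<le> M"
proof -
  note kD = pure_C2D[OF k(1)]
  let ?V = "measure lborel (unit_box :: (real^'n) set)" and ?N = "integral UNIV (\<lambda>x. (h x)\<^sup>2)"
  have N: "?N \<ge> 0"
    by (intro integral_nonneg integrable_compact_support[OF _ K(1)] continuous_intros cont0) (auto simp: K(2))
  have k1z: "k1 j y = 0" if "y \<notin> cball 0 1" for j y
    by (rule integral_partial_UNIV(2)[OF kD(4) kD(1,2) compact_cball k(2) that])
  have e1: "mollify k s m (p1 j) x = (1 / s) * mollify (k1 j) s m h x" for x j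
    using mollify_by_parts[where i=j and s=s and m=m and x=x, OF kD(1) kD(2) kD(4) k(2) cont0 cont1 partial1] s
    by (simp add: field_simps)
  have e2: "mollify k s m (p2 j j) x = (1 / s\<^sup>2) * mollify (k2 j) s m h x" for x
    using mollify_by_parts[where i=j and s=s and m=m and x=x, OF kD(1) kD(2) kD(4) k(2) cont1 cont2 partial2]
      mollify_by_parts[where i=j and s=s and m=m and x=x, OF kD(2) kD(3) kD(5) k1z cont0 cont1 partial1] s
    by (simp add: field_simps power2_eq_square)
  have gen: "integral (cbox a b) (\<lambda>x. (c * mollify q s m h x)\<^sup>2) \<le> M"
    if "continuous_on UNIV q" "\<And>y. y \<in> unit_box \<Longrightarrow> \<bar>q y\<bar> \<le> B" "0 \<le> c" "c \<le> 1 / s\<^sup>2" for c q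
  proof -
    have "integral (cbox a b) (\<lambda>x. (c * mollify q s m h x)\<^sup>2) = c\<^sup>2 * integral (cbox a b) (\<lambda>x. (mollify q s m h x)\<^sup>2)"
      by (simp add: power_mult_distrib)
    also have "\<dots> \<le> c\<^sup>2 * ((B * ?V)\<^sup>2 * ?N)"
      by (intro mult_left_mono mollify_Young[OF that(1,2) cont0 K]) auto
    also have "\<dots> \<le> (1 / s\<^sup>2)\<^sup>2 * ((B * ?V)\<^sup>2 * ?N)"
      using that N by (intro mult_right_mono power_mono mult_nonneg_nonneg) auto
    also have "\<dots> = M" unfolding M_def by (simp add: power_divide power_mult_distrib)
    finally show ?thesis .
  qed
  have s2: "1 \<le> 1 / s\<^sup>2" "1 / s \<le> 1 / s\<^sup>2"
    using s power_le_one[of s 2] by (auto simp: field_simps power2_eq_square)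
  show "integral (cbox a b) (\<lambda>x. (mollify k s m h x)\<^sup>2) \<le> M"
    using gen[OF kD(1) B(1), of 1] s2 by simp
  show "integral (cbox a b) (\<lambda>x. (mollify k s m (p1 j) x)\<^sup>2) \<le> M"
    unfolding e1 by (rule gen[OF kD(2) B(2)]) (use s s2 in auto)
  show "integral (cbox a b) (\<lambda>x. (mollify k s m (p2 j j) x)\<^sup>2) \<le> M"
    unfolding e2 by (rule gen[OF kD(3) B(3)]) (use s s2 in auto)
qed

text \<open>
  The square of the norm of \<open>h\<close>, times the integral of \<open>\<phi>\<close>, is the correlation plus the integral of \<open>h\<close> against its
  mollification error; then one factor of the norm is cancelled.
\<close>
lemma norm_bound_from_correlation:
  assumes \<phi>: "continuous_on UNIV \<phi>" "\<And>y. \<bar>\<phi> y\<bar> \<le> B" "\<And>y. \<phi> (- y) = \<phi> y" "\<And>y. y \<notin> cball 0 1 \<Longrightarrow> \<phi> y = 0"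
    and c0: "0 < integral unit_box \<phi>" and r: "0 < r" and Kab: "K \<subseteq> cbox a b"
    and corr: "\<bar>correlation \<phi> m a b r\<bar> \<le> A * sqrt (integral UNIV (\<lambda>x. (h x)\<^sup>2)) / r" and A: "0 \<le> A"
  defines "A0 \<equiv> B * measure lborel (unit_box :: (real^'n) set) * ((real CARD('n))\<^sup>2 * U + real CARD('n) * U * norm m)"
  shows "integral unit_box \<phi> * sqrt (integral UNIV (\<lambda>x. (h x)\<^sup>2)) \<le> A0 * sqrt (measure lborel (cbox a b)) * r\<^sup>2 + A / r"
proof -
  let ?c = "integral unit_box \<phi>"
  let ?N2 = "integral UNIV (\<lambda>x. (h x)\<^sup>2)"
  let ?V = "measure lborel (cbox a b)"
  let ?M = "mollify \<phi> r (r\<^sup>2 *\<^sub>R m) h"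
  have B: "0 \<le> B" using \<phi>(2)[of 0] by linarith
  have A0: "0 \<le> A0" unfolding A0_def using B U_nonneg by (intro mult_nonneg_nonneg add_nonneg_nonneg measure_nonneg) auto
  have N2: "?N2 \<ge> 0"
    by (intro integral_nonneg integrable_compact_support[OF _ K(1)] continuous_intros cont0) (auto simp: K(2))
  have hc: "continuous_on (cbox a b) h" by (rule continuous_on_subset[OF cont0]) auto
  have Mc: "continuous_on (cbox a b) ?M" by (rule continuous_on_subset[OF mollify_continuous[OF \<phi>(1) cont0]]) auto
  have N2eq: "?N2 = integral (cbox a b) (\<lambda>x. (h x)\<^sup>2)"
    using Kab K(2) by (intro integral_support) auto
  have habs: "integral (cbox a b) (\<lambda>x. \<bar>h x\<bar>) \<le> sqrt ?V * sqrt ?N2"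
  proof -
    have "(integral (cbox a b) (\<lambda>x. 1 * \<bar>h x\<bar>))\<^sup>2 \<le> integral (cbox a b) (\<lambda>x::real^'n. 1\<^sup>2) * integral (cbox a b) (\<lambda>x. \<bar>h x\<bar>\<^sup>2)"
      by (intro integral_Cauchy_Schwarz continuous_intros hc)
    hence "(integral (cbox a b) (\<lambda>x. \<bar>h x\<bar>))\<^sup>2 \<le> ?V * ?N2" by (simp add: N2eq)
    hence "integral (cbox a b) (\<lambda>x. \<bar>h x\<bar>) \<le> sqrt (?V * ?N2)" by (rule real_le_rsqrt)
    thus ?thesis by (simp add: real_sqrt_mult)
  qed
  have "?c * ?N2 = integral (cbox a b) (\<lambda>x. h x * (?c * h x - ?M x)) + correlation \<phi> m a b r"
  proof -
    have "integral (cbox a b) (\<lambda>x. h x * (?c * h x - ?M x)) + correlation \<phi> m a b r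
       = integral (cbox a b) (\<lambda>x. h x * (?c * h x - ?M x) + h x * ?M x)"
      by (intro integral_add[symmetric] integrable_continuous continuous_intros hc Mc)
    also have "\<dots> = integral (cbox a b) (\<lambda>x. ?c * (h x)\<^sup>2)"
      by (intro integral_cong) (simp add: algebra_simps power2_eq_square)
    finally show ?thesis by (simp add: N2eq)
  qed
  also have "integral (cbox a b) (\<lambda>x. h x * (?c * h x - ?M x)) \<le> integral (cbox a b) (\<lambda>x. A0 * r\<^sup>2 * \<bar>h x\<bar>)"
  proof (intro integral_le integrable_continuous continuous_intros hc Mc)
    fix x
    have "h x * (?c * h x - ?M x) \<le> \<bar>h x\<bar> * \<bar>?M x - ?c * h x\<bar>"
      by (metis abs_ge_self abs_minus_commute abs_mult)
    also have "\<dots> \<le> \<bar>h x\<bar> * (A0 * r\<^sup>2)"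
      using mollify_approximates[OF \<phi>, of r m x] r unfolding A0_def by (intro mult_left_mono) auto
    finally show "h x * (?c * h x - ?M x) \<le> A0 * r\<^sup>2 * \<bar>h x\<bar>" by (simp add: mult_ac)
  qed
  also have "integral (cbox a b) (\<lambda>x. A0 * r\<^sup>2 * \<bar>h x\<bar>) = A0 * r\<^sup>2 * integral (cbox a b) (\<lambda>x. \<bar>h x\<bar>)" by simp
  also have "\<dots> \<le> A0 * r\<^sup>2 * (sqrt ?V * sqrt ?N2)" using A0 by (intro mult_left_mono habs) auto
  finally have "?c * ?N2 \<le> A0 * r\<^sup>2 * (sqrt ?V * sqrt ?N2) + A * sqrt ?N2 / r" using corr by linarith
  also have "\<dots> = sqrt ?N2 * (A0 * sqrt ?V * r\<^sup>2 + A / r)" by (simp add: algebra_simps)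
  also have "?c * ?N2 = sqrt ?N2 * (?c * sqrt ?N2)" using N2 by (simp add: mult.left_commute)
  finally have *: "sqrt ?N2 * (?c * sqrt ?N2) \<le> sqrt ?N2 * (A0 * sqrt ?V * r\<^sup>2 + A / r)" .
  show ?thesis
  proof (cases "sqrt ?N2 = 0")
    case True
    have "0 \<le> A0 * sqrt ?V * r\<^sup>2 + A / r" using A0 A r by simp
    thus ?thesis using True by simp
  next
    case False
    hence "sqrt ?N2 > 0" using N2 by simp
    thus ?thesis using * by (simp only: mult_le_cancel_left_pos)
  qed
qed

end

section \<open>The energy form of the difference of two coefficients\<close>

definition div_grad ::
  "(real^'n::finite \<Rightarrow> real) \<Rightarrow> ('n \<Rightarrow> real^'n \<Rightarrow> real) \<Rightarrow> ('n \<Rightarrow> real^'n \<Rightarrow> real) \<Rightarrow> real^'n \<Rightarrow> real" where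
  "div_grad f v1 v2 x = (\<Sum>i\<in>UNIV. partial i f x * v1 i x + f x * v2 i x)"

lemma C2_has_partial:
  assumes "f \<in> C2 S" "open S" "x \<in> S"
  shows "has_partial f i (partial i f x) x" "has_partial (partial i f) j (partial j (partial i f) x) x"
proof -
  have d: "iter_partial is f differentiable_on S" if "length is \<le> 1" for "is"
    using assms(1) that by (auto simp: C2_def)
  show "has_partial f i (partial i f x) x"
    using d[of "[]"] assms by (intro differentiable_has_partial) auto
  show "has_partial (partial i f) j (partial j (partial i f) x) x"
    using d[of "[i]"] assms by (intro differentiable_has_partial) auto
qed

lemma C2_continuous_partials:
  assumes "f \<in> C2 S"
  shows "continuous_on S f" "continuous_on S (partial i f)" "continuous_on S (partial j (partial i f))"
  using C2_continuous[OF assms, of "[]"] C2_continuous[OF assms, of "[i]"] C2_continuous[OF assms, of "[j, i]"]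
  by auto

lemma integrable_support_on:
  fixes G :: "real^'n::finite \<Rightarrow> real"
  assumes "open S" "compact K" "K \<subseteq> S" "continuous_on S G" "\<And>x. x \<in> S - K \<Longrightarrow> G x = 0"
  shows "G integrable_on S"
proof -
  have "(\<lambda>x. if x \<in> S then G x else 0) integrable_on UNIV"
    by (rule integrable_compact_support[OF continuous_zero_extension[OF assms] assms(2)]) (use assms in auto)
  thus ?thesis by (simp add: integrable_restrict_UNIV)
qed

lemma L2_support:
  fixes G :: "real^'n::finite \<Rightarrow> real"
  assumes "open S" "bounded S" "compact K" "K \<subseteq> S" "continuous_on S G" "\<And>x. x \<in> S - K \<Longrightarrow> G x = 0"
  shows "G \<in> L2 S"
proof (rule bounded_continuous_L2)
  have "compact (G ` K)" using assms by (intro compact_continuous_image) (auto intro: continuous_on_subset)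
  hence "bounded (insert 0 (G ` K))" by (simp add: compact_imp_bounded)
  thus "bounded (G ` S)" by (rule bounded_subset) (use assms(6) in auto)
qed (use assms in \<open>auto intro: lmeasurable_open\<close>)

lemma L2_inner_eq_integral:
  assumes "S \<in> sets lebesgue" "\<phi> \<in> L2 S" "\<psi> \<in> L2 S"
  shows "L2_inner S \<phi> \<psi> = integral S (\<lambda>x. \<phi> x * \<psi> x)"
  unfolding L2_inner_def by (intro lebesgue_integral_eq_integral L2_integrable_mult assms)

text \<open>
  Test functions have compact support in \<open>S\<close>, so that no boundary terms arise. The derivatives of \<open>v\<close> are carried along
  as parameters, because they are known explicitly in each use.
\<close>
locale test_function =
  fixes S K :: "(real^'n::finite) set" and v v1 v2
  assumes S: "open S" "bounded S" and K: "compact K" "K \<subseteq> S"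
    and v: "pure_C2 v v1 v2" and v_out: "x \<notin> K \<Longrightarrow> v x = 0"
begin

lemma cont: "continuous_on A v" "continuous_on A (v1 i)" "continuous_on A (v2 i)"
  using pure_C2D(1-3)[OF v] by (auto intro: continuous_on_subset)

lemma v1_out: "x \<notin> K \<Longrightarrow> v1 i x = 0"
  by (rule integral_partial_UNIV(2)[OF pure_C2D(4)[OF v] cont(1,2) K(1) v_out])

lemma v2_out: "x \<notin> K \<Longrightarrow> v2 i x = 0"
  by (rule integral_partial_UNIV(2)[OF pure_C2D(5)[OF v] cont(2,3) K(1) v1_out])

lemma v_L2: "v \<in> L2 S"
  using v_out by (intro L2_support[OF S K] cont) auto

lemma div_grad_continuous: "f \<in> C2 S \<Longrightarrow> continuous_on S (div_grad f v1 v2)"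
  unfolding div_grad_def by (intro continuous_intros cont C2_continuous_partials)

lemma div_grad_L2: "f \<in> C2 S \<Longrightarrow> div_grad f v1 v2 \<in> L2 S"
  using v1_out v2_out
  by (intro L2_support[OF S K] div_grad_continuous) (auto simp: div_grad_def)

lemma Green_div_grad:
  assumes f: "f \<in> C2 S"
    and w: "continuous_on S w" "\<And>i. continuous_on S (w1 i)" "\<And>i x. x \<in> S \<Longrightarrow> has_partial w i (w1 i x) x"
  shows "integral S (\<lambda>x. w x * div_grad f v1 v2 x) = - integral S (\<lambda>x. f x * (\<Sum>i\<in>UNIV. w1 i x * v1 i x))"
proof -
  note fc = C2_continuous_partials[OF f] and fp = C2_has_partial[OF f S(1)]
  let ?F' = "\<lambda>i x. w1 i x * (f x * v1 i x) + w x * (partial i f x * v1 i x + f x * v2 i x)"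
  have F'c: "continuous_on S (?F' i)" for i by (intro continuous_intros cont fc w)
  have F'i: "?F' i integrable_on S" for i
    using v1_out v2_out by (intro integrable_support_on[OF S(1) K] F'c) auto
  have "integral S (?F' i) = 0" for i
  proof (rule integral_partial_eq_0[OF S(1) K, where F="\<lambda>x. w x * (f x * v1 i x)"])
    show "has_partial (\<lambda>x. w x * (f x * v1 i x)) i (?F' i x) x" if "x \<in> S" for x
      by (intro has_partial_mult w fp pure_C2D(5)[OF v] that)
  qed (use v1_out in \<open>auto intro!: continuous_intros cont fc w F'c\<close>)
  hence "0 = integral S (\<lambda>x. \<Sum>i\<in>UNIV. ?F' i x)"
    by (subst integral_sum) (auto intro: F'i)
  also have "\<dots> = integral S (\<lambda>x. w x * div_grad f v1 v2 x + f x * (\<Sum>i\<in>UNIV. w1 i x * v1 i x))"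
    by (intro integral_cong) (simp add: div_grad_def sum.distrib sum_distrib_left algebra_simps)
  also have "\<dots> = integral S (\<lambda>x. w x * div_grad f v1 v2 x) + integral S (\<lambda>x. f x * (\<Sum>i\<in>UNIV. w1 i x * v1 i x))"
    using v1_out v2_out
    by (intro integral_add integrable_support_on[OF S(1) K] continuous_intros div_grad_continuous f w cont fc)
      (auto simp: div_grad_def)
  finally show ?thesis by simp
qed

lemma Green_div_form:
  assumes f: "f \<in> C2 S" and e: "e \<in> C2 S"
  shows "integral S (\<lambda>x. div_form_op f e x * v x) = - integral S (\<lambda>x. f x * (\<Sum>i\<in>UNIV. partial i e x * v1 i x))"
proof -
  note fc = C2_continuous_partials[OF f] and fp = C2_has_partial[OF f S(1)]
  note ec = C2_continuous_partials[OF e] and ep = C2_has_partial[OF e S(1)]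
  let ?q = "\<lambda>i x. partial i f x * partial i e x + f x * partial i (partial i e) x"
  let ?F' = "\<lambda>i x. ?q i x * v x + (f x * partial i e x) * v1 i x"
  have F'c: "continuous_on S (?F' i)" for i by (intro continuous_intros cont fc ec)
  have F'i: "?F' i integrable_on S" for i
    using v1_out v_out by (intro integrable_support_on[OF S(1) K] F'c) auto
  have q: "partial i (\<lambda>y. f y * partial i e y) x = ?q i x" if x: "x \<in> S" for i x
  proof (rule has_partial_unique)
    show "has_partial (\<lambda>y. f y * partial i e y) i (?q i x) x"
      by (intro has_partial_mult fp ep x)
    have "iter_partial [] f differentiable_on S" "iter_partial [i] e differentiable_on S"
      using f e by (auto simp: C2_def simp del: iter_partial.simps)
    hence "(\<lambda>y. f y * partial i e y) differentiable_on S"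
      by (auto simp: differentiable_on_def intro: differentiable_mult)
    thus "has_partial (\<lambda>y. f y * partial i e y) i (partial i (\<lambda>y. f y * partial i e y) x) x"
      by (rule differentiable_has_partial[OF _ S(1) x])
  qed
  have "integral S (?F' i) = 0" for i
  proof (rule integral_partial_eq_0[OF S(1) K, where F="\<lambda>x. (f x * partial i e x) * v x"])
    show "has_partial (\<lambda>x. (f x * partial i e x) * v x) i (?F' i x) x" if "x \<in> S" for x
      by (intro has_partial_mult fp ep pure_C2D(4)[OF v] that)
  qed (use v_out in \<open>auto intro!: continuous_intros cont fc ec F'c\<close>)
  hence "0 = integral S (\<lambda>x. \<Sum>i\<in>UNIV. ?F' i x)"
    by (subst integral_sum) (auto intro: F'i)
  also have "\<dots> = integral S (\<lambda>x. (\<Sum>i\<in>UNIV. ?q i x) * v x + f x * (\<Sum>i\<in>UNIV. partial i e x * v1 i x))"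
    by (intro integral_cong) (simp only: sum.distrib[symmetric] sum_distrib_left sum_distrib_right mult.assoc)
  also have "\<dots> = integral S (\<lambda>x. (\<Sum>i\<in>UNIV. ?q i x) * v x) + integral S (\<lambda>x. f x * (\<Sum>i\<in>UNIV. partial i e x * v1 i x))"
    using v1_out v_out
    by (intro integral_add integrable_support_on[OF S(1) K] continuous_intros cont fc ec) auto
  also have "integral S (\<lambda>x. (\<Sum>i\<in>UNIV. ?q i x) * v x) = integral S (\<lambda>x. div_form_op f e x * v x)"
    by (intro integral_cong) (simp add: div_form_op_def q)
  finally show ?thesis by simp
qed

text \<open>
  Two integrations by parts move the operator from the test function to the eigenfunction. Being compactly supported,
  \<open>v\<close> is thus in the domain of the operator, and the resolvent at \<open>c\<close> maps \<open>c * v - \<nabla>\<cdot>(f\<nabla>v)\<close> back to \<open>v\<close>.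
\<close>
lemma coefficient_shifted_operator:
  assumes f: "f \<in> C2 S" and sys: "neumann_eigensystem S f e lam"
  shows "L2_inner S (e j) (\<lambda>x. c * v x - div_grad f v1 v2 x) = (c + lam j) * L2_inner S (e j) v"
proof -
  have ej: "e j \<in> C2 S" and eq: "\<And>x. x \<in> S \<Longrightarrow> div_form_op f (e j) x = - lam j * e j x"
    using sys by (auto simp: neumann_eigensystem_def)
  have m: "S \<in> sets lebesgue" using S(1) by (simp add: borel_open)
  have eL: "e j \<in> L2 S" by (rule C2_L2[OF ej S])
  have "L2_inner S (e j) (div_grad f v1 v2) = integral S (\<lambda>x. e j x * div_grad f v1 v2 x)"
    by (rule L2_inner_eq_integral[OF m eL div_grad_L2[OF f]])
  also have "\<dots> = integral S (\<lambda>x. div_form_op f (e j) x * v x)"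
    unfolding Green_div_form[OF f ej]
    by (rule Green_div_grad[OF f]) (intro C2_continuous_partials[OF ej] C2_has_partial[OF ej S(1)]; assumption)+
  also have "\<dots> = integral S (\<lambda>x. - lam j * (e j x * v x))"
    by (intro integral_cong) (simp add: eq)
  also have "\<dots> = - lam j * L2_inner S (e j) v"
    unfolding L2_inner_eq_integral[OF m eL v_L2] by (rule integral_mult_right)
  finally show ?thesis
    using L2_inner_diff_right[OF eL L2_scale[OF v_L2, of c] div_grad_L2[OF f]]
    by (simp add: L2_inner_scale_right algebra_simps)
qed

end

text \<open>
  In the matrix element of the difference of the resolvents, the terms \<open>2 / D * \<integral> u v\<close> cancel and the energies
  \<open>\<integral> f \<nabla>u\<cdot>\<nabla>v\<close> and \<open>\<integral> f\<^sub>0 \<nabla>u\<cdot>\<nabla>v\<close> remain. The number \<open>\<delta>\<close> need not be the norm of the difference of the semigroups: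
  if these coincide, it may be arbitrarily small.
\<close>
lemma energy_difference_bound:
  assumes f: "f \<in> C2 S" "f\<^sub>0 \<in> C2 S"
    and sys: "neumann_eigensystem S f e lam" and sys0: "neumann_eigensystem S f\<^sub>0 e\<^sub>0 lam\<^sub>0"
    and D: "D > 0" and \<delta>: "0 < \<delta>" "\<delta> < 1"
    and close: "\<And>\<phi>. \<phi> \<in> L2 S \<Longrightarrow>
        L2_norm S (\<lambda>x. semigroup_op S e lam D \<phi> x - semigroup_op S e\<^sub>0 lam\<^sub>0 D \<phi> x) \<le> \<delta> * L2_norm S \<phi>"
    and u: "test_function S K u u1 u2" and v: "test_function S K v v1 v2"
  shows "\<bar>integral S (\<lambda>x. (f x - f\<^sub>0 x) * (\<Sum>i\<in>UNIV. u1 i x * v1 i x))\<bar>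
     \<le> 4 * D / (2 + ln (1 / \<delta>)) * (L2_norm S (\<lambda>x. 2 / D * v x - div_grad f v1 v2 x)
          * L2_norm S (\<lambda>x. 2 / D * u x - div_grad f\<^sub>0 u1 u2 x))"
proof -
  interpret u: test_function S K u u1 u2 by (rule u)
  interpret v: test_function S K v v1 v2 by (rule v)
  note S = u.S
  have m: "S \<in> sets lebesgue" using S(1) by (simp add: borel_open)
  interpret A: L2_multiplier S e "semigroup_op S e lam D" "\<lambda>j. exp (- D * lam j)"
    by (rule semigroup_multiplier[OF sys S D])
  interpret B: L2_multiplier S e\<^sub>0 "semigroup_op S e\<^sub>0 lam\<^sub>0 D" "\<lambda>j. exp (- D * lam\<^sub>0 j)"
    by (rule semigroup_multiplier[OF sys0 S D])
  interpret close_multipliers S e "semigroup_op S e lam D" "\<lambda>j. exp (- D * lam j)"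
    e\<^sub>0 "semigroup_op S e\<^sub>0 lam\<^sub>0 D" "\<lambda>j. exp (- D * lam\<^sub>0 j)" \<delta>
    by unfold_locales (use close \<delta> in auto)
  let ?a = "\<lambda>x. 2 / D * v x - div_grad f v1 v2 x" and ?b = "\<lambda>x. 2 / D * u x - div_grad f\<^sub>0 u1 u2 x"
  have aL: "?a \<in> L2 S" by (intro L2_diff L2_scale v.v_L2 v.div_grad_L2 f)
  have bL: "?b \<in> L2 S" by (intro L2_diff L2_scale u.v_L2 u.div_grad_L2 f)
  have main: "\<bar>L2_inner S ?b v - L2_inner S ?a u\<bar> \<le> 4 * D / (2 + ln (1 / \<delta>)) * (L2_norm S ?a * L2_norm S ?b)"
    by (rule resolvent_stability[where lam=lam and lam'=lam\<^sub>0, OF aL v.v_L2 bL u.v_L2 D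
          eigensystem_lam_ge(2)[OF sys] refl v.coefficient_shifted_operator[OF f(1) sys]
          eigensystem_lam_ge(2)[OF sys0] refl u.coefficient_shifted_operator[OF f(2) sys0]])
  have c: "continuous_on S (\<lambda>x. g x * (\<Sum>i\<in>UNIV. u1 i x * v1 i x))" if "continuous_on S g" for g
    by (intro continuous_intros that u.cont v.cont)
  have gi: "(\<lambda>x. g x * (\<Sum>i\<in>UNIV. u1 i x * v1 i x)) integrable_on S" if "continuous_on S g" for g
    using u.v1_out by (intro integrable_support_on[OF S(1) u.K] c that) auto
  have "L2_inner S (div_grad f\<^sub>0 u1 u2) v = integral S (\<lambda>x. v x * div_grad f\<^sub>0 u1 u2 x)"
    using L2_inner_eq_integral[OF m v.v_L2 u.div_grad_L2[OF f(2)]] by (simp add: L2_inner_commute)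
  also have "\<dots> = - integral S (\<lambda>x. f\<^sub>0 x * (\<Sum>i\<in>UNIV. v1 i x * u1 i x))"
    by (rule u.Green_div_grad[OF f(2)]) (intro v.cont pure_C2D(4)[OF v.v])+
  finally have 1: "L2_inner S (div_grad f\<^sub>0 u1 u2) v = - integral S (\<lambda>x. f\<^sub>0 x * (\<Sum>i\<in>UNIV. u1 i x * v1 i x))"
    by (simp add: mult.commute)
  have "L2_inner S (div_grad f v1 v2) u = integral S (\<lambda>x. u x * div_grad f v1 v2 x)"
    using L2_inner_eq_integral[OF m u.v_L2 v.div_grad_L2[OF f(1)]] by (simp add: L2_inner_commute)
  also have "\<dots> = - integral S (\<lambda>x. f x * (\<Sum>i\<in>UNIV. u1 i x * v1 i x))"
    by (rule v.Green_div_grad[OF f(1)]) (intro u.cont pure_C2D(4)[OF u.v])+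
  finally have 2: "L2_inner S (div_grad f v1 v2) u = - integral S (\<lambda>x. f x * (\<Sum>i\<in>UNIV. u1 i x * v1 i x))" .
  have "L2_inner S ?b v = 2 / D * L2_inner S v u - L2_inner S (div_grad f\<^sub>0 u1 u2) v"
    using L2_inner_diff_right[OF v.v_L2 L2_scale[OF u.v_L2, of "2 / D"] u.div_grad_L2[OF f(2)]]
      L2_inner_scale_right[of S v "2 / D" u] by (simp add: L2_inner_commute)
  moreover have "L2_inner S ?a u = 2 / D * L2_inner S v u - L2_inner S (div_grad f v1 v2) u"
    using L2_inner_diff_right[OF u.v_L2 L2_scale[OF v.v_L2, of "2 / D"] v.div_grad_L2[OF f(1)]]
      L2_inner_scale_right[of S u "2 / D" v] by (simp add: L2_inner_commute)
  moreover have "integral S (\<lambda>x. (f x - f\<^sub>0 x) * (\<Sum>i\<in>UNIV. u1 i x * v1 i x))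
     = integral S (\<lambda>x. f x * (\<Sum>i\<in>UNIV. u1 i x * v1 i x)) - integral S (\<lambda>x. f\<^sub>0 x * (\<Sum>i\<in>UNIV. u1 i x * v1 i x))"
    unfolding left_diff_distrib
    by (intro integral_diff gi C2_continuous_partials f)
  ultimately have "L2_inner S ?b v - L2_inner S ?a u = - integral S (\<lambda>x. (f x - f\<^sub>0 x) * (\<Sum>i\<in>UNIV. u1 i x * v1 i x))"
    using 1 2 by simp
  thus ?thesis using main by simp
qed

section \<open>The quantitative estimate\<close>

lemma differentiable_has_derivative_partials:
  assumes "g differentiable_on S" "open S" "x \<in> S"
  shows "(g has_derivative (\<lambda>d. \<Sum>i\<in>UNIV. partial i g x * d $ i)) (at x)"
proof -
  let ?F = "frechet_derivative g (at x)"
  have "g differentiable (at x)"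
    using assms by (metis at_within_open differentiable_on_def)
  hence d: "(g has_derivative ?F) (at x)" by (simp only: frechet_derivative_works)
  have l: "linear ?F" by (rule has_derivative_linear[OF d])
  have "?F d = (\<Sum>i\<in>UNIV. partial i g x * d $ i)" for d
  proof -
    have "?F d = ?F (\<Sum>i\<in>UNIV. d $ i *\<^sub>R axis i 1)"
      using basis_expansion[of d] by (simp add: scalar_mult_eq_scaleR)
    also have "\<dots> = (\<Sum>i\<in>UNIV. partial i g x * d $ i)"
      by (simp add: linear_sum[OF l] linear_scale[OF l] partial_def mult.commute)
    finally show ?thesis .
  qed
  thus ?thesis using d by (metis (no_types, lifting) ext)
qed

lemma has_derivative_zero_extension:
  fixes g :: "real^'n::finite \<Rightarrow> real"
  assumes "open S" "compact K" "K \<subseteq> S" "\<And>x. x \<in> S - K \<Longrightarrow> g x = 0"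
    and g: "\<And>x. x \<in> S \<Longrightarrow> (g has_derivative (\<lambda>d. \<Sum>i\<in>UNIV. q i x * d $ i)) (at x)"
  shows "((\<lambda>x. if x \<in> S then g x else 0) has_derivative (\<lambda>d. \<Sum>i\<in>UNIV. (if x \<in> S then q i x else 0) * d $ i)) (at x)"
proof (cases "x \<in> S")
  case True
  thus ?thesis
    using has_derivative_transform_within_open[OF g[OF True] assms(1) True, of "\<lambda>x. if x \<in> S then g x else 0"] by simp
next
  case False
  have "((\<lambda>x. if x \<in> S then g x else 0) has_derivative (\<lambda>d. 0)) (at x)"
    by (rule has_derivative_transform_within_open[of "\<lambda>_. 0" _ _ _ "- K"])
      (use False assms(2-4) in \<open>auto simp: compact_imp_closed open_Compl\<close>)
  thus ?thesis using False by simp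
qed

lemma partial_eq_0:
  assumes "open V" "x \<in> V" "\<And>y. y \<in> V \<Longrightarrow> g y = c" "has_partial g i d x"
  shows "d = 0"
  by (rule has_partial_unique[OF assms(4) has_partial_cong[OF assms(1,2) _ has_partial_const[of c]]])
    (simp add: assms(3))

lemma C2_norm_bound:
  fixes f :: "real^'n::finite \<Rightarrow> real"
  assumes "f \<in> C2 S" "bounded S" "x \<in> S" "length is \<le> 2"
  shows "\<bar>iter_partial is f x\<bar> \<le> C2_norm S f"
proof -
  have "bounded (iter_partial is f ` S)" by (rule C2_bounded[OF assms(1,4,2)])
  then obtain B where "\<And>y. y \<in> S \<Longrightarrow> \<bar>iter_partial is f y\<bar> \<le> B" by (auto simp: bounded_iff)
  hence "bdd_above ((\<lambda>x. \<bar>iter_partial is f x\<bar>) ` S)" by (auto intro!: bdd_aboveI2)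
  hence "\<bar>iter_partial is f x\<bar> \<le> (SUP x\<in>S. \<bar>iter_partial is f x\<bar>)" using assms(3) by (rule cSUP_upper2) simp
  also have "\<dots> \<le> C2_norm S f"
    unfolding C2_norm_def
  proof (rule Max_ge)
    have "finite {is :: 'n list. set is \<subseteq> UNIV \<and> length is \<le> 2}" by (rule finite_lists_length_le) simp
    thus "finite ((\<lambda>is. SUP x\<in>S. \<bar>iter_partial is f x\<bar>) ` {is. length is \<le> 2})" by simp
  qed (use assms(4) in auto)
  finally show ?thesis .
qed

lemma difference_compact_C2:
  fixes f f\<^sub>0 :: "real^'n::finite \<Rightarrow> real"
  assumes S: "open S" "bounded S" "S \<noteq> {}" and S0: "compact S\<^sub>0" "S\<^sub>0 \<subseteq> S"
    and f: "f \<in> C2 S" "f\<^sub>0 \<in> C2 S" and eq: "\<forall>x\<in>S - S\<^sub>0. f x = f\<^sub>0 x"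
    and U: "C2_norm S f + C2_norm S f\<^sub>0 \<le> U"
  shows "compact_C2 (\<lambda>x. if x \<in> S then f x - f\<^sub>0 x else 0)
     (\<lambda>i x. if x \<in> S then partial i f x - partial i f\<^sub>0 x else 0)
     (\<lambda>i j x. if x \<in> S then partial j (partial i f) x - partial j (partial i f\<^sub>0) x else 0) S\<^sub>0 U"
proof -
  have d: "g differentiable_on S" "partial i g differentiable_on S" if "g \<in> C2 S" for g i
  proof -
    have "iter_partial is g differentiable_on S" if "length is \<le> 1" for "is"
      using \<open>g \<in> C2 S\<close> that by (auto simp: C2_def)
    from this[of "[]"] this[of "[i]"] show "g differentiable_on S" "partial i g differentiable_on S" by auto
  qed
  have op: "open (S - S\<^sub>0)" using S S0 by (simp add: open_Diff compact_imp_closed)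
  have diffp: "has_partial (\<lambda>x. g x - g' x) i (a - b) x" if "has_partial g i a x" "has_partial g' i b x" for g g' i a b x
    using that unfolding has_partial_def by (rule DERIV_diff)
  have z0: "f x - f\<^sub>0 x = 0" if "x \<in> S - S\<^sub>0" for x using eq that by simp
  have z1: "partial i f x - partial i f\<^sub>0 x = 0" if "x \<in> S - S\<^sub>0" for x i
    by (rule partial_eq_0[OF op that z0 diffp]) (use that f S in \<open>auto intro: C2_has_partial\<close>)
  have z2: "partial j (partial i f) x - partial j (partial i f\<^sub>0) x = 0" if "x \<in> S - S\<^sub>0" for x i j
    by (rule partial_eq_0[OF op that z1 diffp]) (use that f S in \<open>auto intro: C2_has_partial\<close>)
  have dd: "((\<lambda>x. g x - g' x) has_derivative (\<lambda>d. \<Sum>i\<in>UNIV. (partial i g x - partial i g' x) * d $ i)) (at x)"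
    if "g differentiable_on S" "g' differentiable_on S" "x \<in> S" for g g' x
    using has_derivative_diff[OF differentiable_has_derivative_partials[OF that(1) S(1) that(3)]
        differentiable_has_derivative_partials[OF that(2) S(1) that(3)]]
    by (simp add: sum_subtractf[symmetric] left_diff_distrib)
  have b: "\<bar>iter_partial is f x - iter_partial is f\<^sub>0 x\<bar> \<le> U" if "x \<in> S" "length is \<le> 2" for x "is"
    using C2_norm_bound[OF f(1) S(2) that] C2_norm_bound[OF f(2) S(2) that] U by linarith
  obtain x0 where x0: "x0 \<in> S" using S(3) by blast
  have U0: "0 \<le> U" using b[OF x0, of "[]"] by simp
  show ?thesis
  proof
    show "((\<lambda>x. if x \<in> S then f x - f\<^sub>0 x else 0) has_derivative
        (\<lambda>d. \<Sum>i\<in>UNIV. (if x \<in> S then partial i f x - partial i f\<^sub>0 x else 0) * d $ i)) (at x)" for x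
      by (rule has_derivative_zero_extension[OF S(1) S0 z0 dd]) (auto intro: d f)
    show "((\<lambda>x. if x \<in> S then partial i f x - partial i f\<^sub>0 x else 0) has_derivative
        (\<lambda>d. \<Sum>j\<in>UNIV. (if x \<in> S then partial j (partial i f) x - partial j (partial i f\<^sub>0) x else 0) * d $ j)) (at x)" for i x
      by (rule has_derivative_zero_extension[OF S(1) S0 z1 dd]) (auto intro: d f)
    show "continuous_on UNIV (\<lambda>x. if x \<in> S then partial j (partial i f) x - partial j (partial i f\<^sub>0) x else 0)" for i j
      by (rule continuous_zero_extension[OF S(1) S0 _ z2])
        (intro continuous_on_diff C2_continuous_partials(3) f | assumption)+
    show "\<bar>if x \<in> S then f x - f\<^sub>0 x else 0\<bar> \<le> U" for x using b[of x "[]"] U0 by auto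
    show "\<bar>if x \<in> S then partial i f x - partial i f\<^sub>0 x else 0\<bar> \<le> U" for x i using b[of x "[i]"] U0 by auto
    show "\<bar>if x \<in> S then partial j (partial i f) x - partial j (partial i f\<^sub>0) x else 0\<bar> \<le> U" for x i j
      using b[of x "[j, i]"] U0 by auto
  qed (use S0 z0 in auto)
qed

lemma div_grad_bound:
  fixes w1 :: "'n::finite \<Rightarrow> real^'n \<Rightarrow> real"
  assumes "\<bar>f x\<bar> \<le> U" "\<And>i. \<bar>partial i f x\<bar> \<le> U" "0 \<le> c"
  shows "\<bar>c * w x - div_grad f w1 w2 x\<bar> \<le> c * \<bar>w x\<bar> + U * (\<Sum>i\<in>UNIV. \<bar>w1 i x\<bar> + \<bar>w2 i x\<bar>)"
proof -
  have "\<bar>div_grad f w1 w2 x\<bar> \<le> (\<Sum>i\<in>UNIV. U * (\<bar>w1 i x\<bar> + \<bar>w2 i x\<bar>))"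
    unfolding div_grad_def
  proof (rule order_trans[OF sum_abs sum_mono])
    fix i
    have "\<bar>partial i f x * w1 i x\<bar> \<le> U * \<bar>w1 i x\<bar>" "\<bar>f x * w2 i x\<bar> \<le> U * \<bar>w2 i x\<bar>"
      unfolding abs_mult by (intro mult_right_mono assms; simp)+
    thus "\<bar>partial i f x * w1 i x + f x * w2 i x\<bar> \<le> U * (\<bar>w1 i x\<bar> + \<bar>w2 i x\<bar>)"
      unfolding distrib_left by linarith
  qed
  moreover have "\<bar>c * w x\<bar> = c * \<bar>w x\<bar>" using assms(3) by (simp add: abs_mult)
  ultimately show ?thesis unfolding sum_distrib_left by linarith
qed

lemma L2_norm_le_bound:
  assumes "S \<in> lmeasurable" "measure lebesgue S = 1" "g \<in> L2 S" "\<And>x. x \<in> S \<Longrightarrow> \<bar>g x\<bar> \<le> C" "0 \<le> C"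
  shows "L2_norm S g \<le> C"
proof -
  have "L2_inner S g g \<le> L2_inner S (\<lambda>x. C) (\<lambda>x. C)"
    unfolding L2_inner_def
  proof (rule integral_mono)
    fix x assume "x \<in> space (lebesgue_on S)"
    hence "\<bar>g x\<bar> * \<bar>g x\<bar> \<le> C * C" using assms(4)[of x] assms(5) by (intro mult_mono) auto
    thus "g x * g x \<le> C * C" by simp
  qed (intro L2_integrable_mult assms L2_const)+
  also have "\<dots> = C * C"
    using assms(1,2) by (simp add: L2_inner_def measure_restrict_space fmeasurableD)
  finally show ?thesis unfolding L2_norm_def using assms(5) real_sqrt_le_mono by fastforce
qed

lemma sum_sq3: "(a + b + c)\<^sup>2 \<le> 3 * (a\<^sup>2 + b\<^sup>2 + c\<^sup>2)" for a b c :: real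
proof -
  have "0 \<le> (a - b)\<^sup>2 + (b - c)\<^sup>2 + (a - c)\<^sup>2" by simp
  thus ?thesis by (simp add: power2_eq_square algebra_simps)
qed

text \<open>
  Cut off, a function \<open>V\<close> that is \<open>C\<^sup>2\<close> on the whole space becomes a test function. Its product with the cutoff
  inherits the \<open>L\<^sup>2\<close> bounds of \<open>V\<close> and its pure derivatives, with a constant that depends on the cutoff and on the bounds for \<open>f\<close>.
\<close>
lemma cutoff_product_bound:
  fixes S K :: "(real^'n::finite) set"
  assumes S: "open S" "bounded S" "S \<subseteq> cbox a b" and K: "compact K" "K \<subseteq> S"
    and \<theta>: "pure_C2 \<theta> \<theta>1 \<theta>2" "\<And>x. x \<notin> K \<Longrightarrow> \<theta> x = 0"
    and \<theta>b: "\<And>x. x \<in> S \<Longrightarrow> \<bar>\<theta> x\<bar> \<le> C" "\<And>i x. x \<in> S \<Longrightarrow> \<bar>\<theta>1 i x\<bar> \<le> C" "\<And>i x. x \<in> S \<Longrightarrow> \<bar>\<theta>2 i x\<bar> \<le> C"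
    and V: "pure_C2 V V1 V2"
    and M: "integral (cbox a b) (\<lambda>x. (V x)\<^sup>2) \<le> M" "\<And>i. integral (cbox a b) (\<lambda>x. (V1 i x)\<^sup>2) \<le> M"
       "\<And>i. integral (cbox a b) (\<lambda>x. (V2 i x)\<^sup>2) \<le> M"
    and f: "f \<in> C2 S" "\<And>x. x \<in> S \<Longrightarrow> \<bar>f x\<bar> \<le> U" "\<And>i x. x \<in> S \<Longrightarrow> \<bar>partial i f x\<bar> \<le> U"
    and C: "0 \<le> C" "0 \<le> U" "0 \<le> c"
  defines "v \<equiv> \<lambda>x. \<theta> x * V x" and "v1 \<equiv> \<lambda>i x. \<theta>1 i x * V x + \<theta> x * V1 i x"
    and "v2 \<equiv> \<lambda>i x. \<theta>2 i x * V x + 2 * \<theta>1 i x * V1 i x + \<theta> x * V2 i x"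
    and "d \<equiv> real CARD('n)"
  shows "test_function S K v v1 v2"
    and "L2_norm S (\<lambda>x. c * v x - div_grad f v1 v2 x) \<le> sqrt (3 * (1 + 2 * d\<^sup>2)) * (C * (c + 3 * U * d)) * sqrt M"
proof -
  show T: "test_function S K v v1 v2"
    by unfold_locales (use S K \<theta>(2) pure_C2_mult[OF \<theta>(1) V] in \<open>auto simp: v_def v1_def v2_def\<close>)
  have Sab: "S \<subseteq> cbox a b" by (rule S(3))
  interpret test_function S K v v1 v2 by (rule T)
  let ?a = "\<lambda>x. c * v x - div_grad f v1 v2 x"
  define Ca where "Ca = C * (c + 3 * U * d)"
  have d1: "1 \<le> d" by (simp add: d_def Suc_leI)
  have Ca: "0 \<le> Ca" unfolding Ca_def using C d1 by simp
  have M0: "0 \<le> M"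
    using order_trans[OF integral_nonneg M(1)] pure_C2D(1)[OF V]
    by (auto intro!: integrable_continuous continuous_intros intro: continuous_on_subset)
  have pw: "\<bar>?a x\<bar> \<le> Ca * (\<bar>V x\<bar> + (\<Sum>i\<in>UNIV. \<bar>V1 i x\<bar>) + (\<Sum>i\<in>UNIV. \<bar>V2 i x\<bar>))" if x: "x \<in> S" for x
  proof -
    have b0: "\<bar>v x\<bar> \<le> C * \<bar>V x\<bar>"
      unfolding v_def abs_mult by (intro mult_right_mono \<theta>b x) auto
    have b12: "\<bar>v1 i x\<bar> + \<bar>v2 i x\<bar> \<le> C * (2 * \<bar>V x\<bar> + 3 * \<bar>V1 i x\<bar> + \<bar>V2 i x\<bar>)" for i
    proof -
      have "\<bar>\<theta>1 i x * V x\<bar> \<le> C * \<bar>V x\<bar>" "\<bar>\<theta> x * V1 i x\<bar> \<le> C * \<bar>V1 i x\<bar>" "\<bar>\<theta>2 i x * V x\<bar> \<le> C * \<bar>V x\<bar>"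
        "\<bar>\<theta>1 i x * V1 i x\<bar> \<le> C * \<bar>V1 i x\<bar>" "\<bar>\<theta> x * V2 i x\<bar> \<le> C * \<bar>V2 i x\<bar>"
        unfolding abs_mult by (intro mult_right_mono \<theta>b x; simp)+
      moreover have "2 * \<theta>1 i x * V1 i x = 2 * (\<theta>1 i x * V1 i x)" by simp
      ultimately show ?thesis unfolding v1_def v2_def distrib_left by linarith
    qed
    have "\<bar>?a x\<bar> \<le> c * \<bar>v x\<bar> + U * (\<Sum>i\<in>UNIV. \<bar>v1 i x\<bar> + \<bar>v2 i x\<bar>)"
      by (rule div_grad_bound) (use f x C in auto)
    also have "\<dots> \<le> c * (C * \<bar>V x\<bar>) + U * (\<Sum>i\<in>(UNIV::'n set). C * (2 * \<bar>V x\<bar> + 3 * \<bar>V1 i x\<bar> + \<bar>V2 i x\<bar>))"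
      by (intro add_mono mult_left_mono b0 sum_mono b12 C)
    also have "\<dots> = C * (c + 2 * U * d) * \<bar>V x\<bar> + (3 * U * C) * (\<Sum>i\<in>UNIV. \<bar>V1 i x\<bar>) + (U * C) * (\<Sum>i\<in>UNIV. \<bar>V2 i x\<bar>)"
      by (simp add: sum.distrib sum_distrib_left[symmetric] d_def algebra_simps)
    also have "\<dots> \<le> Ca * \<bar>V x\<bar> + Ca * (\<Sum>i\<in>UNIV. \<bar>V1 i x\<bar>) + Ca * (\<Sum>i\<in>UNIV. \<bar>V2 i x\<bar>)"
    proof (intro add_mono mult_right_mono sum_nonneg abs_ge_zero)
      have "2 * U * d \<le> 3 * U * d" using C d1 by (intro mult_right_mono) auto
      thus "C * (c + 2 * U * d) \<le> Ca" unfolding Ca_def using C by (intro mult_left_mono) auto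
      have Ud: "U \<le> U * d" using mult_left_mono[OF d1 C(2)] by simp
      hence "C * (3 * U) \<le> Ca" unfolding Ca_def using C by (intro mult_left_mono) auto
      thus "3 * U * C \<le> Ca" by (simp add: mult_ac)
      moreover have "U * C \<le> 3 * U * C" using C by simp
      ultimately show "U * C \<le> Ca" by linarith
    qed
    finally show ?thesis by (simp add: distrib_left)
  qed
  define G where "G = (\<lambda>x. 3 * Ca\<^sup>2 * ((V x)\<^sup>2 + d * (\<Sum>i\<in>UNIV. (V1 i x)\<^sup>2) + d * (\<Sum>i\<in>UNIV. (V2 i x)\<^sup>2)))"
  have sqs: "(\<Sum>i\<in>UNIV. \<bar>w i\<bar>)\<^sup>2 \<le> d * (\<Sum>i\<in>UNIV. (w i)\<^sup>2)" for w :: "'n \<Rightarrow> real"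
    using sum_squared_le_sum_of_squares[of "\<lambda>i. \<bar>w i\<bar>" UNIV] by (simp add: d_def mult.commute)
  have aG: "?a x * ?a x \<le> G x" if x: "x \<in> S" for x
  proof -
    let ?s1 = "\<Sum>i\<in>UNIV. \<bar>V1 i x\<bar>" and ?s2 = "\<Sum>i\<in>UNIV. \<bar>V2 i x\<bar>"
    have "?a x * ?a x = \<bar>?a x\<bar>\<^sup>2" by (simp add: power2_eq_square)
    also have "\<dots> \<le> (Ca * (\<bar>V x\<bar> + ?s1 + ?s2))\<^sup>2"
      by (intro power_mono pw x) simp
    also have "\<dots> = Ca\<^sup>2 * (\<bar>V x\<bar> + ?s1 + ?s2)\<^sup>2" by (simp add: power_mult_distrib)
    also have "\<dots> \<le> Ca\<^sup>2 * (3 * (\<bar>V x\<bar>\<^sup>2 + ?s1\<^sup>2 + ?s2\<^sup>2))"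
      by (intro mult_left_mono sum_sq3) simp
    also have "\<dots> \<le> Ca\<^sup>2 * (3 * ((V x)\<^sup>2 + d * (\<Sum>i\<in>UNIV. (V1 i x)\<^sup>2) + d * (\<Sum>i\<in>UNIV. (V2 i x)\<^sup>2)))"
      using sqs[of "\<lambda>i. V1 i x"] sqs[of "\<lambda>i. V2 i x"] by (intro mult_left_mono) auto
    finally show ?thesis unfolding G_def by (simp only: mult_ac)
  qed
  have G0: "0 \<le> G x" for x unfolding G_def using d1 by (intro mult_nonneg_nonneg add_nonneg_nonneg sum_nonneg) auto
  have Vc: "continuous_on A V" "continuous_on A (V1 i)" "continuous_on A (V2 i)" for A i
    using pure_C2D(1-3)[OF V] by (auto intro: continuous_on_subset)
  have Gc: "continuous_on A G" for A unfolding G_def by (intro continuous_intros Vc)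
  have aL: "?a \<in> L2 S" by (intro L2_diff L2_scale v_L2 div_grad_L2 f)
  have a_out: "?a x = 0" if "x \<notin> K" for x using v_out v1_out v2_out that by (simp add: div_grad_def)
  have ac: "continuous_on UNIV (\<lambda>x. if x \<in> S then ?a x * ?a x else 0)"
    by (rule continuous_zero_extension[OF S(1) K])
      (use a_out in \<open>auto intro!: continuous_intros cont div_grad_continuous f\<close>)
  have "(L2_norm S ?a)\<^sup>2 = integral S (\<lambda>x. ?a x * ?a x)"
    unfolding L2_norm_sq by (rule L2_inner_eq_integral) (use aL S in \<open>auto simp: borel_open\<close>)
  also have "\<dots> = integral (cbox a b) (\<lambda>x. if x \<in> S then ?a x * ?a x else 0)"
    using Sab by (simp add: integral_restrict_Int Int_absorb1 Int_absorb2)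
  also have "\<dots> \<le> integral (cbox a b) G"
    by (intro integral_le integrable_continuous Gc continuous_on_subset[OF ac]) (use aG G0 in auto)
  also have "\<dots> = 3 * Ca\<^sup>2 * (integral (cbox a b) (\<lambda>x. (V x)\<^sup>2)
      + d * (\<Sum>i\<in>UNIV. integral (cbox a b) (\<lambda>x. (V1 i x)\<^sup>2)) + d * (\<Sum>i\<in>UNIV. integral (cbox a b) (\<lambda>x. (V2 i x)\<^sup>2)))"
  proof -
    have i: "(\<lambda>x. (V x)\<^sup>2) integrable_on cbox a b" "(\<lambda>x. (V1 i x)\<^sup>2) integrable_on cbox a b"
      "(\<lambda>x. (V2 i x)\<^sup>2) integrable_on cbox a b" for i
      by (intro integrable_continuous continuous_intros Vc)+
    have j: "(\<lambda>x. d * (\<Sum>i\<in>UNIV. (V1 i x)\<^sup>2)) integrable_on cbox a b"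
       "(\<lambda>x. d * (\<Sum>i\<in>UNIV. (V2 i x)\<^sup>2)) integrable_on cbox a b"
      by (intro integrable_continuous continuous_intros Vc)+
    show ?thesis unfolding G_def
      by (simp add: integral_add integrable_add i j integral_sum)
  qed
  also have "\<dots> \<le> 3 * Ca\<^sup>2 * (M + d * (\<Sum>i\<in>(UNIV::'n set). M) + d * (\<Sum>i\<in>(UNIV::'n set). M))"
    using d1 by (intro mult_left_mono add_mono M sum_mono) auto
  also have "\<dots> = 3 * Ca\<^sup>2 * ((1 + 2 * d\<^sup>2) * M)" by (simp add: d_def power2_eq_square algebra_simps)
  also have "\<dots> = (sqrt (3 * (1 + 2 * d\<^sup>2)) * Ca * sqrt M)\<^sup>2"
    using M0 by (simp add: power_mult_distrib)
  finally have "(L2_norm S ?a)\<^sup>2 \<le> (sqrt (3 * (1 + 2 * d\<^sup>2)) * Ca * sqrt M)\<^sup>2" .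
  hence "L2_norm S ?a \<le> sqrt (3 * (1 + 2 * d\<^sup>2)) * Ca * sqrt M"
    by (rule power2_le_imp_le) (use Ca M0 in simp)
  thus "L2_norm S ?a \<le> sqrt (3 * (1 + 2 * d\<^sup>2)) * (C * (c + 3 * U * d)) * sqrt M"
    unfolding Ca_def .
qed

lemma finite_family_bounded:
  fixes F :: "'i::finite \<Rightarrow> 'a::topological_space \<Rightarrow> real"
  assumes "compact Q" "\<And>i. continuous_on Q (F i)"
  obtains B where "0 \<le> B" "\<And>i x. x \<in> Q \<Longrightarrow> \<bar>F i x\<bar> \<le> B"
proof -
  have "compact (\<Union>i. F i ` Q)"
    using assms by (intro compact_UN) (auto intro: compact_continuous_image)
  then obtain B where "\<And>y. y \<in> (\<Union>i. F i ` Q) \<Longrightarrow> \<bar>y\<bar> \<le> B"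
    using compact_imp_bounded bounded_iff[of "\<Union>i. F i ` Q"] by (metis real_norm_def)
  hence "\<And>i x. x \<in> Q \<Longrightarrow> \<bar>F i x\<bar> \<le> max 0 B" by (fastforce simp: le_max_iff_disj)
  thus ?thesis using that[of "max 0 B"] by simp
qed

lemma pure_C2_bounded:
  fixes w :: "real^'n::finite \<Rightarrow> real"
  assumes "pure_C2 w w1 w2" "compact Q"
  obtains B where "0 \<le> B" "\<And>x. x \<in> Q \<Longrightarrow> \<bar>w x\<bar> \<le> B" "\<And>i x. x \<in> Q \<Longrightarrow> \<bar>w1 i x\<bar> \<le> B"
    "\<And>i x. x \<in> Q \<Longrightarrow> \<bar>w2 i x\<bar> \<le> B"
proof -
  note c = continuous_on_subset[OF _ subset_UNIV]
  obtain B0 where B0: "0 \<le> B0" "\<And>x. x \<in> Q \<Longrightarrow> \<bar>w x\<bar> \<le> B0"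
    using finite_family_bounded[OF assms(2), of "\<lambda>_::'n. w"] c[OF pure_C2D(1)[OF assms(1)]] by metis
  obtain B1 where B1: "0 \<le> B1" "\<And>i x. x \<in> Q \<Longrightarrow> \<bar>w1 i x\<bar> \<le> B1"
    using finite_family_bounded[OF assms(2), of w1] c[OF pure_C2D(2)[OF assms(1)]] by metis
  obtain B2 where B2: "0 \<le> B2" "\<And>i x. x \<in> Q \<Longrightarrow> \<bar>w2 i x\<bar> \<le> B2"
    using finite_family_bounded[OF assms(2), of w2] c[OF pure_C2D(3)[OF assms(1)]] by metis
  show ?thesis
    by (rule that[of "B0 + B1 + B2"]) (use B0 B1 B2 in \<open>force intro: order_trans\<close>)+
qed

lemma bump_unit:
  "\<bar>bump 0 1 (y :: real^'n::finite)\<bar> \<le> 1" "bump 0 1 (- y) = bump 0 1 y"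
  "y \<notin> cball 0 1 \<Longrightarrow> bump 0 1 y = 0" "continuous_on UNIV (bump 0 1 :: real^'n \<Rightarrow> real)"
  "0 < integral unit_box (bump 0 1 :: real^'n \<Rightarrow> real)"
proof -
  show "\<bar>bump 0 1 y\<bar> \<le> 1" by (auto simp: bump_def max_def intro!: power_le_one)
  show "bump 0 1 (- y) = bump 0 1 y" by (simp add: bump_def)
  show "bump 0 1 y = 0" if "y \<notin> cball 0 1"
    using bump_pos_iff[of 1 0 y] bump_nonneg[of 0 1 y] that by force
  show c: "continuous_on UNIV (bump 0 1 :: real^'n \<Rightarrow> real)"
    unfolding bump_def by (intro continuous_intros)
  hence c': "continuous_on unit_box (bump 0 1 :: real^'n \<Rightarrow> real)" by (rule continuous_on_subset) simp
  have z: "0 \<in> (unit_box :: (real^'n) set)" "0 \<in> box (- One) (One :: real^'n)" by (auto simp: mem_box)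
  have "integral unit_box (bump 0 1 :: real^'n \<Rightarrow> real) \<noteq> 0"
  proof
    assume "integral unit_box (bump 0 1 :: real^'n \<Rightarrow> real) = 0"
    hence "(bump 0 1 has_integral 0) (unit_box :: (real^'n) set)"
      using integrable_integral[OF integrable_continuous[OF c']] by simp
    hence "bump 0 1 (0 :: real^'n) = 0"
      using has_integral_0_cbox_imp_0[OF c'] bump_nonneg z by blast
    thus False by (simp add: bump_def)
  qed
  moreover have "0 \<le> integral unit_box (bump 0 1 :: real^'n \<Rightarrow> real)"
    by (intro integral_nonneg integrable_continuous c') (simp add: bump_nonneg)
  ultimately show "0 < integral unit_box (bump 0 1 :: real^'n \<Rightarrow> real)" by linarith
qed

text \<open>
  The bound is uniform in the scale \<open>s\<close>, because the kernels depend on it only through the shift by \<open>2 s m\<close>.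
\<close>
lemma flux_kernel_bounds:
  fixes m :: "real^'n::finite"
  assumes "pure_C2 \<phi> B1 B2"
  obtains B where "0 \<le> B"
    "\<And>s i. 0 < s \<Longrightarrow> s \<le> 1 \<Longrightarrow> \<exists>k1 k2. pure_C2 (\<lambda>y. \<phi> y * (y $ i + 2 * s * m $ i)) k1 k2 \<and>
       (\<forall>y\<in>unit_box. \<bar>\<phi> y * (y $ i + 2 * s * m $ i)\<bar> \<le> B \<and> (\<forall>j. \<bar>k1 j y\<bar> \<le> B \<and> \<bar>k2 j y\<bar> \<le> B))"
proof -
  obtain B where B: "0 \<le> B" "\<And>y. y \<in> unit_box \<Longrightarrow> \<bar>\<phi> y\<bar> \<le> B" "\<And>j y. y \<in> unit_box \<Longrightarrow> \<bar>B1 j y\<bar> \<le> B"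
    "\<And>j y. y \<in> unit_box \<Longrightarrow> \<bar>B2 j y\<bar> \<le> B"
    using pure_C2_bounded[OF assms compact_cbox] by metis
  let ?q = "1 + 2 * norm m"
  show ?thesis
  proof (rule that[of "B * (?q + 2)"])
    show "0 \<le> B * (?q + 2)" using B(1) by simp
    fix s :: real and i :: 'n assume s: "0 < s" "s \<le> 1"
    let ?l = "\<lambda>y::real^'n. y $ i + 2 * s * m $ i"
    let ?k1 = "\<lambda>j y. B1 j y * ?l y + \<phi> y * ((if j = i then 1 else 0) + 0)"
    let ?k2 = "\<lambda>j y. B2 j y * ?l y + 2 * B1 j y * ((if j = i then 1 else 0) + 0) + \<phi> y * (0 + 0)"
    have p: "pure_C2 (\<lambda>y. \<phi> y * ?l y) ?k1 ?k2"
      by (rule pure_C2_mult[OF assms pure_C2_add[OF pure_C2_coord pure_C2_const]])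
    have bd: "\<bar>\<phi> y * ?l y\<bar> \<le> B * (?q + 2) \<and> (\<forall>j. \<bar>?k1 j y\<bar> \<le> B * (?q + 2) \<and> \<bar>?k2 j y\<bar> \<le> B * (?q + 2))"
      if y: "y \<in> unit_box" for y
    proof -
      have "\<bar>y $ i\<bar> \<le> 1"
      proof -
        have ax: "axis i 1 \<in> (Basis :: (real^'n) set)" by (rule axis_in_Basis_iff[THEN iffD2]) simp
        hence "(- One) \<bullet> (axis i 1 :: real^'n) \<le> y \<bullet> axis i 1 \<and> y \<bullet> axis i 1 \<le> One \<bullet> (axis i 1 :: real^'n)"
          using y unfolding mem_box by blast
        thus ?thesis using ax by (simp add: inner_sum_left_Basis cart_eq_inner_axis abs_le_iff)
      qed
      moreover have "\<bar>2 * s * m $ i\<bar> \<le> 2 * norm m"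
        using mult_mono[OF s(2) component_le_norm_cart[of m i]] s by (simp add: abs_mult)
      ultimately have l: "\<bar>?l y\<bar> \<le> ?q" by linarith
      have mm: "\<bar>g * ?l y\<bar> \<le> B * ?q" if "\<bar>g\<bar> \<le> B" for g
        unfolding abs_mult using that l B(1) by (intro mult_mono) auto
      have e: "B * (?q + 2) = B * ?q + 2 * B" by (simp add: algebra_simps)
      have 1: "\<bar>\<phi> y * ?l y\<bar> \<le> B * (?q + 2)" using mm[OF B(2)[OF y]] B(1) unfolding e by linarith
      have 2: "\<bar>?k1 j y\<bar> \<le> B * (?q + 2)" for j
      proof -
        have "\<bar>\<phi> y * ((if j = i then 1 else 0) + 0)\<bar> \<le> B" using B(1) B(2)[OF y] by simp
        thus ?thesis using mm[OF B(3)[OF y, of j]] B(1) unfolding e by linarith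
      qed
      have 3: "\<bar>?k2 j y\<bar> \<le> B * (?q + 2)" for j
      proof -
        have "\<bar>2 * B1 j y * ((if j = i then 1 else 0) + 0)\<bar> \<le> 2 * B" using B(1) B(3)[OF y, of j] by (auto simp: abs_mult)
        moreover have "\<phi> y * (0 + 0) = 0" by simp
        ultimately show ?thesis using mm[OF B(4)[OF y, of j]] unfolding e by linarith
      qed
      show ?thesis using 1 2 3 by blast
    qed
    show "\<exists>k1 k2. pure_C2 (\<lambda>y. \<phi> y * ?l y) k1 k2 \<and>
       (\<forall>y\<in>unit_box. \<bar>\<phi> y * ?l y\<bar> \<le> B * (?q + 2) \<and> (\<forall>j. \<bar>k1 j y\<bar> \<le> B * (?q + 2) \<and> \<bar>k2 j y\<bar> \<le> B * (?q + 2)))"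
      by (rule exI[of _ ?k1], rule exI[of _ ?k2], intro conjI p ballI bd)
  qed
qed

text \<open>
  All constants are chosen before the coefficients: they depend on \<open>S\<close>, \<open>S\<^sub>0\<close>, \<open>U\<close> and \<open>D\<close> only. For each direction \<open>i\<close>
  the energy form is tested with the cut-off coordinate \<open>u i\<close> and the cut-off mollification \<open>v\<close> of \<open>h\<close>. Where \<open>h\<close> does not
  vanish, the cutoff is constant, and the energy density is \<open>h\<close> times the \<open>i\<close>-th derivative of the mollification.
\<close>
theorem stability_estimate:
  fixes S S\<^sub>0 :: "(real^'n::finite) set" and U D :: real
  assumes S: "open S" "bounded S" and S1: "measure lebesgue S = 1"
    and S0: "compact S\<^sub>0" "S\<^sub>0 \<subseteq> S" and D: "D > 0" and U: "0 \<le> U"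
  obtains C where "0 < C"
    "\<And>f f\<^sub>0 e lam e\<^sub>0 lam\<^sub>0 \<delta>. f \<in> C2 S \<Longrightarrow> f\<^sub>0 \<in> C2 S \<Longrightarrow> \<forall>x\<in>S - S\<^sub>0. f x = f\<^sub>0 x \<Longrightarrow>
       C2_norm S f + C2_norm S f\<^sub>0 \<le> U \<Longrightarrow>
       neumann_eigensystem S f e lam \<Longrightarrow> neumann_eigensystem S f\<^sub>0 e\<^sub>0 lam\<^sub>0 \<Longrightarrow> 0 < \<delta> \<Longrightarrow> \<delta> < 1 \<Longrightarrow>
       (\<And>\<phi>. \<phi> \<in> L2 S \<Longrightarrow>
        L2_norm S (\<lambda>x. semigroup_op S e lam D \<phi> x - semigroup_op S e\<^sub>0 lam\<^sub>0 D \<phi> x) \<le> \<delta> * L2_norm S \<phi>) \<Longrightarrow>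
       L2_norm S (\<lambda>x. f x - f\<^sub>0 x) \<le> C * (1 / (2 + ln (1 / \<delta>))) powr (2 / 3)"
proof -
  have Sne: "S \<noteq> {}" using S1 by auto
  have Slm: "S \<in> lmeasurable" by (rule lmeasurable_open[OF S(2,1)])
  have Sm: "S \<in> sets lebesgue" using Slm by (rule fmeasurableD)
  define d where "d = real CARD('n)"
  have d1: "1 \<le> d" by (simp add: d_def Suc_leI)
  obtain aa where aa: "S \<subseteq> cbox (-aa) aa" using bounded_subset_cbox_symmetric[OF S(2)] by blast
  let ?Q = "cbox (-aa) aa"
  obtain R where R: "0 < R" "S\<^sub>0 \<subseteq> ball 0 R"
    using bounded_subset_ballD[OF compact_imp_bounded[OF S0(1)], of 0] by auto
  \<comment> \<open>This is the length required in \<open>correlation_far\<close>.\<close>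
  define m :: "real^'n" where "m = (2 * R + 1) *\<^sub>R axis undefined 1"
  have m: "norm m = 2 * R + 1" using R by (simp add: m_def norm_axis_1)
  let ?\<phi> = "bump 0 1 :: real^'n \<Rightarrow> real"
  let ?c0 = "integral unit_box ?\<phi>"
  note \<phi> = bump_unit
  obtain B1 B2 where pB: "pure_C2 ?\<phi> B1 B2" using pure_C2_bump by blast
  obtain Bk where Bk: "0 \<le> Bk" and kb: "\<And>s i. 0 < s \<Longrightarrow> s \<le> 1 \<Longrightarrow> \<exists>k1 k2. pure_C2 (\<lambda>y. ?\<phi> y * (y $ i + 2 * s * m $ i)) k1 k2 \<and>
       (\<forall>y\<in>unit_box. \<bar>?\<phi> y * (y $ i + 2 * s * m $ i)\<bar> \<le> Bk \<and> (\<forall>j. \<bar>k1 j y\<bar> \<le> Bk \<and> \<bar>k2 j y\<bar> \<le> Bk))"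
    using flux_kernel_bounds[OF pB, of m] by blast
  obtain \<theta> \<theta>1 \<theta>2 K N where \<theta>: "pure_C2 \<theta> \<theta>1 \<theta>2" and Kc: "compact K" "K \<subseteq> S" and \<theta>K: "\<And>x. x \<notin> K \<Longrightarrow> \<theta> x = 0"
    and N: "open N" "S\<^sub>0 \<subseteq> N" and \<theta>N: "\<And>x. x \<in> N \<Longrightarrow> \<theta> x = 1"
    using smooth_cutoff[OF S(1) S0] by metis
  obtain C\<theta> where C\<theta>: "0 \<le> C\<theta>" "\<And>x. x \<in> ?Q \<Longrightarrow> \<bar>\<theta> x\<bar> \<le> C\<theta>" "\<And>i x. x \<in> ?Q \<Longrightarrow> \<bar>\<theta>1 i x\<bar> \<le> C\<theta>"
    "\<And>i x. x \<in> ?Q \<Longrightarrow> \<bar>\<theta>2 i x\<bar> \<le> C\<theta>"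
    using pure_C2_bounded[OF \<theta> compact_cbox] by metis
  have CS: "\<bar>\<theta> x\<bar> \<le> C\<theta>" "\<bar>\<theta>1 i x\<bar> \<le> C\<theta>" "\<bar>\<theta>2 i x\<bar> \<le> C\<theta>" if "x \<in> S" for i x
    using C\<theta>(2-4) that aa by blast+
  define u where "u = (\<lambda>i x. \<theta> x * x $ i)"
  define u1 where "u1 = (\<lambda>i j x. \<theta>1 j x * x $ i + \<theta> x * (if j = i then 1 else 0))"
  define u2 where "u2 = (\<lambda>i j x. \<theta>2 j x * x $ i + 2 * \<theta>1 j x * (if j = i then 1 else 0) + \<theta> x * 0)"
  have u: "pure_C2 (u i) (u1 i) (u2 i)" for i
    unfolding u_def u1_def u2_def by (rule pure_C2_mult[OF \<theta> pure_C2_coord])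
  have ut: "test_function S K (u i) (u1 i) (u2 i)" for i
    by unfold_locales (use S Kc u \<theta>K in \<open>auto simp: u_def\<close>)
  have "\<exists>B. \<forall>i. 0 \<le> B \<and> (\<forall>x\<in>?Q. \<bar>u i x\<bar> \<le> B \<and> (\<forall>j. \<bar>u1 i j x\<bar> \<le> B \<and> \<bar>u2 i j x\<bar> \<le> B))"
  proof -
    have "\<exists>B. 0 \<le> B \<and> (\<forall>x\<in>?Q. \<bar>u i x\<bar> \<le> B \<and> (\<forall>j. \<bar>u1 i j x\<bar> \<le> B \<and> \<bar>u2 i j x\<bar> \<le> B))" for i
      using pure_C2_bounded[OF u[of i] compact_cbox] by metis
    then obtain B where B: "\<And>i. 0 \<le> B i \<and> (\<forall>x\<in>?Q. \<bar>u i x\<bar> \<le> B i \<and> (\<forall>j. \<bar>u1 i j x\<bar> \<le> B i \<and> \<bar>u2 i j x\<bar> \<le> B i))"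
      by metis
    have "B i \<le> (\<Sum>i\<in>UNIV. B i)" for i using B by (intro member_le_sum) auto
    thus ?thesis using B by (intro exI[of _ "\<Sum>i\<in>UNIV. B i"]) (meson order_trans)
  qed
  then obtain Cu where Cu: "0 \<le> Cu" "\<And>i x. x \<in> ?Q \<Longrightarrow> \<bar>u i x\<bar> \<le> Cu" "\<And>i j x. x \<in> ?Q \<Longrightarrow> \<bar>u1 i j x\<bar> \<le> Cu"
    "\<And>i j x. x \<in> ?Q \<Longrightarrow> \<bar>u2 i j x\<bar> \<le> Cu" by blast
  define Cb where "Cb = 2 / D * Cu + U * (d * (2 * Cu))"
  have Cb: "0 \<le> Cb" unfolding Cb_def using D Cu(1) U d1 by simp
  define V0 where "V0 = measure lborel (unit_box :: (real^'n) set)"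
  have V0: "0 \<le> V0" unfolding V0_def by (rule measure_nonneg)
  define Ca where "Ca = sqrt (3 * (1 + 2 * d\<^sup>2)) * (C\<theta> * (2 / D + 3 * U * d)) * (Bk * V0)"
  have Ca: "0 \<le> Ca" unfolding Ca_def using C\<theta>(1) D U d1 Bk V0 by (intro mult_nonneg_nonneg) auto
  define A0 where "A0 = 1 * V0 * (d\<^sup>2 * U + d * U * norm m)"
  define C where "C = (A0 * sqrt (measure lborel ?Q) + d * (4 * D * (Ca * Cb))) / ?c0 + 1"
  have A0: "0 \<le> A0" unfolding A0_def using V0 U d1 by (intro mult_nonneg_nonneg add_nonneg_nonneg) auto
  have Cpos: "0 < C"
    unfolding C_def using A0 Ca Cb D d1 \<phi>(5) by (intro add_nonneg_pos divide_nonneg_pos add_nonneg_nonneg mult_nonneg_nonneg) (auto simp: measure_nonneg)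
  show ?thesis
  proof (rule that[OF Cpos])
    fix f f\<^sub>0 e lam e\<^sub>0 lam\<^sub>0 \<delta>
    assume f: "f \<in> C2 S" "f\<^sub>0 \<in> C2 S" and eq: "\<forall>x\<in>S - S\<^sub>0. f x = f\<^sub>0 x" and fU: "C2_norm S f + C2_norm S f\<^sub>0 \<le> U"
      and sys: "neumann_eigensystem S f e lam" "neumann_eigensystem S f\<^sub>0 e\<^sub>0 lam\<^sub>0" and \<delta>: "0 < \<delta>" "\<delta> < 1"
      and close: "\<And>\<phi>. \<phi> \<in> L2 S \<Longrightarrow>
        L2_norm S (\<lambda>x. semigroup_op S e lam D \<phi> x - semigroup_op S e\<^sub>0 lam\<^sub>0 D \<phi> x) \<le> \<delta> * L2_norm S \<phi>"
    define \<epsilon> where "\<epsilon> = 1 / (2 + ln (1 / \<delta>))"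
    have "ln (1 / \<delta>) > 0" using \<delta> by simp
    hence \<epsilon>: "0 < \<epsilon>" "\<epsilon> \<le> 1" by (auto simp: \<epsilon>_def)
    define h where "h = (\<lambda>x. if x \<in> S then f x - f\<^sub>0 x else 0)"
    define p1 where "p1 = (\<lambda>i x. if x \<in> S then partial i f x - partial i f\<^sub>0 x else 0)"
    define p2 where "p2 = (\<lambda>i j x. if x \<in> S then partial j (partial i f) x - partial j (partial i f\<^sub>0) x else 0)"
    interpret compact_C2 h p1 p2 S\<^sub>0 U
      unfolding h_def p1_def p2_def by (rule difference_compact_C2[OF S Sne S0 f eq fU])
    let ?N2 = "integral UNIV (\<lambda>x. (h x)\<^sup>2)"
    have N2: "0 \<le> ?N2"
      by (intro integral_nonneg integrable_compact_support[OF _ S0(1)] continuous_intros cont0) (auto simp: K(2))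
    have norm0: "C2_norm S g \<ge> 0" if "g \<in> C2 S" for g
      using C2_norm_bound[OF that S(2), of _ "[]"] Sne by fastforce
    have fb: "\<bar>f x\<bar> \<le> U" "\<bar>partial i f x\<bar> \<le> U" "\<bar>f\<^sub>0 x\<bar> \<le> U" "\<bar>partial i f\<^sub>0 x\<bar> \<le> U" if "x \<in> S" for x i
      using C2_norm_bound[OF f(1) S(2) that, of "[]"] C2_norm_bound[OF f(1) S(2) that, of "[i]"]
        C2_norm_bound[OF f(2) S(2) that, of "[]"] C2_norm_bound[OF f(2) S(2) that, of "[i]"] fU norm0[OF f(1)] norm0[OF f(2)]
      by auto
    have bu: "L2_norm S (\<lambda>x. 2 / D * u i x - div_grad f\<^sub>0 (u1 i) (u2 i) x) \<le> Cb" for i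
    proof -
      interpret t: test_function S K "u i" "u1 i" "u2 i" by (rule ut)
      show ?thesis
      proof (rule L2_norm_le_bound[OF Slm S1 _ _ Cb])
        show "(\<lambda>x. 2 / D * u i x - div_grad f\<^sub>0 (u1 i) (u2 i) x) \<in> L2 S"
          by (intro L2_diff L2_scale t.v_L2 t.div_grad_L2 f)
        fix x assume x: "x \<in> S"
        hence xQ: "x \<in> ?Q" using aa by blast
        have "\<bar>2 / D * u i x - div_grad f\<^sub>0 (u1 i) (u2 i) x\<bar>
            \<le> 2 / D * \<bar>u i x\<bar> + U * (\<Sum>j\<in>UNIV. \<bar>u1 i j x\<bar> + \<bar>u2 i j x\<bar>)"
          by (rule div_grad_bound) (use fb x D in auto)
        also have "\<dots> \<le> 2 / D * Cu + U * (\<Sum>j\<in>(UNIV::'n set). Cu + Cu)"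
          using D U by (intro add_mono mult_left_mono sum_mono Cu xQ) auto
        also have "\<dots> = Cb" by (simp add: Cb_def d_def)
        finally show "\<bar>2 / D * u i x - div_grad f\<^sub>0 (u1 i) (u2 i) x\<bar> \<le> Cb" .
      qed
    qed
    have flux: "\<bar>\<Sum>i\<in>UNIV. integral ?Q (\<lambda>x. h x * mollify (flux_kernel ?\<phi> m s i) s (s\<^sup>2 *\<^sub>R m) (p1 i) x)\<bar>
        \<le> (d * (4 * D * (Ca * Cb)) * \<epsilon> * sqrt ?N2) / s\<^sup>2" if s: "0 < s" "s \<le> 1" for s
    proof -
      have one: "\<bar>integral ?Q (\<lambda>x. h x * mollify (flux_kernel ?\<phi> m s i) s (s\<^sup>2 *\<^sub>R m) (p1 i) x)\<bar>
          \<le> 4 * D * \<epsilon> * ((Ca * (sqrt ?N2 / s\<^sup>2)) * Cb)" for i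
      proof -
        let ?k = "flux_kernel ?\<phi> m s i"
        obtain k1 k2 where k: "pure_C2 ?k k1 k2" "\<And>y. y \<in> unit_box \<Longrightarrow> \<bar>?k y\<bar> \<le> Bk"
           "\<And>j y. y \<in> unit_box \<Longrightarrow> \<bar>k1 j y\<bar> \<le> Bk" "\<And>j y. y \<in> unit_box \<Longrightarrow> \<bar>k2 j y\<bar> \<le> Bk"
          using kb[OF s, of i] by blast
        have kz: "?k y = 0" if "y \<notin> cball 0 1" for y using \<phi>(3)[OF that] by simp
        define V where "V = mollify ?k s (s\<^sup>2 *\<^sub>R m) h"
        define V1 where "V1 = (\<lambda>j. mollify ?k s (s\<^sup>2 *\<^sub>R m) (p1 j))"
        define V2 where "V2 = (\<lambda>j. mollify ?k s (s\<^sup>2 *\<^sub>R m) (p2 j j))"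
        have V: "pure_C2 V V1 V2" unfolding V_def V1_def V2_def by (rule mollify_pure_C2[OF pure_C2D(1)[OF k(1)]])
        define M where "M = (Bk * V0 / s\<^sup>2)\<^sup>2 * ?N2"
        note Mb = mollify_L2_bounds[OF k(1) kz k(2-4) s, of "-aa" aa "s\<^sup>2 *\<^sub>R m", folded V0_def, folded M_def V_def]
        have Mb': "integral ?Q (\<lambda>x. (V1 j x)\<^sup>2) \<le> M" "integral ?Q (\<lambda>x. (V2 j x)\<^sup>2) \<le> M" for j
          unfolding V1_def V2_def using Mb(2)[of j] Mb(3)[of j] by simp_all
        note P = cutoff_product_bound[OF S aa Kc \<theta> \<theta>K CS V Mb(1) Mb' f(1) fb(1,2) C\<theta>(1) U, of "2 / D", folded d_def]
        define v where "v = (\<lambda>x. \<theta> x * V x)"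
        define v1 where "v1 = (\<lambda>i x. \<theta>1 i x * V x + \<theta> x * V1 i x)"
        define v2 where "v2 = (\<lambda>i x. \<theta>2 i x * V x + 2 * \<theta>1 i x * V1 i x + \<theta> x * V2 i x)"
        have vt: "test_function S K v v1 v2"
          unfolding v_def v1_def v2_def by (rule P(1)) (use aa D in auto)
        have "L2_norm S (\<lambda>x. 2 / D * v x - div_grad f v1 v2 x) \<le> sqrt (3 * (1 + 2 * d\<^sup>2)) * (C\<theta> * (2 / D + 3 * U * d)) * sqrt M"
          unfolding v_def v1_def v2_def by (rule P(2)) (use aa D in auto)
        also have "sqrt M = Bk * V0 / s\<^sup>2 * sqrt ?N2"
          unfolding M_def using Bk V0 by (simp add: real_sqrt_mult abs_of_nonneg)
        also have "sqrt (3 * (1 + 2 * d\<^sup>2)) * (C\<theta> * (2 / D + 3 * U * d)) * (Bk * V0 / s\<^sup>2 * sqrt ?N2) = Ca * (sqrt ?N2 / s\<^sup>2)"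
          unfolding Ca_def by simp
        finally have av: "L2_norm S (\<lambda>x. 2 / D * v x - div_grad f v1 v2 x) \<le> Ca * (sqrt ?N2 / s\<^sup>2)" .
        have \<theta>1N: "\<theta>1 j x = 0" if "x \<in> N" for j x
          by (rule partial_eq_0[OF N(1) that \<theta>N pure_C2D(4)[OF \<theta>]])
        have "integral ?Q (\<lambda>x. h x * V1 i x) = integral S (\<lambda>x. h x * V1 i x)"
          by (rule integral_support) (use aa in \<open>auto simp: h_def\<close>)
        also have "\<dots> = integral S (\<lambda>x. (f x - f\<^sub>0 x) * (\<Sum>j\<in>UNIV. u1 i j x * v1 j x))"
        proof (rule integral_cong)
          fix x assume x: "x \<in> S"
          show "h x * V1 i x = (f x - f\<^sub>0 x) * (\<Sum>j\<in>UNIV. u1 i j x * v1 j x)"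
          proof (cases "x \<in> S\<^sub>0")
            case True
            hence xN: "x \<in> N" using N(2) by blast
            have "(\<Sum>j\<in>UNIV. u1 i j x * v1 j x) = (\<Sum>j\<in>UNIV. if j = i then V1 j x else 0)"
              by (intro sum.cong refl) (simp add: u1_def v1_def \<theta>1N[OF xN] \<theta>N[OF xN])
            also have "\<dots> = V1 i x" by simp
            finally show ?thesis using x by (simp add: h_def)
          qed (use eq x in \<open>auto simp: h_def\<close>)
        qed
        also have "\<bar>\<dots>\<bar> \<le> 4 * D / (2 + ln (1 / \<delta>)) * (L2_norm S (\<lambda>x. 2 / D * v x - div_grad f v1 v2 x)
          * L2_norm S (\<lambda>x. 2 / D * u i x - div_grad f\<^sub>0 (u1 i) (u2 i) x))"
          by (rule energy_difference_bound[OF f sys D \<delta> close ut vt])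
        also have "\<dots> \<le> 4 * D / (2 + ln (1 / \<delta>)) * ((Ca * (sqrt ?N2 / s\<^sup>2)) * Cb)"
          using D \<epsilon>(1) Ca N2 by (intro mult_left_mono mult_mono av bu) (auto simp: \<epsilon>_def L2_norm_nonneg)
        finally show ?thesis by (simp add: V1_def \<epsilon>_def)
      qed
      have "\<bar>\<Sum>i\<in>UNIV. integral ?Q (\<lambda>x. h x * mollify (flux_kernel ?\<phi> m s i) s (s\<^sup>2 *\<^sub>R m) (p1 i) x)\<bar>
         \<le> (\<Sum>i\<in>(UNIV::'n set). 4 * D * \<epsilon> * ((Ca * (sqrt ?N2 / s\<^sup>2)) * Cb))"
        by (rule order_trans[OF sum_abs sum_mono]) (rule one)
      also have "\<dots> = (d * (4 * D * (Ca * Cb)) * \<epsilon> * sqrt ?N2) / s\<^sup>2" by (simp add: d_def)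
      finally show ?thesis .
    qed
    define A where "A = d * (4 * D * (Ca * Cb)) * \<epsilon>"
    have A: "0 \<le> A" unfolding A_def using d1 D Ca Cb \<epsilon> by simp
    have far: "correlation ?\<phi> m (-aa) aa 1 = 0"
      by (rule correlation_far[OF \<phi>(3) R(2)]) (simp_all add: m)
    \<comment> \<open>Up to constants, this scale balances the mollification error \<open>r\<^sup>2\<close> and the bound \<open>\<epsilon> / r\<close> on the correlation.\<close>
    define r where "r = \<epsilon> powr (1 / 3)"
    have r: "0 < r" "r \<le> 1" unfolding r_def using \<epsilon> by (auto intro: powr_le1)
    have corr: "\<bar>correlation ?\<phi> m (-aa) aa r\<bar> \<le> A * sqrt ?N2 / r"
      by (rule correlation_bound[OF \<phi>(4) _ _ far r]) (use A flux in \<open>auto simp: A_def N2\<close>)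
    have "?c0 * sqrt ?N2 \<le> A0 * sqrt (measure lborel ?Q) * r\<^sup>2 + A / r"
      unfolding A0_def V0_def d_def
      by (rule norm_bound_from_correlation[OF \<phi>(4,1,2,3,5) r(1) _ corr A]) (use S0 aa in auto)
    also have "r\<^sup>2 = \<epsilon> powr (2 / 3)"
      using \<epsilon> by (simp add: r_def powr_powr flip: powr_numeral)
    also have "A / r = d * (4 * D * (Ca * Cb)) * \<epsilon> powr (2 / 3)"
    proof -
      have "\<epsilon> / r = \<epsilon> powr 1 / \<epsilon> powr (1 / 3)" using \<epsilon> by (simp add: r_def)
      also have "\<dots> = \<epsilon> powr (2 / 3)" by (subst powr_diff[symmetric]) simp
      finally show ?thesis unfolding A_def by (metis times_divide_eq_right)
    qed
    finally have "?c0 * sqrt ?N2 \<le> (A0 * sqrt (measure lborel ?Q) + d * (4 * D * (Ca * Cb))) * \<epsilon> powr (2 / 3)"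
      by (simp add: algebra_simps)
    hence "sqrt ?N2 \<le> (A0 * sqrt (measure lborel ?Q) + d * (4 * D * (Ca * Cb))) * \<epsilon> powr (2 / 3) / ?c0"
      unfolding pos_le_divide_eq[OF \<phi>(5)] by (subst mult.commute)
    also have "\<dots> \<le> C * \<epsilon> powr (2 / 3)" unfolding C_def by (simp add: distrib_right)
    finally have "sqrt ?N2 \<le> C * \<epsilon> powr (2 / 3)" .
    moreover have "L2_norm S (\<lambda>x. f x - f\<^sub>0 x) = sqrt ?N2"
    proof -
      have fL: "(\<lambda>x. f x - f\<^sub>0 x) \<in> L2 S" by (intro L2_diff C2_L2 f S)
      have "L2_inner S (\<lambda>x. f x - f\<^sub>0 x) (\<lambda>x. f x - f\<^sub>0 x) = integral S (\<lambda>x. (f x - f\<^sub>0 x) * (f x - f\<^sub>0 x))"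
        by (rule L2_inner_eq_integral[OF Sm fL fL])
      also have "\<dots> = integral S (\<lambda>x. (h x)\<^sup>2)"
        by (intro integral_cong) (simp add: h_def power2_eq_square)
      also have "\<dots> = ?N2"
        by (rule integral_support[symmetric]) (auto simp: h_def)
      finally show ?thesis by (simp add: L2_norm_def)
    qed
    ultimately show "L2_norm S (\<lambda>x. f x - f\<^sub>0 x) \<le> C * (1 / (2 + ln (1 / \<delta>))) powr (2 / 3)"
      by (simp add: \<epsilon>_def)
  qed
qed

section \<open>Stability and injectivity\<close>

lemma L2_norm_eq_0_imp:
  fixes g :: "real^'n::finite \<Rightarrow> real"
  assumes "open S" "continuous_on S g" "g \<in> L2 S" "L2_norm S g = 0" "x \<in> S"
  shows "g x = 0"
proof (rule ccontr)
  assume "g x \<noteq> 0"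
  let ?W = "S \<inter> g -` (- {0})"
  have "open ?W" by (rule continuous_open_preimage[OF assms(2,1)]) auto
  have Sm: "S \<in> sets lebesgue" using assms(1) by (simp add: borel_open)
  have "AE x in lebesgue_on S. g x = 0" using L2_norm_eq_0_iff[OF assms(3)] assms(4) by simp
  hence "AE x in lebesgue. x \<in> S \<longrightarrow> g x = 0" using Sm by (simp add: AE_restrict_space_iff)
  then obtain N where N: "N \<in> null_sets lebesgue" "{x. \<not> (x \<in> S \<longrightarrow> g x = 0)} \<subseteq> N"
    by (auto simp: eventually_ae_filter)
  have "?W \<subseteq> N" using N(2) by auto
  moreover have "negligible N" using N(1) by (simp add: negligible_iff_null_sets)
  ultimately have "negligible ?W" by (rule negligible_subset[rotated])
  moreover have "?W \<noteq> {}" using assms(5) \<open>g x \<noteq> 0\<close> by blast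
  ultimately show False using open_not_negligible \<open>open ?W\<close> by blast
qed

lemma powr_modulus_le:
  assumes "0 < \<delta>" "\<delta> < (1::real)"
  shows "(1 / (2 + ln (1 / \<delta>))) powr (2 / 3) \<le> ln (1 / \<delta>) powr (- 2 / 3)"
proof -
  have l: "ln (1 / \<delta>) > 0" using assms by simp
  have "(1 / (2 + ln (1 / \<delta>))) powr (2 / 3) \<le> (1 / ln (1 / \<delta>)) powr (2 / 3)"
    using l by (intro powr_mono2 divide_left_mono) auto
  also have "\<dots> = ln (1 / \<delta>) powr (- 2 / 3)" using l by (simp add: powr_minus_divide powr_divide)
  finally show ?thesis .
qed

theorem theorem5:
  fixes S S\<^sub>0 :: "(real^'n::finite) set" and f\<^sub>m\<^sub>i\<^sub>n U D :: real
  assumes "open S" and "bounded S" and "convex S" and "smooth_boundary S"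
    and "measure lebesgue S = 1"
    and "compact S\<^sub>0" and "S\<^sub>0 \<subseteq> S"
    and "f\<^sub>m\<^sub>i\<^sub>n > 0" and "D > 0"
  shows "(\<exists>C>0. \<forall>f f\<^sub>0 e lam e\<^sub>0 lam\<^sub>0.
            f \<in> C2 S \<longrightarrow> f\<^sub>0 \<in> C2 S \<longrightarrow>
            (\<forall>x\<in>S. f x \<ge> f\<^sub>m\<^sub>i\<^sub>n \<and> f\<^sub>0 x \<ge> f\<^sub>m\<^sub>i\<^sub>n) \<longrightarrow>
            (\<forall>x\<in>S - S\<^sub>0. f x = f\<^sub>0 x) \<longrightarrow>
            C2_norm S f + C2_norm S f\<^sub>0 \<le> U \<longrightarrow>
            neumann_eigensystem S f e lam \<longrightarrow> neumann_eigensystem S f\<^sub>0 e\<^sub>0 lam\<^sub>0 \<longrightarrow>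
            (let P = semigroup_op S e lam D; P\<^sub>0 = semigroup_op S e\<^sub>0 lam\<^sub>0 D in
              L2_norm S (\<lambda>x. f x - f\<^sub>0 x) \<le>
                (if L2_operator_eq S P P\<^sub>0 then 0
                 else C * ln (1 / L2_operator_norm S (\<lambda>\<phi> x. P \<phi> x - P\<^sub>0 \<phi> x)) powr (- 2 / 3))))
       \<and>
         (\<forall>f f\<^sub>0 e lam e\<^sub>0 lam\<^sub>0.
            f \<in> C2 S \<longrightarrow> f\<^sub>0 \<in> C2 S \<longrightarrow>
            (\<forall>x\<in>S. f x \<ge> f\<^sub>m\<^sub>i\<^sub>n \<and> f\<^sub>0 x \<ge> f\<^sub>m\<^sub>i\<^sub>n) \<longrightarrow>
            (\<forall>x\<in>S - S\<^sub>0. f x = f\<^sub>0 x) \<longrightarrow>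
            neumann_eigensystem S f e lam \<longrightarrow> neumann_eigensystem S f\<^sub>0 e\<^sub>0 lam\<^sub>0 \<longrightarrow>
            L2_operator_eq S (semigroup_op S e lam D) (semigroup_op S e\<^sub>0 lam\<^sub>0 D) \<longrightarrow>
            (\<forall>x\<in>S. f x = f\<^sub>0 x))"
proof -
  note S = assms(1,2) and S0 = assms(6,7)
  have est: "\<exists>C>0. \<forall>f f\<^sub>0 e lam e\<^sub>0 lam\<^sub>0. f \<in> C2 S \<longrightarrow> f\<^sub>0 \<in> C2 S \<longrightarrow> (\<forall>x\<in>S - S\<^sub>0. f x = f\<^sub>0 x) \<longrightarrow>
       C2_norm S f + C2_norm S f\<^sub>0 \<le> U \<longrightarrow>
       neumann_eigensystem S f e lam \<longrightarrow> neumann_eigensystem S f\<^sub>0 e\<^sub>0 lam\<^sub>0 \<longrightarrow>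
       L2_norm S (\<lambda>x. f x - f\<^sub>0 x) \<le>
         (if L2_operator_eq S (semigroup_op S e lam D) (semigroup_op S e\<^sub>0 lam\<^sub>0 D) then 0
          else C * ln (1 / L2_operator_norm S (\<lambda>\<phi> x. semigroup_op S e lam D \<phi> x - semigroup_op S e\<^sub>0 lam\<^sub>0 D \<phi> x)) powr (- 2 / 3))"
    for U
  proof (rule stability_estimate[OF S assms(5) S0 assms(9) abs_ge_zero[of U]], goal_cases)
    case (1 C)
    note C = 1(1) and est = 1(2)
    show ?thesis
    proof (intro exI[of _ C] conjI C allI impI)
      fix f f\<^sub>0 e lam e\<^sub>0 lam\<^sub>0
      assume f: "f \<in> C2 S" "f\<^sub>0 \<in> C2 S" and eq: "\<forall>x\<in>S - S\<^sub>0. f x = f\<^sub>0 x" and fU: "C2_norm S f + C2_norm S f\<^sub>0 \<le> U"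
        and sys: "neumann_eigensystem S f e lam" "neumann_eigensystem S f\<^sub>0 e\<^sub>0 lam\<^sub>0"
      let ?P = "semigroup_op S e lam D" and ?Q = "semigroup_op S e\<^sub>0 lam\<^sub>0 D"
      let ?T = "\<lambda>\<phi> x. ?P \<phi> x - ?Q \<phi> x"
      have fU': "C2_norm S f + C2_norm S f\<^sub>0 \<le> \<bar>U\<bar>" using fU by simp
      note est' = est[OF f eq fU' sys]
      interpret gapped_multipliers S e ?P "\<lambda>j. exp (- D * lam j)" e\<^sub>0 ?Q "\<lambda>j. exp (- D * lam\<^sub>0 j)"
          "max (exp (- D * lam 1)) (exp (- D * lam\<^sub>0 1))"
        by (rule semigroups_gapped[OF sys S assms(9)])
      note nb = operator_norm_bounds
      show "L2_norm S (\<lambda>x. f x - f\<^sub>0 x) \<le>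
         (if L2_operator_eq S ?P ?Q then 0 else C * ln (1 / L2_operator_norm S ?T) powr (- 2 / 3))"
      proof (cases "L2_operator_eq S ?P ?Q")
        case True
        \<comment> \<open>The estimate holds for every \<open>\<delta> = exp (- t)\<close>; let \<open>t\<close> tend to infinity.\<close>
        have zero: "L2_norm S (?T \<phi>) = 0" if "\<phi> \<in> L2 S" for \<phi>
        proof -
          have "AE x in lebesgue_on S. ?P \<phi> x = ?Q \<phi> x"
            using True that unfolding L2_operator_eq_def by blast
          hence "AE x in lebesgue_on S. ?T \<phi> x = 0" by eventually_elim simp
          thus ?thesis using L2_norm_eq_0_iff[OF T_mem[OF that]] by blast
        qed
        have "L2_norm S (\<lambda>x. f x - f\<^sub>0 x) \<le> C * (1 / (2 + t)) powr (2 / 3)" if t: "t > 0" for t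
        proof -
          have "L2_norm S (\<lambda>x. f x - f\<^sub>0 x) \<le> C * (1 / (2 + ln (1 / exp (- t)))) powr (2 / 3)"
            by (rule est') (use t zero L2_norm_nonneg[of S] in auto)
          thus ?thesis by (simp add: ln_div)
        qed
        hence "\<forall>\<^sub>F t in at_top. L2_norm S (\<lambda>x. f x - f\<^sub>0 x) \<le> C * (1 / (2 + t)) powr (2 / 3)"
          using eventually_gt_at_top[of 0] by (rule eventually_mono[rotated])
        moreover have "((\<lambda>t. C * (1 / (2 + t)) powr (2 / 3)) \<longlongrightarrow> 0) (at_top :: real filter)"
        proof -
          have "((\<lambda>t. 1 / (2 + t)) \<longlongrightarrow> 0) (at_top :: real filter)"
            by (rule tendsto_divide_0[OF tendsto_const filterlim_at_top_imp_at_infinity[OF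
                  filterlim_tendsto_add_at_top[OF tendsto_const filterlim_ident]]])
          moreover have "\<forall>\<^sub>F t in at_top. 0 \<le> 1 / (2 + t :: real)"
            using eventually_gt_at_top[of 0] by eventually_elim simp
          ultimately have "((\<lambda>t. (1 / (2 + t)) powr (2 / 3)) \<longlongrightarrow> 0 powr (2 / 3)) (at_top :: real filter)"
            by (intro tendsto_powr') auto
          from tendsto_mult[OF tendsto_const[of C] this] show ?thesis by simp
        qed
        ultimately have "L2_norm S (\<lambda>x. f x - f\<^sub>0 x) \<le> 0"
          by (intro tendsto_lowerbound[of _ 0 at_top]) auto
        thus ?thesis using True by simp
      next
        case False
        have "L2_norm S (\<lambda>x. f x - f\<^sub>0 x) \<le> C * (1 / (2 + ln (1 / L2_operator_norm S ?T))) powr (2 / 3)"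
          by (rule est'[OF nb(4)[OF False] nb(2,3)])
        also have "\<dots> \<le> C * ln (1 / L2_operator_norm S ?T) powr (- 2 / 3)"
          using C by (intro mult_left_mono powr_modulus_le nb(2) nb(4)[OF False]) auto
        finally show ?thesis using False by simp
      qed
    qed
  qed
  show ?thesis
  proof (rule conjI, goal_cases)
    case 1
    show ?case using est[of U] unfolding Let_def by blast
  next
    case 2
    show ?case
    proof (intro allI impI ballI)
      fix f f\<^sub>0 e lam e\<^sub>0 lam\<^sub>0 x
      assume f: "f \<in> C2 S" "f\<^sub>0 \<in> C2 S" and eq: "\<forall>x\<in>S - S\<^sub>0. f x = f\<^sub>0 x"
        and sys: "neumann_eigensystem S f e lam" "neumann_eigensystem S f\<^sub>0 e\<^sub>0 lam\<^sub>0"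
        and P: "L2_operator_eq S (semigroup_op S e lam D) (semigroup_op S e\<^sub>0 lam\<^sub>0 D)" and x: "x \<in> S"
      have "L2_norm S (\<lambda>x. f x - f\<^sub>0 x) \<le> 0"
        using est[of "C2_norm S f + C2_norm S f\<^sub>0"] f eq sys P by fastforce
      hence z: "L2_norm S (\<lambda>x. f x - f\<^sub>0 x) = 0" using L2_norm_nonneg[of S] by (simp add: antisym)
      have c: "continuous_on S (\<lambda>x. f x - f\<^sub>0 x)"
        by (intro continuous_on_diff C2_continuous_partials(1) f)
      have "(\<lambda>x. f x - f\<^sub>0 x) \<in> L2 S" by (intro L2_diff C2_L2 f S)
      from L2_norm_eq_0_imp[OF S(1) c this z x] have "f x - f\<^sub>0 x = 0" .
      thus "f x = f\<^sub>0 x" by simp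
    qed
  qed
qed

end
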